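(* Let $p\in\mathbb C[z,w]$ be a non-zero homogeneous polynomial of total degree $D\ge1$ and let $Y_p=[S_z^*,S_w]=S_z^*S_w-S_wS_z^*$ on $\mathcal Q_p=H^2(\mathbb D^2)\ominus[p]$. Then $Y_p$ is Hilbert--Schmidt and $$\|Y_p\|_{HS}^2=(1-a_q)(1-b_q)+\sum_{n=1}^{\infty}|\alpha_{n-1}|^2(1-a_q\kappa_n^2)(1-b_q\kappa_n^2).$$ Moreover, $$\|Y_p\|_{HS}^2\le1+\sum_{n\ge0}|\alpha_n|^2\le1+\log\frac{\|q\|_2^2}{\mathfrak M(q)^2}\le1+\log\binom{2D}{D}<1+2D\log2 .$$
   Context: $H^2(\mathbb D^2)$ is the Hardy space of the bidisc and $[p]$ the closure of $p\,\mathbb C[z,w]$ in it. $S_z=P_{\mathcal Q_p}M_z|_{\mathcal Q_p}$ and $S_w=P_{\mathcal Q_p}M_w|_{\mathcal Q_p}$ are the compressions of multiplication by $z$ and $w$. $\|\cdot\|_{HS}$ is the Hilbert--Schmidt norm. Write $q(\zeta)=p(\zeta,1)=\sum_{j=0}^Dq_j\zeta^j$ (the coefficients $q_0,q_D$ may vanish), $\|q\|_2$ for the norm of $L^2(\mathbb T,m)$ with $m$ normalized Haar measure, $a_q=|q_0|^2/\|q\|_2^2$, $b_q=|q_D|^2/\|q\|_2^2$, and $\mathfrak M(q)=\exp\left(\int_{\mathbb T}\log|q|\,dm\right)$ for the Mahler measure. Let $d\mu=\frac{|q|^2}{\|q\|_2^2}dm$ on $\mathbb T$, let $(\varphi_n)_{n\ge0}$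 be its orthonormal polynomials with leading coefficients $\kappa_n>0$, $\varphi_n^*(\zeta)=\zeta^n\overline{\varphi_n(1/\overline\zeta)}$, and let the Verblunsky coefficients $\alpha_n\in\mathbb D$ be defined by $\rho_n\varphi_{n+1}(\zeta)=\zeta\varphi_n(\zeta)-\overline{\alpha_n}\varphi_n^*(\zeta)$, $\rho_n=(1-|\alpha_n|^2)^{1/2}$. *)

theory Defs
  imports "HOL-Analysis.Analysis" "HOL-Computational_Algebra.Polynomial"
begin

section \<open>The Hardy space of the bidisc\<close>

text \<open>Elements are genuine functions on the bidisc.  They are extended by \<open>0\<close> to
  all of \<open>complex \<times> complex\<close>, so that equality of functions on the bidisc is equality
  in the logic.\<close>

definition bidisc :: "(complex \<times> complex) set" where
  "bidisc = ball 0 1 \<times> ball 0 1"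

definition square_summable :: "(nat \<times> nat \<Rightarrow> complex) \<Rightarrow> bool" where
  "square_summable a \<longleftrightarrow> (\<lambda>k. (cmod (a k))\<^sup>2) summable_on UNIV"

definition power_series2 :: "(nat \<times> nat \<Rightarrow> complex) \<Rightarrow> complex \<times> complex \<Rightarrow> complex" where
  "power_series2 a = (\<lambda>(z, w). if (z, w) \<in> bidisc
     then (\<Sum>\<^sub>\<infinity>(i, j). a (i, j) * z ^ i * w ^ j) else 0)"

definition hardy2 :: "(complex \<times> complex \<Rightarrow> complex) set" where
  "hardy2 = power_series2 ` {a. square_summable a}"

definition taylor_coeff :: "(complex \<times> complex \<Rightarrow> complex) \<Rightarrow> nat \<times> nat \<Rightarrow> complex" where
  "taylor_coeff f = (THE a. square_summable a \<and> f = power_series2 a)"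

definition hinner :: "(complex \<times> complex \<Rightarrow> complex) \<Rightarrow> (complex \<times> complex \<Rightarrow> complex) \<Rightarrow> complex" where
  "hinner f g = (\<Sum>\<^sub>\<infinity>k. taylor_coeff f k * cnj (taylor_coeff g k))"

definition hnorm :: "(complex \<times> complex \<Rightarrow> complex) \<Rightarrow> real" where
  "hnorm f = sqrt (Re (hinner f f))"

definition hclosure :: "(complex \<times> complex \<Rightarrow> complex) set \<Rightarrow> (complex \<times> complex \<Rightarrow> complex) set" where
  "hclosure A = {f \<in> hardy2. \<forall>e>0. \<exists>g\<in>A. hnorm (\<lambda>x. f x - g x) < e}"

definition horth :: "(complex \<times> complex \<Rightarrow> complex) set \<Rightarrow> (complex \<times> complex \<Rightarrow> complex) set" where
  "horth A = {f \<in> hardy2. \<forall>g\<in>A. hinner f g = 0}"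


section \<open>Operators on closed subspaces of the Hardy space\<close>

definition hproj :: "(complex \<times> complex \<Rightarrow> complex) set
    \<Rightarrow> (complex \<times> complex \<Rightarrow> complex) \<Rightarrow> complex \<times> complex \<Rightarrow> complex" where
  "hproj M f = (THE g. g \<in> M \<and> (\<forall>h\<in>M. hinner (\<lambda>x. f x - g x) h = 0))"

definition compression :: "(complex \<times> complex \<Rightarrow> complex) set
    \<Rightarrow> ((complex \<times> complex \<Rightarrow> complex) \<Rightarrow> complex \<times> complex \<Rightarrow> complex)
    \<Rightarrow> (complex \<times> complex \<Rightarrow> complex) \<Rightarrow> complex \<times> complex \<Rightarrow> complex" where
  "compression M T f = hproj M (T f)"

definition hadjoint :: "(complex \<times> complex \<Rightarrow> complex) set
    \<Rightarrow> ((complex \<times> complex \<Rightarrow> complex) \<Rightarrow> complex \<times> complex \<Rightarrow> complex)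
    \<Rightarrow> (complex \<times> complex \<Rightarrow> complex) \<Rightarrow> complex \<times> complex \<Rightarrow> complex" where
  "hadjoint M T g = (THE h. h \<in> M \<and> (\<forall>f\<in>M. hinner (T f) g = hinner f h))"

definition bounded_operator_on :: "(complex \<times> complex \<Rightarrow> complex) set
    \<Rightarrow> ((complex \<times> complex \<Rightarrow> complex) \<Rightarrow> complex \<times> complex \<Rightarrow> complex) \<Rightarrow> bool" where
  "bounded_operator_on M T \<longleftrightarrow>
     (\<forall>f\<in>M. T f \<in> M) \<and>
     (\<forall>f\<in>M. \<forall>g\<in>M. T (\<lambda>x. f x + g x) = (\<lambda>x. T f x + T g x)) \<and>
     (\<forall>c. \<forall>f\<in>M. T (\<lambda>x. c * f x) = (\<lambda>x. c * T f x)) \<and>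
     (\<exists>C. \<forall>f\<in>M. hnorm (T f) \<le> C * hnorm f)"

definition orthonormal_basis :: "(complex \<times> complex \<Rightarrow> complex) set
    \<Rightarrow> (complex \<times> complex \<Rightarrow> complex) set \<Rightarrow> bool" where
  "orthonormal_basis M E \<longleftrightarrow>
     E \<subseteq> M \<and>
     (\<forall>e\<in>E. \<forall>f\<in>E. hinner e f = (if e = f then 1 else 0)) \<and>
     (\<forall>f\<in>M. (\<forall>e\<in>E. hinner f e = 0) \<longrightarrow> f = (\<lambda>_. 0))"

definition hilbert_schmidt_on :: "(complex \<times> complex \<Rightarrow> complex) set
    \<Rightarrow> ((complex \<times> complex \<Rightarrow> complex) \<Rightarrow> complex \<times> complex \<Rightarrow> complex) \<Rightarrow> bool" where
  "hilbert_schmidt_on M T \<longleftrightarrow> bounded_operator_on M T \<and>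
     (\<exists>E. orthonormal_basis M E \<and> (\<lambda>e. (hnorm (T e))\<^sup>2) summable_on E)"

text \<open>The value does not depend on the orthonormal basis that is chosen.\<close>

definition hs_norm :: "(complex \<times> complex \<Rightarrow> complex) set
    \<Rightarrow> ((complex \<times> complex \<Rightarrow> complex) \<Rightarrow> complex \<times> complex \<Rightarrow> complex) \<Rightarrow> real" where
  "hs_norm M T = sqrt (\<Sum>\<^sub>\<infinity>e\<in>(SOME E. orthonormal_basis M E). (hnorm (T e))\<^sup>2)"


section \<open>Quotient modules\<close>

text \<open>The ring of polynomials in \<open>z, w\<close> is \<open>complex poly poly\<close>, with \<open>w\<close> the outer
  and \<open>z\<close> the inner variable: \<open>coeff (coeff p j) i\<close> is the coefficient of
  \<open>z\<^sup>i w\<^sup>j\<close>.\<close>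

definition eval2 :: "complex poly poly \<Rightarrow> complex \<Rightarrow> complex \<Rightarrow> complex" where
  "eval2 p z w = poly (poly p [:w:]) z"

definition homogeneous2 :: "nat \<Rightarrow> complex poly poly \<Rightarrow> bool" where
  "homogeneous2 D p \<longleftrightarrow> (\<forall>i j. coeff (coeff p j) i \<noteq> 0 \<longrightarrow> i + j = D)"

definition poly_fun :: "complex poly poly \<Rightarrow> complex \<times> complex \<Rightarrow> complex" where
  "poly_fun p = (\<lambda>(z, w). if (z, w) \<in> bidisc then eval2 p z w else 0)"

definition submodule_gen :: "complex poly poly \<Rightarrow> (complex \<times> complex \<Rightarrow> complex) set" where
  "submodule_gen p = hclosure (range (\<lambda>r. poly_fun (p * r)))"

definition quotient_module :: "complex poly poly \<Rightarrow> (complex \<times> complex \<Rightarrow> complex) set" where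
  "quotient_module p = horth (submodule_gen p)"

definition mult_z :: "(complex \<times> complex \<Rightarrow> complex) \<Rightarrow> complex \<times> complex \<Rightarrow> complex" where
  "mult_z f = (\<lambda>(z, w). z * f (z, w))"

definition mult_w :: "(complex \<times> complex \<Rightarrow> complex) \<Rightarrow> complex \<times> complex \<Rightarrow> complex" where
  "mult_w f = (\<lambda>(z, w). w * f (z, w))"

definition S_z :: "complex poly poly \<Rightarrow> (complex \<times> complex \<Rightarrow> complex) \<Rightarrow> complex \<times> complex \<Rightarrow> complex" where
  "S_z p = compression (quotient_module p) mult_z"

definition S_w :: "complex poly poly \<Rightarrow> (complex \<times> complex \<Rightarrow> complex) \<Rightarrow> complex \<times> complex \<Rightarrow> complex" where
  "S_w p = compression (quotient_module p) mult_w"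

definition cross_commutator :: "complex poly poly
    \<Rightarrow> (complex \<times> complex \<Rightarrow> complex) \<Rightarrow> complex \<times> complex \<Rightarrow> complex" where
  "cross_commutator p f = (\<lambda>x.
     hadjoint (quotient_module p) (S_z p) (S_w p f) x -
     S_w p (hadjoint (quotient_module p) (S_z p) f) x)"


section \<open>Orthogonal polynomials on the unit circle\<close>

text \<open>Normalized Haar measure of the unit circle, as a Borel measure on the plane.\<close>

definition haar_circle :: "complex measure" where
  "haar_circle = distr (uniform_measure lborel {0..1::real}) borel (\<lambda>t. cis (2 * pi * t))"

definition L2_norm_circle :: "complex poly \<Rightarrow> real" where
  "L2_norm_circle q = sqrt (\<integral>\<zeta>. (cmod (poly q \<zeta>))\<^sup>2 \<partial>haar_circle)"

text \<open>\<open>ln 0 = 0\<close> in HOL; this affects the integrand only at the finitely many zeros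
  of \<open>q\<close>.\<close>

definition mahler_measure :: "complex poly \<Rightarrow> real" where
  "mahler_measure q = exp (\<integral>\<zeta>. ln (cmod (poly q \<zeta>)) \<partial>haar_circle)"

definition circle_measure :: "complex poly \<Rightarrow> complex measure" where
  "circle_measure q = density haar_circle
     (\<lambda>\<zeta>. ennreal ((cmod (poly q \<zeta>))\<^sup>2 / (L2_norm_circle q)\<^sup>2))"

definition orthonormal_polys :: "complex measure \<Rightarrow> nat \<Rightarrow> complex poly" where
  "orthonormal_polys \<mu> = (THE \<phi>.
     (\<forall>n. degree (\<phi> n) = n \<and> (\<exists>\<kappa>>0. lead_coeff (\<phi> n) = complex_of_real \<kappa>)) \<and>
     (\<forall>m n. (\<integral>\<zeta>. poly (\<phi> m) \<zeta> * cnj (poly (\<phi> n) \<zeta>) \<partial>\<mu>) = (if m = n then 1 else 0)))"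

definition op_kappa :: "complex measure \<Rightarrow> nat \<Rightarrow> real" where
  "op_kappa \<mu> n = Re (lead_coeff (orthonormal_polys \<mu> n))"

text \<open>Only used at \<open>\<zeta> \<noteq> 0\<close>, because of \<open>1 / 0 = 0\<close>.\<close>

definition star_reversed :: "nat \<Rightarrow> complex poly \<Rightarrow> complex \<Rightarrow> complex" where
  "star_reversed n P \<zeta> = \<zeta> ^ n * cnj (poly P (1 / cnj \<zeta>))"

definition verblunsky :: "complex measure \<Rightarrow> nat \<Rightarrow> complex" where
  "verblunsky \<mu> n = (THE \<alpha>. cmod \<alpha> < 1 \<and>
     (\<forall>\<zeta>. \<zeta> \<noteq> 0 \<longrightarrow>
        complex_of_real (sqrt (1 - (cmod \<alpha>)\<^sup>2)) * poly (orthonormal_polys \<mu> (Suc n)) \<zeta> =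
        \<zeta> * poly (orthonormal_polys \<mu> n) \<zeta>
          - cnj \<alpha> * star_reversed n (orthonormal_polys \<mu> n) \<zeta>))"

end

theory Submission
  imports Defs "HOL-Complex_Analysis.Complex_Analysis" "HOL-Real_Asymp.Real_Asymp"
    "HOL-Computational_Algebra.Fundamental_Theorem_Algebra"
begin

text \<open>The Hardy space is graded by homogeneous degree, and in degree \<open>D + m\<close> the submodule \<open>[p]\<close> is
  isometric to the polynomials of degree at most \<open>m\<close> in \<open>L\<^sup>2(\<mu>)\<close>.  For \<open>x\<close> in the quotient module, \<open>w x\<close> is
  orthogonal to \<open>w [p]\<close>, so its component in \<open>[p]\<close> only involves the homogenizations \<open>\<Phi>\<^sub>m\<close> of \<open>q \<phi>\<^sub>m / \<parallel>q\<parallel>\<close>.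
  With \<open>\<Psi>\<^sub>m\<close> the homogenization of \<open>q \<phi>\<^sub>m\<^sup>* / \<parallel>q\<parallel>\<close>, the Szego recursion turns the cross commutator into
  \<open>Y x = - \<langle>x, W \<Phi>\<^sub>0\<rangle> Z \<Psi>\<^sub>0 + (\<Sum>m\<ge>1. cnj \<alpha>\<^bsub>m-1\<^esub> \<langle>x, W \<Phi>\<^sub>m\<rangle> Z \<Psi>\<^sub>m)\<close>,
  where \<open>Z\<close> and \<open>W\<close> are the backward shifts.  The terms are pairwise orthogonal,
  \<open>\<parallel>W \<Phi>\<^sub>m\<parallel>\<^sup>2 = 1 - b \<kappa>\<^sub>m\<^sup>2\<close> and \<open>\<parallel>Z \<Psi>\<^sub>m\<parallel>\<^sup>2 = 1 - a \<kappa>\<^sub>m\<^sup>2\<close>,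
  and Parseval's identity gives the Hilbert-Schmidt norm.  For the bounds,
  \<open>\<kappa>\<^sub>n\<^bsup>-2\<^esup> = (\<Prod>j<n. 1 - \<bar>\<alpha>\<^sub>j\<bar>\<^sup>2)\<close> is the squared norm of the monic orthogonal polynomial, which is at least
  \<open>M(q)\<^sup>2 / \<parallel>q\<parallel>\<^sup>2\<close> by Jensen's inequality and the multiplicativity of the Mahler measure \<open>M\<close>, and
  \<open>\<bar>q\<^sub>j\<bar> \<le> (D choose j) M(q)\<close>.\<close>

section \<open>Hilbert space geometry\<close>

text \<open>The quotient module is invariant under \<open>Z\<close>, so the adjoint of
  \<open>S_z\<close> is \<open>Z\<close> itself and only \<open>S_w\<close> involves an explicit
  projection. Since \<open>Z\<close> commutes with multiplication by \<open>w\<close>, the terms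
  \<open>Z (w x)\<close> of the two products cancel: \<open>Y x\<close> is the submodule component
  of \<open>w (Z x)\<close> minus \<open>Z\<close> applied to that of \<open>w x\<close>. Comparing
  equal degrees, the Szego recursion solved for \<open>z phi_m\<close> leaves one direction per
  degree. The component of \<open>w x\<close> in degree D has no partner, since \<open>Z\<close>
  sends it to degree D - 1, below the submodule; this produces the coefficient -1, the usual
  convention alpha_(-1) = -1. A backward shift drops a single coefficient of a homogeneous vector,
  and this loss is the origin of the factors 1 - a kappa^2 and 1 - b kappa^2. D acts as a formal
  degree throughout, so q_0 and q_D may vanish; zeros of q on the circle are delicate only for log
  |q|. Projections, adjoints and orthogonal polynomials are given by definite descriptions, so each
  of them is exhibited explicitly and shown to be unique.\<close>

lemma orthogonal_decomposition:
  fixes S :: "'a::{real_inner, complete_space} set"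
  assumes "closed S" and S: "subspace S"
  obtains y where "y \<in> S" and "\<And>s. s \<in> S \<Longrightarrow> (x - y) \<bullet> s = 0"
proof -
  define d where "d = (INF s\<in>S. (norm (x - s))\<^sup>2)"
  have ne: "S \<noteq> {}" using subspace_0[OF S] by auto
  have bdd: "bdd_below ((\<lambda>s. (norm (x - s))\<^sup>2) ` S)"
    by (rule bdd_belowI[of _ 0]) auto
  have d_le: "d \<le> (norm (x - s))\<^sup>2" if "s \<in> S" for s
    unfolding d_def using bdd that by (rule cINF_lower)
  have "\<exists>s\<in>S. (norm (x - s))\<^sup>2 < d + inverse (real (Suc n))" for n
  proof -
    have "d < d + inverse (real (Suc n))" by simp
    then show ?thesis
      unfolding d_def using cINF_less_iff[OF ne bdd] by blast
  qed
  then obtain y where y: "\<And>n. y n \<in> S"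
    and y_less: "\<And>n. (norm (x - y n))\<^sup>2 < d + inverse (real (Suc n))"
    by metis
  \<comment> \<open>Parallelogram law: the midpoint of two elements of \<open>S\<close> is again at
    squared distance at least \<open>d\<close> from \<open>x\<close>, which makes every minimizing
    sequence Cauchy.\<close>
  have par: "(norm (y m - y n))\<^sup>2 \<le> 2 * inverse (real (Suc m)) + 2 * inverse (real (Suc n))" for m n
  proof -
    have mid: "(1/2) *\<^sub>R (y m + y n) \<in> S"
      using y S by (simp add: subspace_add subspace_scale)
    have "(norm (y m - y n))\<^sup>2 = 2 * (norm (x - y m))\<^sup>2 + 2 * (norm (x - y n))\<^sup>2
        - 4 * (norm (x - (1/2) *\<^sub>R (y m + y n)))\<^sup>2"
      by (simp add: power2_norm_eq_inner inner_diff_left inner_diff_right inner_add_left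
          inner_add_right inner_commute algebra_simps)
    with d_le[OF mid] y_less[of m] y_less[of n] show ?thesis by linarith
  qed
  have "Cauchy y"
  proof (rule metric_CauchyI)
    fix e :: real assume "0 < e"
    then obtain N where N: "inverse (real (Suc N)) < e\<^sup>2 / 4"
      using reals_Archimedean[of "e\<^sup>2/4"] by auto
    have "dist (y m) (y n) < e" if "m \<ge> N" "n \<ge> N" for m n
    proof -
      have "inverse (real (Suc m)) \<le> inverse (real (Suc N))" "inverse (real (Suc n)) \<le> inverse (real (Suc N))"
        using that by (auto simp: field_simps)
      with par[of m n] N have "(norm (y m - y n))\<^sup>2 < e\<^sup>2" by linarith
      then show ?thesis
        using \<open>0 < e\<close> by (simp add: dist_norm power2_less_imp_less)
    qed
    then show "\<exists>M. \<forall>m\<ge>M. \<forall>n\<ge>M. dist (y m) (y n) < e" by blast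
  qed
  then obtain l where l: "y \<longlonglongrightarrow> l"
    using Cauchy_convergent convergent_def by blast
  have lS: "l \<in> S" using closed_sequentially[OF \<open>closed S\<close> y l] .
  have l_le: "(norm (x - l))\<^sup>2 \<le> d"
  proof -
    have "(\<lambda>n. (norm (x - y n))\<^sup>2) \<longlonglongrightarrow> (norm (x - l))\<^sup>2"
      by (intro tendsto_intros l)
    moreover have "(\<lambda>n. d + inverse (real (Suc n))) \<longlonglongrightarrow> d + 0"
      by (intro tendsto_intros LIMSEQ_inverse_real_of_nat)
    ultimately show ?thesis
      using y_less LIMSEQ_le[of "\<lambda>n. (norm (x - y n))\<^sup>2" "(norm (x - l))\<^sup>2"
          "\<lambda>n. d + inverse (real (Suc n))" d] by (simp add: less_imp_le)
  qed
  have "(x - l) \<bullet> s = 0" if "s \<in> S" for s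
  proof (cases "s = 0")
    case False
    \<comment> \<open>The optimal step along \<open>s\<close>: moving the minimizer by
      \<open>c *\<^sub>R s\<close> would lower the squared distance by
      \<open>((x - l) \<bullet> s)\<^sup>2 / (s \<bullet> s)\<close>, so this quantity has to
      vanish.\<close>
    define c where "c = ((x - l) \<bullet> s) / (s \<bullet> s)"
    have pos: "s \<bullet> s > 0" using False by simp
    have "l + c *\<^sub>R s \<in> S" using lS that S by (simp add: subspace_add subspace_scale)
    from d_le[OF this] l_le have "(norm (x - l))\<^sup>2 \<le> (norm ((x - l) - c *\<^sub>R s))\<^sup>2"
      unfolding diff_diff_eq by linarith
    also have "\<dots> = (norm (x - l))\<^sup>2 - 2 * c * ((x - l) \<bullet> s) + c\<^sup>2 * (s \<bullet> s)"
      unfolding power2_norm_eq_inner inner_diff_left[of "x - l"] inner_diff_right[of _ "x - l"]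
        inner_commute[of "c *\<^sub>R s" "x - l"]
      by (simp add: power2_eq_square algebra_simps)
    also have "\<dots> = (norm (x - l))\<^sup>2 - ((x - l) \<bullet> s)\<^sup>2 / (s \<bullet> s)"
      using pos by (simp add: c_def power2_eq_square field_simps)
    finally have "((x - l) \<bullet> s)\<^sup>2 / (s \<bullet> s) \<le> 0" by simp
    then show ?thesis using pos by (simp add: divide_le_0_iff)
  qed simp
  with lS show ?thesis by (rule that)
qed

text \<open>Completing the square. The choice \<open>c e = x \<bullet> e\<close> yields Bessel's
  inequality, and for arbitrary \<open>c\<close> the identity says that no combination approximates
  better than the Fourier sum.\<close>

lemma norm_diff_orthonormal_combination:
  fixes x :: "'a::real_inner"
  assumes "finite F" and "\<And>e f. e \<in> F \<Longrightarrow> f \<in> F \<Longrightarrow> e \<bullet> f = (if e = f then 1 else 0)"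
  shows "(norm (x - (\<Sum>e\<in>F. c e *\<^sub>R e)))\<^sup>2
    = (norm x)\<^sup>2 - (\<Sum>e\<in>F. (x \<bullet> e)\<^sup>2) + (\<Sum>e\<in>F. (c e - x \<bullet> e)\<^sup>2)"
proof -
  have "(\<Sum>e\<in>F. c e *\<^sub>R e) \<bullet> (\<Sum>e\<in>F. c e *\<^sub>R e) = (\<Sum>e\<in>F. \<Sum>f\<in>F. c e * (c f * (e \<bullet> f)))"
    by (subst inner_sum_left, intro sum.cong refl) (simp add: inner_sum_right sum_distrib_left mult.left_commute)
  also have "\<dots> = (\<Sum>e\<in>F. \<Sum>f\<in>F. if e = f then c e * c f else 0)"
    by (intro sum.cong refl) (auto simp: assms(2))
  also have "\<dots> = (\<Sum>e\<in>F. (c e)\<^sup>2)"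
    using assms(1) by (simp add: sum.delta power2_eq_square)
  finally have sq: "(\<Sum>e\<in>F. c e *\<^sub>R e) \<bullet> (\<Sum>e\<in>F. c e *\<^sub>R e) = (\<Sum>e\<in>F. (c e)\<^sup>2)" .
  have xs: "x \<bullet> (\<Sum>e\<in>F. c e *\<^sub>R e) = (\<Sum>e\<in>F. c e * (x \<bullet> e))"
    by (simp add: inner_sum_right)
  show ?thesis
    unfolding power2_norm_eq_inner inner_diff_left[of x] inner_diff_right[of _ x]
      inner_commute[of "\<Sum>e\<in>F. c e *\<^sub>R e" x] sq xs
    by (simp add: power2_diff sum.distrib sum_subtractf sum_distrib_left sum_negf mult.assoc)
qed

text \<open>Bessel bounds the partial sums from above. From below, every finite \<open>F\<close>
  that contains the support of a good approximant \<open>v\<close> does at least as well as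
  \<open>v\<close>, which is exactly convergence along finite subsets.\<close>

lemma parseval_closure_span:
  fixes x :: "'a::real_inner"
  assumes on: "\<And>e f. e \<in> E \<Longrightarrow> f \<in> E \<Longrightarrow> e \<bullet> f = (if e = f then 1 else 0)"
    and x: "x \<in> closure (span E)"
  shows "((\<lambda>e. (x \<bullet> e)\<^sup>2) has_sum (norm x)\<^sup>2) E"
  unfolding has_sum_def tendsto_iff
proof safe
  fix r :: real assume "0 < r"
  then obtain v where v: "v \<in> span E" "dist v x < sqrt r"
    using x closure_approachable[of x "span E"] by (meson real_sqrt_gt_zero)
  then obtain T c where T: "finite T" "T \<subseteq> E" "v = (\<Sum>e\<in>T. c e *\<^sub>R e)"
    by (auto simp: span_explicit)
  have "dist (\<Sum>e\<in>F. (x \<bullet> e)\<^sup>2) ((norm x)\<^sup>2) < r" if F: "finite F" "T \<subseteq> F" "F \<subseteq> E" for F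
  proof -
    have on_F: "e \<bullet> f = (if e = f then 1 else 0)" if "e \<in> F" "f \<in> F" for e f
      using on that F by blast
    define c' where "c' e = (if e \<in> T then c e else 0)" for e
    have "v = (\<Sum>e\<in>F. c' e *\<^sub>R e)"
      unfolding T(3) c'_def using F by (intro sum.mono_neutral_cong_left) auto
    then have "(norm (x - v))\<^sup>2 \<ge> (norm x)\<^sup>2 - (\<Sum>e\<in>F. (x \<bullet> e)\<^sup>2)"
      using norm_diff_orthonormal_combination[OF F(1) on_F, of x c'] by (simp add: sum_nonneg)
    moreover have "(norm (x - v))\<^sup>2 < r"
    proof -
      have "norm (x - v) < sqrt r" using v(2) by (simp add: dist_norm norm_minus_commute)
      then have "(norm (x - v))\<^sup>2 < (sqrt r)\<^sup>2" by (intro power_strict_mono) auto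
      then show ?thesis using \<open>0 < r\<close> by simp
    qed
    moreover have "(\<Sum>e\<in>F. (x \<bullet> e)\<^sup>2) \<le> (norm x)\<^sup>2"
      using norm_diff_orthonormal_combination[OF F(1) on_F, of x "\<lambda>e. x \<bullet> e"]
        zero_le_power2[of "norm (x - (\<Sum>e\<in>F. (x \<bullet> e) *\<^sub>R e))"] by auto
    ultimately show ?thesis by (simp add: dist_real_def)
  qed
  with T show "\<forall>\<^sub>F F in finite_subsets_at_top E. dist (\<Sum>e\<in>F. (x \<bullet> e)\<^sup>2) ((norm x)\<^sup>2) < r"
    unfolding eventually_finite_subsets_at_top by blast
qed

text \<open>By Pythagoras the squared norm of a block of the series is a block of the series of
  squared norms, so Cauchy's criterion transfers.\<close>

lemma summable_orthogonal:
  fixes v :: "nat \<Rightarrow> 'a::{real_inner, complete_space}"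
  assumes orth: "\<And>m n. m \<noteq> n \<Longrightarrow> v m \<bullet> v n = 0"
    and sum: "summable (\<lambda>n. (norm (v n))\<^sup>2)"
  shows "summable v" and "(norm (suminf v))\<^sup>2 = (\<Sum>n. (norm (v n))\<^sup>2)"
proof -
  have pyth: "(norm (sum v I))\<^sup>2 = (\<Sum>n\<in>I. (norm (v n))\<^sup>2)" if "finite I" for I
    using that orth by (intro norm_sum_Pythagorean) (auto simp: pairwise_def orthogonal_def)
  have partial: "Cauchy (\<lambda>n. sum v {..<n})"
  proof (rule metric_CauchyI)
    fix e :: real assume "0 < e"
    then obtain N where N: "\<And>m n. m \<ge> N \<Longrightarrow> norm (\<Sum>k=m..<n. (norm (v k))\<^sup>2) < e\<^sup>2"
      using sum unfolding summable_Cauchy by (meson zero_less_power)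
    have half: "dist (sum v {..<m}) (sum v {..<n}) < e" if "m \<ge> N" "m \<le> n" for m n
    proof -
      have "sum v {..<n} - sum v {..<m} = sum v {m..<n}"
        using that by (simp add: sum_diff_nat_ivl[of 0, simplified atLeast0LessThan])
      then have "(dist (sum v {..<m}) (sum v {..<n}))\<^sup>2 = (\<Sum>k=m..<n. (norm (v k))\<^sup>2)"
        by (metis dist_norm dist_commute pyth finite_atLeastLessThan)
      also have "\<dots> < e\<^sup>2" using N[OF that(1), of n] by (simp add: sum_nonneg)
      finally show ?thesis using \<open>0 < e\<close> by (simp add: power2_less_imp_less)
    qed
    then show "\<exists>M. \<forall>m\<ge>M. \<forall>n\<ge>M. dist (sum v {..<m}) (sum v {..<n}) < e"
      by (metis dist_commute nat_le_linear)
  qed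
  then show summ: "summable v"
    by (simp add: Cauchy_convergent summable_iff_convergent)
  have "(\<lambda>n. (norm (sum v {..<n}))\<^sup>2) \<longlonglongrightarrow> (norm (suminf v))\<^sup>2"
    by (intro tendsto_intros summable_LIMSEQ summ)
  moreover have "(\<lambda>n. (norm (sum v {..<n}))\<^sup>2) \<longlonglongrightarrow> (\<Sum>n. (norm (v n))\<^sup>2)"
    using summable_LIMSEQ[OF sum] by (simp add: pyth)
  ultimately show "(norm (suminf v))\<^sup>2 = (\<Sum>n. (norm (v n))\<^sup>2)"
    by (rule LIMSEQ_unique)
qed

section \<open>Square-summable families\<close>

text \<open>The sequence model in which all Hilbert space arguments take place; \<open>hfun\<close>
  later identifies it with the Hardy space by Taylor coefficients.\<close>

typedef 'a ell2 = "{a :: 'a \<Rightarrow> complex. (\<lambda>k. (cmod (a k))\<^sup>2) summable_on UNIV}"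
  by (rule exI[of _ "\<lambda>_. 0"]) simp

setup_lifting type_definition_ell2

lemma summable_norm_sq_add:
  fixes a b :: "'a \<Rightarrow> complex"
  assumes "(\<lambda>k. (cmod (a k))\<^sup>2) summable_on A" "(\<lambda>k. (cmod (b k))\<^sup>2) summable_on A"
  shows "(\<lambda>k. (cmod (a k + b k))\<^sup>2) summable_on A"
proof (rule summable_on_comparison_test)
  show "(\<lambda>k. 2 * (cmod (a k))\<^sup>2 + 2 * (cmod (b k))\<^sup>2) summable_on A"
    by (intro summable_on_add summable_on_cmult_right assms)
  show "(cmod (a k + b k))\<^sup>2 \<le> 2 * (cmod (a k))\<^sup>2 + 2 * (cmod (b k))\<^sup>2" for k
  proof -
    have "(cmod (a k + b k))\<^sup>2 \<le> (cmod (a k) + cmod (b k))\<^sup>2"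
      by (intro power_mono norm_triangle_ineq) auto
    also have "\<dots> \<le> 2 * (cmod (a k))\<^sup>2 + 2 * (cmod (b k))\<^sup>2"
      using zero_le_power2[of "cmod (a k) - cmod (b k)"] by (simp add: power2_diff power2_sum)
    finally show ?thesis .
  qed
qed auto

lemma summable_norm_sq_scale:
  fixes a :: "'a \<Rightarrow> complex"
  assumes "(\<lambda>k. (cmod (a k))\<^sup>2) summable_on A"
  shows "(\<lambda>k. (cmod (c * a k))\<^sup>2) summable_on A"
  using summable_on_cmult_right[OF assms, of "(cmod c)\<^sup>2"] by (simp add: norm_mult power_mult_distrib)

lemma summable_mult_cnj:
  fixes a b :: "'a \<Rightarrow> complex"
  assumes "(\<lambda>k. (cmod (a k))\<^sup>2) summable_on A" "(\<lambda>k. (cmod (b k))\<^sup>2) summable_on A"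
  shows "(\<lambda>k. a k * cnj (b k)) summable_on A"
proof (rule abs_summable_summable)
  have "(\<lambda>k. cmod (a k * cnj (b k))) summable_on A"
  proof (rule summable_on_comparison_test)
    show "(\<lambda>k. (cmod (a k))\<^sup>2 + (cmod (b k))\<^sup>2) summable_on A"
      by (intro summable_on_add assms)
    show "cmod (a k * cnj (b k)) \<le> (cmod (a k))\<^sup>2 + (cmod (b k))\<^sup>2" for k
    proof -
      have "0 \<le> cmod (a k) * cmod (b k)" by simp
      with sum_squares_bound[of "cmod (a k)" "cmod (b k)"] show ?thesis
        unfolding norm_mult complex_mod_cnj by linarith
    qed
  qed auto
  then show "(\<lambda>k. norm (a k * cnj (b k))) summable_on A" .
qed

section \<open>Complex structure of the sequence space\<close>

lift_definition coord :: "'a ell2 \<Rightarrow> 'a \<Rightarrow> complex" is "\<lambda>a. a" .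

text \<open>The class \<open>real_inner\<close> only knows the real inner product
  \<open>Re (cinner x y)\<close>. Complex scalars are therefore a separate operation, and the
  imaginary part is recovered as \<open>x \<bullet> cscale \<i> y\<close>.\<close>

lift_definition cscale :: "complex \<Rightarrow> 'a ell2 \<Rightarrow> 'a ell2" is "\<lambda>c a k. c * a k"
  by (rule summable_norm_sq_scale)

definition cinner :: "'a ell2 \<Rightarrow> 'a ell2 \<Rightarrow> complex" where
  "cinner x y = (\<Sum>\<^sub>\<infinity>k. coord x k * cnj (coord y k))"

lemma summable_coord: "(\<lambda>k. (cmod (coord x k))\<^sup>2) summable_on UNIV"
  by transfer

lemma ell2_eqI: "(\<And>k. coord x k = coord y k) \<Longrightarrow> x = y"
  by transfer auto

lemma summable_cinner: "(\<lambda>k. coord x k * cnj (coord y k)) summable_on UNIV"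
  by (intro summable_mult_cnj summable_coord)

lemma coord_cscale [simp]: "coord (cscale c x) k = c * coord x k"
  by transfer auto

lemma cinner_commute: "cinner y x = cnj (cinner x y)"
  unfolding cinner_def by (simp flip: infsum_cnj add: mult.commute)

lemma cinner_cscale_left [simp]: "cinner (cscale c x) y = c * cinner x y"
  unfolding cinner_def by (simp add: infsum_cmult_right' mult.assoc)

lemma cinner_cscale_right [simp]: "cinner x (cscale c y) = cnj c * cinner x y"
  by (metis cinner_commute cinner_cscale_left complex_cnj_mult)

lemma cinner_self: "cinner x x = complex_of_real (\<Sum>\<^sub>\<infinity>k. (cmod (coord x k))\<^sup>2)"
proof -
  have "((\<lambda>k. complex_of_real ((cmod (coord x k))\<^sup>2)) has_sum
      complex_of_real (\<Sum>\<^sub>\<infinity>k. (cmod (coord x k))\<^sup>2)) UNIV"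
    by (intro has_sum_of_real has_sum_infsum summable_coord)
  then show ?thesis
    unfolding cinner_def complex_norm_square by (rule infsumI)
qed

instantiation ell2 :: (type) real_inner
begin

lift_definition zero_ell2 :: "'a ell2" is "\<lambda>_. 0" by simp
lift_definition plus_ell2 :: "'a ell2 \<Rightarrow> 'a ell2 \<Rightarrow> 'a ell2" is "\<lambda>a b k. a k + b k"
  by (rule summable_norm_sq_add)
lift_definition uminus_ell2 :: "'a ell2 \<Rightarrow> 'a ell2" is "\<lambda>a k. - a k" by simp
definition minus_ell2 :: "'a ell2 \<Rightarrow> 'a ell2 \<Rightarrow> 'a ell2" where "minus_ell2 x y = x + - y"
definition scaleR_ell2 :: "real \<Rightarrow> 'a ell2 \<Rightarrow> 'a ell2" where
  "scaleR_ell2 r x = cscale (complex_of_real r) x"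
definition inner_ell2 :: "'a ell2 \<Rightarrow> 'a ell2 \<Rightarrow> real" where "inner_ell2 x y = Re (cinner x y)"
definition norm_ell2 :: "'a ell2 \<Rightarrow> real" where "norm_ell2 x = sqrt (inner x x)"
definition sgn_ell2 :: "'a ell2 \<Rightarrow> 'a ell2" where "sgn_ell2 x = scaleR (inverse (norm x)) x"
definition dist_ell2 :: "'a ell2 \<Rightarrow> 'a ell2 \<Rightarrow> real" where "dist_ell2 x y = norm (x - y)"
definition uniformity_ell2 :: "('a ell2 \<times> 'a ell2) filter" where
  "uniformity_ell2 = (INF e\<in>{0<..}. principal {(x, y). dist x y < e})"
definition open_ell2 :: "'a ell2 set \<Rightarrow> bool" where
  "open_ell2 S = (\<forall>x\<in>S. \<forall>\<^sub>F (x', y) in uniformity. x' = x \<longrightarrow> y \<in> S)"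

lemma coord_zero [simp]: "coord 0 k = 0" by transfer auto
lemma coord_add [simp]: "coord (x + y) k = coord x k + coord y k" by transfer auto
lemma coord_minus [simp]: "coord (- x) k = - coord x k" by transfer auto

lemma cinner_add_left: "cinner (x + y) z = cinner x z + cinner y z"
  unfolding cinner_def by (simp add: distrib_right infsum_add summable_cinner)

instance
proof
  fix x y z :: "'a ell2" and r s :: real
  show "x + y + z = x + (y + z)" "x + y = y + x" "0 + x = x" "- x + x = 0"
    by (auto intro!: ell2_eqI simp: add.assoc add.commute)
  show "x - y = x + - y" by (simp add: minus_ell2_def)
  show "r *\<^sub>R (x + y) = r *\<^sub>R x + r *\<^sub>R y" "(r + s) *\<^sub>R x = r *\<^sub>R x + s *\<^sub>R x"
    "r *\<^sub>R s *\<^sub>R x = (r * s) *\<^sub>R x" "1 *\<^sub>R x = x"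
    by (auto intro!: ell2_eqI simp: scaleR_ell2_def distrib_left distrib_right mult.assoc)
  show "sgn x = inverse (norm x) *\<^sub>R x" by (simp add: sgn_ell2_def)
  show "dist x y = norm (x - y)" by (simp add: dist_ell2_def)
  show "uniformity = (INF e\<in>{0<..}. principal {(x :: 'a ell2, y). dist x y < e})"
    by (rule uniformity_ell2_def)
  show "open U = (\<forall>x\<in>U. \<forall>\<^sub>F (x', y) in uniformity. x' = x \<longrightarrow> y \<in> U)" for U :: "'a ell2 set"
    by (rule open_ell2_def)
  show "inner x y = inner y x"
    by (metis cinner_commute inner_ell2_def complex_cnj(1) cnj.simps(1))
  show "inner (x + y) z = inner x z + inner y z"
    by (simp add: inner_ell2_def cinner_add_left)
  show "inner (r *\<^sub>R x) y = r * inner x y"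
    by (simp add: inner_ell2_def scaleR_ell2_def)
  show "0 \<le> inner x x"
    by (simp add: inner_ell2_def cinner_self infsum_nonneg)
  show "(inner x x = 0) = (x = 0)"
  proof
    assume "inner x x = 0"
    then have z: "(\<Sum>\<^sub>\<infinity>k. (cmod (coord x k))\<^sup>2) = 0" by (simp add: inner_ell2_def cinner_self)
    have "(cmod (coord x k))\<^sup>2 = 0" for k
      using nonneg_infsum_le_0D[of "\<lambda>k. (cmod (coord x k))\<^sup>2" UNIV k] z summable_coord[of x] by auto
    then show "x = 0" by (auto intro!: ell2_eqI)
  qed (simp add: inner_ell2_def cinner_self)
  show "norm x = sqrt (inner x x)" by (rule norm_ell2_def)
qed

end

lemma coord_diff [simp]: "coord (x - y) k = coord x k - coord y k"
  unfolding minus_ell2_def coord_add coord_minus by simp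

lemma coord_scaleR [simp]: "coord (r *\<^sub>R x) k = complex_of_real r * coord x k"
  by (simp add: scaleR_ell2_def)

lemma cinner_diff_left: "cinner (x - y) z = cinner x z - cinner y z"
  using cinner_add_left[of "x - y" y z] by simp

lemma cinner_add_right: "cinner z (x + y) = cinner z x + cinner z y"
  by (metis cinner_add_left cinner_commute complex_cnj_add)

lemma cinner_diff_right: "cinner z (x - y) = cinner z x - cinner z y"
  by (metis cinner_diff_left cinner_commute complex_cnj_diff)

lemma cinner_zero [simp]: "cinner 0 x = 0" "cinner x 0 = 0"
  by (simp_all add: cinner_def)

lemma cinner_sum_left: "cinner (sum f A) x = (\<Sum>i\<in>A. cinner (f i) x)"
  by (induction A rule: infinite_finite_induct) (auto simp: cinner_add_left)

lemma cinner_sum_right: "cinner x (sum f A) = (\<Sum>i\<in>A. cinner x (f i))"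
  by (induction A rule: infinite_finite_induct) (auto simp: cinner_add_right)

lemma norm_sq_ell2: "(norm x)\<^sup>2 = (\<Sum>\<^sub>\<infinity>k. (cmod (coord x k))\<^sup>2)"
  by (simp add: power2_norm_eq_inner inner_ell2_def cinner_self)

lemma cinner_self_norm: "cinner x x = complex_of_real ((norm x)\<^sup>2)"
  by (simp add: cinner_self norm_sq_ell2)

lemma Re_cinner: "Re (cinner x y) = x \<bullet> y"
  by (simp add: inner_ell2_def)

lemma Im_cinner: "Im (cinner x y) = x \<bullet> cscale \<i> y"
  by (simp add: inner_ell2_def)

lemma cinner_eq: "cinner x y = Complex (x \<bullet> y) (x \<bullet> cscale \<i> y)"
  by (simp add: complex_eq_iff Re_cinner Im_cinner)

lemma norm_cscale [simp]: "norm (cscale c x) = cmod c * norm x"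
proof -
  have "(norm (cscale c x))\<^sup>2 = (cmod c * norm x)\<^sup>2"
    unfolding norm_sq_ell2 by (simp add: norm_mult power_mult_distrib infsum_cmult_right' norm_sq_ell2)
  then show ?thesis by simp
qed

lemma cscale_add: "cscale c (x + y) = cscale c x + cscale c y"
  by (auto intro!: ell2_eqI simp: distrib_left)

lemma bounded_linear_cscale: "bounded_linear (cscale c)"
  by (rule bounded_linear_intro[where K = "cmod c"])
     (auto intro!: ell2_eqI simp: distrib_left)

text \<open>Rotating \<open>x\<close> by a unimodular number makes the complex product real and
  nonnegative, which reduces the claim to the real Cauchy-Schwarz inequality.\<close>

lemma norm_cinner_le: "cmod (cinner x y) \<le> norm x * norm y"
proof (cases "cinner x y = 0")
  case False
  define u where "u = cnj (sgn (cinner x y))"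
  have "cinner (cscale u x) y = complex_of_real (cmod (cinner x y))"
    using False by (simp add: u_def sgn_eq complex_norm_square[symmetric] power2_eq_square mult.commute)
  then have "cmod (cinner x y) = cscale u x \<bullet> y"
    by (metis Re_cinner Re_complex_of_real)
  also have "\<dots> \<le> norm (cscale u x) * norm y" by (rule norm_cauchy_schwarz)
  also have "\<dots> = norm x * norm y" using False by (simp add: u_def norm_sgn)
  finally show ?thesis .
qed simp

lemma bounded_linear_cinner_left: "bounded_linear (\<lambda>x. cinner x y)"
  by (rule bounded_linear_intro[where K = "norm y"])
     (auto simp: cinner_add_left scaleR_ell2_def norm_cinner_le scaleR_conv_of_real)

lemma cmod_coord_le: "cmod (coord x k) \<le> norm x"
proof -
  have "(cmod (coord x k))\<^sup>2 \<le> (norm x)\<^sup>2"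
    unfolding norm_sq_ell2
    using infsum_mono_neutral[of "\<lambda>k. (cmod (coord x k))\<^sup>2" "{k}" "\<lambda>k. (cmod (coord x k))\<^sup>2" UNIV]
      summable_coord[of x] by simp
  then show ?thesis by simp
qed

text \<open>Coordinates are bounded by the norm, hence converge. Bounds on finite partial sums
  survive the coordinatewise limit; they show both that the limit is square-summable and that
  convergence holds in norm.\<close>

instance ell2 :: (type) complete_space
proof
  fix X :: "nat \<Rightarrow> 'a ell2"
  assume C: "Cauchy X"
  have "Cauchy (\<lambda>n. coord (X n) k)" for k
  proof (rule metric_CauchyI)
    fix e :: real assume "0 < e"
    then obtain N where N: "\<And>m n. m \<ge> N \<Longrightarrow> n \<ge> N \<Longrightarrow> dist (X m) (X n) < e"
      using metric_CauchyD[OF C] by blast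
    have "dist (coord (X m) k) (coord (X n) k) < e" if "m \<ge> N" "n \<ge> N" for m n
      using N[OF that] cmod_coord_le[of "X m - X n" k] by (simp add: dist_norm)
    then show "\<exists>M. \<forall>m\<ge>M. \<forall>n\<ge>M. dist (coord (X m) k) (coord (X n) k) < e" by blast
  qed
  then obtain a where a: "\<And>k. (\<lambda>n. coord (X n) k) \<longlonglongrightarrow> a k"
    unfolding Cauchy_convergent_iff convergent_def by metis
  have fin: "(\<Sum>k\<in>K. (cmod (coord (X n) k - a k))\<^sup>2) \<le> e\<^sup>2"
    if K: "finite K" and e: "\<And>m. m \<ge> N \<Longrightarrow> dist (X n) (X m) < e" for K n N e
  proof (rule LIMSEQ_le_const2)
    show "(\<lambda>m. \<Sum>k\<in>K. (cmod (coord (X n) k - coord (X m) k))\<^sup>2)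
        \<longlonglongrightarrow> (\<Sum>k\<in>K. (cmod (coord (X n) k - a k))\<^sup>2)"
      by (intro tendsto_intros a)
    have "(\<Sum>k\<in>K. (cmod (coord (X n) k - coord (X m) k))\<^sup>2) \<le> e\<^sup>2" if "m \<ge> N" for m
    proof -
      have "(\<Sum>k\<in>K. (cmod (coord (X n - X m) k))\<^sup>2) \<le> (norm (X n - X m))\<^sup>2"
        unfolding norm_sq_ell2 by (rule finite_sum_le_infsum) (use K summable_coord[of "X n - X m"] in auto)
      also have "\<dots> \<le> e\<^sup>2"
        using e[OF that] by (intro power_mono) (auto simp: dist_norm)
      finally show ?thesis by simp
    qed
    then show "\<exists>N. \<forall>m\<ge>N. (\<Sum>k\<in>K. (cmod (coord (X n) k - coord (X m) k))\<^sup>2) \<le> e\<^sup>2" by blast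
  qed
  have summ: "(\<lambda>k. (cmod (coord (X n) k - a k))\<^sup>2) summable_on UNIV"
    and le: "(\<Sum>\<^sub>\<infinity>k. (cmod (coord (X n) k - a k))\<^sup>2) \<le> e\<^sup>2"
    if e: "\<And>m. m \<ge> N \<Longrightarrow> dist (X n) (X m) < e" for n N e
  proof -
    show 1: "(\<lambda>k. (cmod (coord (X n) k - a k))\<^sup>2) summable_on UNIV"
    proof (rule nonneg_bdd_above_summable_on)
      show "bdd_above (sum (\<lambda>k. (cmod (coord (X n) k - a k))\<^sup>2) ` {F. F \<subseteq> UNIV \<and> finite F})"
        using fin[OF _ e] by (intro bdd_aboveI[of _ "e\<^sup>2"]) blast
    qed auto
    show "(\<Sum>\<^sub>\<infinity>k. (cmod (coord (X n) k - a k))\<^sup>2) \<le> e\<^sup>2"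
      by (rule infsum_le_finite_sums[OF 1]) (rule fin[OF _ e])
  qed
  obtain M where M: "\<And>m n. m \<ge> M \<Longrightarrow> n \<ge> M \<Longrightarrow> dist (X m) (X n) < 1"
    using metric_CauchyD[OF C, of 1] by auto
  \<comment> \<open>The limit \<open>a\<close> written as \<open>X M\<close> minus the
    square-summable difference \<open>X M - a\<close>.\<close>
  have "(\<lambda>k. (cmod (coord (X M) k + (-1) * (coord (X M) k - a k)))\<^sup>2) summable_on UNIV"
    by (intro summable_norm_sq_add summable_norm_sq_scale summable_coord summ[of M M 1] M) auto
  then have "(\<lambda>k. (cmod (a k))\<^sup>2) summable_on UNIV" by simp
  then obtain x where x: "\<And>k. coord x k = a k"
    by (metis Abs_ell2_inverse coord.rep_eq mem_Collect_eq)
  have "X \<longlonglongrightarrow> x"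
  proof (rule metric_LIMSEQ_I)
    fix e :: real assume "0 < e"
    then obtain N where N: "\<And>m n. m \<ge> N \<Longrightarrow> n \<ge> N \<Longrightarrow> dist (X m) (X n) < e / 2"
      using metric_CauchyD[OF C, of "e / 2"] by auto
    have "dist (X n) x < e" if "n \<ge> N" for n
    proof -
      have "(norm (X n - x))\<^sup>2 \<le> (e/2)\<^sup>2"
        unfolding norm_sq_ell2 using le[of N n "e/2"] N that by (simp add: x)
      then have "norm (X n - x) \<le> e / 2"
        using \<open>0 < e\<close> by (auto intro: power2_le_imp_le)
      then show ?thesis using \<open>0 < e\<close> by (simp add: dist_norm)
    qed
    then show "\<exists>N. \<forall>n\<ge>N. dist (X n) x < e" by blast
  qed
  then show "convergent X" by (rule convergentI)
qed

section \<open>Orthonormal bases of complex subspaces\<close>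

lemma subspace_closure:
  fixes S :: "'a::real_normed_vector set"
  assumes "subspace S"
  shows "subspace (closure S)"
proof (rule subspaceI)
  show "0 \<in> closure S"
    using subspace_0[OF assms] closure_subset by blast
next
  fix x y assume "x \<in> closure S" "y \<in> closure S"
  then obtain f g where "\<And>n. f n \<in> S" "f \<longlonglongrightarrow> x" "\<And>n. g n \<in> S" "g \<longlonglongrightarrow> y"
    unfolding closure_sequential by blast
  then have "(\<lambda>n. f n + g n) \<longlonglongrightarrow> x + y" "\<And>n. f n + g n \<in> S"
    using assms by (auto intro: tendsto_add subspace_add)
  then show "x + y \<in> closure S"
    unfolding closure_sequential by (intro exI[of _ "\<lambda>n. f n + g n"]) blast
next
  fix c x assume "x \<in> closure S"
  then obtain f where "\<And>n. f n \<in> S" "f \<longlonglongrightarrow> x"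
    unfolding closure_sequential by blast
  then have "(\<lambda>n. c *\<^sub>R f n) \<longlonglongrightarrow> c *\<^sub>R x" "\<And>n. c *\<^sub>R f n \<in> S"
    using assms by (auto intro: tendsto_scaleR subspace_scale)
  then show "c *\<^sub>R x \<in> closure S"
    unfolding closure_sequential by (intro exI[of _ "\<lambda>n. c *\<^sub>R f n"]) blast
qed

text \<open>Reduction to the real case: a complex orthonormal set \<open>E\<close> gives the real
  orthonormal set formed by \<open>E\<close> and its multiples by \<open>\<i>\<close>, and the
  squares of the two real coefficients add up to \<open>(cmod (cinner u e))\<^sup>2\<close>.
  Completeness within \<open>Q\<close> applies because \<open>Q\<close> is closed and
  complex-linear, so the residual of the projection stays in \<open>Q\<close>.\<close>

lemma parseval_ell2:
  fixes Q :: "'a ell2 set"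
  assumes Q: "closed Q" "subspace Q" "\<And>c x. x \<in> Q \<Longrightarrow> cscale c x \<in> Q"
    and E: "E \<subseteq> Q" "\<And>e f. e \<in> E \<Longrightarrow> f \<in> E \<Longrightarrow> cinner e f = (if e = f then 1 else 0)"
    and complete: "\<And>x. x \<in> Q \<Longrightarrow> (\<And>e. e \<in> E \<Longrightarrow> cinner x e = 0) \<Longrightarrow> x = 0"
    and u: "u \<in> Q"
  shows "((\<lambda>e. (cmod (cinner u e))\<^sup>2) has_sum (norm u)\<^sup>2) E"
proof -
  let ?I = "cscale \<i>"
  have on1: "e \<bullet> f = (if e = f then 1 else 0)" "e \<bullet> ?I f = 0" "?I e \<bullet> f = 0"
    "?I e \<bullet> ?I f = (if e = f then 1 else 0)" if "e \<in> E" "f \<in> E" for e f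
    using E(2)[OF that] by (auto simp: inner_ell2_def)
  have ne: "e \<noteq> ?I f" if "e \<in> E" "f \<in> E" for e f
    using on1(1)[OF that(1) that(1)] on1(2)[OF that] by auto
  have inj: "inj_on ?I E"
    by (rule inj_onI) (metis on1(4) zero_neq_one)
  have on: "e \<bullet> f = (if e = f then 1 else 0)" if "e \<in> E \<union> ?I ` E" "f \<in> E \<union> ?I ` E" for e f
  proof -
    consider "e \<in> E" "f \<in> E" | f' where "e \<in> E" "f' \<in> E" "f = ?I f'"
      | e' where "e' \<in> E" "f \<in> E" "e = ?I e'" | e' f' where "e' \<in> E" "f' \<in> E" "e = ?I e'" "f = ?I f'"
      using \<open>e \<in> E \<union> ?I ` E\<close> \<open>f \<in> E \<union> ?I ` E\<close> by blast
    then show ?thesis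
    proof cases
      case 1 then show ?thesis using on1(1) by blast
    next
      case 2 then show ?thesis using on1(2) ne by auto
    next
      case 3 then show ?thesis using on1(3) ne by metis
    next
      case 4 then show ?thesis using on1(4) inj by (auto dest: inj_onD)
    qed
  qed
  have sub: "closure (span (E \<union> ?I ` E)) \<subseteq> Q"
  proof (rule closure_minimal[OF span_minimal])
    show "E \<union> ?I ` E \<subseteq> Q" using E(1) Q(3) by auto
  qed (use Q in auto)
  obtain y where y: "y \<in> closure (span (E \<union> ?I ` E))"
    and ort: "\<And>s. s \<in> closure (span (E \<union> ?I ` E)) \<Longrightarrow> (u - y) \<bullet> s = 0"
    using orthogonal_decomposition[of "closure (span (E \<union> ?I ` E))" u]
    by (metis closed_closure subspace_closure subspace_span)
  have "u - y = 0"
  proof (rule complete)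
    show "u - y \<in> Q" using u y sub Q(2) by (meson subsetD subspace_diff)
    fix e assume "e \<in> E"
    then have "e \<in> closure (span (E \<union> ?I ` E))" "?I e \<in> closure (span (E \<union> ?I ` E))"
      by (auto intro!: subsetD[OF closure_subset] span_base)
    then show "cinner (u - y) e = 0"
      using ort by (simp add: cinner_eq complex_eq_iff)
  qed
  then have "u \<in> closure (span (E \<union> ?I ` E))" using y by simp
  from parseval_closure_span[OF on this]
  have hs: "((\<lambda>e. (u \<bullet> e)\<^sup>2) has_sum (norm u)\<^sup>2) (E \<union> ?I ` E)" .
  have disj: "E \<inter> ?I ` E = {}" using ne by auto
  have s1: "(\<lambda>e. (u \<bullet> e)\<^sup>2) summable_on E" and s2: "(\<lambda>e. (u \<bullet> e)\<^sup>2) summable_on (?I ` E)"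
    using has_sum_imp_summable[OF hs] by (auto intro: summable_on_subset_banach)
  have "(norm u)\<^sup>2 = infsum (\<lambda>e. (u \<bullet> e)\<^sup>2) E + infsum (\<lambda>e. (u \<bullet> e)\<^sup>2) (?I ` E)"
    using infsum_Un_disjoint[OF s1 s2 disj] infsumI[OF hs] by simp
  also have "infsum (\<lambda>e. (u \<bullet> e)\<^sup>2) (?I ` E) = infsum (\<lambda>e. (u \<bullet> ?I e)\<^sup>2) E"
    using infsum_reindex[OF inj] by (simp add: o_def)
  finally have eq: "(norm u)\<^sup>2 = infsum (\<lambda>e. (u \<bullet> e)\<^sup>2) E + infsum (\<lambda>e. (u \<bullet> ?I e)\<^sup>2) E" .
  have s3: "(\<lambda>e. (u \<bullet> ?I e)\<^sup>2) summable_on E"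
    using s2 summable_on_reindex[OF inj, of "\<lambda>e. (u \<bullet> e)\<^sup>2"] by (simp add: o_def)
  have "((\<lambda>e. (u \<bullet> e)\<^sup>2 + (u \<bullet> ?I e)\<^sup>2) has_sum (norm u)\<^sup>2) E"
    unfolding eq by (intro has_sum_add has_sum_infsum s1 s3)
  then show ?thesis by (simp add: cinner_eq cmod_power2)
qed

text \<open>Zorn's lemma; a vector orthogonal to a maximal orthonormal set could be normalized and
  adjoined. Existence is what gives meaning to the basis selected by \<open>SOME\<close> in
  \<open>hs_norm\<close>.\<close>

lemma orthonormal_basis_ell2_exists:
  fixes Q :: "'a ell2 set"
  assumes "subspace Q"
  shows "\<exists>E\<subseteq>Q. (\<forall>e\<in>E. \<forall>f\<in>E. cinner e f = (if e = f then 1 else 0)) \<and>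
    (\<forall>x\<in>Q. (\<forall>e\<in>E. cinner x e = 0) \<longrightarrow> x = 0)"
proof -
  define A where "A = {E. E \<subseteq> Q \<and> (\<forall>e\<in>E. \<forall>f\<in>E. cinner e f = (if e = f then 1 else 0))}"
  have "\<exists>M\<in>A. \<forall>X\<in>A. M \<subseteq> X \<longrightarrow> X = M"
  proof (rule subset_Zorn')
    fix C assume C: "subset.chain A C"
    then have CA: "C \<subseteq> A" and lin: "\<And>X Y. X \<in> C \<Longrightarrow> Y \<in> C \<Longrightarrow> X \<subseteq> Y \<or> Y \<subseteq> X"
      by (auto simp: subset.chain_def)
    have "cinner e f = (if e = f then 1 else 0)" if XY: "X \<in> C" "e \<in> X" "Y \<in> C" "f \<in> Y" for e f X Y
    proof -
      obtain Z where "Z \<in> C" "e \<in> Z" "f \<in> Z" using lin[OF XY(1,3)] XY by blast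
      then show ?thesis using CA unfolding A_def by blast
    qed
    moreover have "\<Union>C \<subseteq> Q" using CA unfolding A_def by blast
    ultimately show "\<Union>C \<in> A" unfolding A_def by blast
  qed
  then obtain M where M: "M \<in> A" and max: "\<And>X. X \<in> A \<Longrightarrow> M \<subseteq> X \<Longrightarrow> X = M" by blast
  have "x = 0" if x: "x \<in> Q" "\<forall>e\<in>M. cinner x e = 0" for x
  proof (rule ccontr)
    assume "x \<noteq> 0"
    define y where "y = (1 / norm x) *\<^sub>R x"
    have y: "cinner y y = 1"
      using \<open>x \<noteq> 0\<close> by (simp add: cinner_self_norm y_def)
    have ye: "cinner y e = 0" "cinner e y = 0" if "e \<in> M" for e
    proof -
      show "cinner y e = 0" using x(2) that by (simp add: y_def scaleR_ell2_def)
      then show "cinner e y = 0" by (metis cinner_commute complex_cnj_zero)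
    qed
    have "y \<in> Q" using x(1) assms by (simp add: y_def subspace_scale)
    then have "insert y M \<in> A"
      using M ye y unfolding A_def by auto
    then have "y \<in> M" using max by blast
    then show False using ye y by force
  qed
  then show ?thesis using M unfolding A_def by blast
qed

text \<open>Tonelli for unconditional sums. It will interchange the sum over a basis with the sum
  over degrees.\<close>

lemma has_sum_swap_nonneg:
  fixes f :: "'a \<Rightarrow> 'b \<Rightarrow> real"
  assumes rows: "\<And>m. m \<in> A \<Longrightarrow> (f m has_sum g m) B" and g: "(g has_sum S) A"
    and cols: "\<And>e. e \<in> B \<Longrightarrow> ((\<lambda>m. f m e) has_sum h e) A"
    and nonneg: "\<And>m e. m \<in> A \<Longrightarrow> e \<in> B \<Longrightarrow> 0 \<le> f m e"
  shows "(h has_sum S) B"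
proof -
  let ?F = "\<lambda>(m, e). f m e"
  have "?F summable_on A \<times> B"
    by (rule summable_on_SigmaI[where g = g])
       (use rows nonneg has_sum_imp_summable[OF g] in auto)
  then have "(?F has_sum S) (A \<times> B)"
    by (intro has_sum_SigmaI[where g = g]) (use rows g in auto)
  then have "((\<lambda>(e, m). f m e) has_sum S) (B \<times> A)"
    by (subst (asm) has_sum_swap) simp
  then show ?thesis
    by (rule has_sum_SigmaD) (use cols in auto)
qed

section \<open>Integration over the circle\<close>

lemma haar_circle_eq:
  "haar_circle = distr (density lborel (\<lambda>t. ennreal (indicator {0..1} t))) borel (\<lambda>t. cis (2 * pi * t))"
  unfolding haar_circle_def uniform_measure_def by (simp add: divide_ennreal_def ennreal_indicator)

lemma measurable_cis [measurable]: "cis \<in> borel_measurable borel"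
  by (intro borel_measurable_continuous_onI continuous_intros)

lemma measurable_cnj [measurable]: "cnj \<in> borel_measurable borel"
  by (intro borel_measurable_continuous_onI continuous_intros)

lemma sets_haar_circle [simp, measurable_cong]: "sets haar_circle = sets borel"
  by (simp add: haar_circle_def)

lemma space_haar_circle [simp]: "space haar_circle = UNIV"
  by (simp add: haar_circle_def)

lemma AE_haar_circle_iff:
  assumes [measurable]: "Measurable.pred borel P"
  shows "(AE \<zeta> in haar_circle. P \<zeta>) \<longleftrightarrow> (AE t in lborel. t \<in> {0..1} \<longrightarrow> P (cis (2 * pi * t)))"
  unfolding haar_circle_eq
  by (subst AE_distr_iff) (auto simp: AE_density indicator_def)

lemma AE_haar_circle_norm: "AE \<zeta> in haar_circle. cmod \<zeta> = 1"
  by (subst AE_haar_circle_iff) auto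

lemma emeasure_haar_circle_UNIV: "emeasure haar_circle UNIV = 1"
  unfolding haar_circle_eq
  by (simp add: emeasure_distr emeasure_density ennreal_indicator)

lemma finite_measure_haar_circle: "finite_measure haar_circle"
  by (rule finite_measureI) (simp add: emeasure_haar_circle_UNIV)

lemma measure_haar_circle_UNIV: "measure haar_circle UNIV = 1"
  by (simp add: measure_def emeasure_haar_circle_UNIV)

lemma AE_haar_circle_neq: "AE \<zeta> in haar_circle. \<zeta> \<noteq> z"
proof (subst AE_haar_circle_iff)
  \<comment> \<open>The half-open interval makes the parametrization injective; the endpoint 1,
    where \<open>cis\<close> repeats its value at 0, is put back as one further exceptional
    point.\<close>
  let ?A = "{t \<in> {0..<1::real}. cis (2 * pi * t) = z}"
  have "finite ?A"
  proof (cases "?A = {}")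
    case False
    then obtain s where s: "s \<in> ?A" by blast
    have "t = s" if "t \<in> ?A" for t
    proof -
      have "sin (2 * pi * t) = sin (2 * pi * s) \<and> cos (2 * pi * t) = cos (2 * pi * s)"
        using s that by (auto simp: complex_eq_iff)
      then obtain n :: int where "2 * pi * t = 2 * pi * s + 2 * pi * n"
        unfolding sin_cos_eq_iff by blast
      then have n: "t = s + n" by (simp flip: distrib_left)
      with s that have "\<bar>real_of_int n\<bar> < 1" by auto
      then have "n = 0" by linarith
      with n show ?thesis by simp
    qed
    then have "?A \<subseteq> {s}" by blast
    then show ?thesis by (rule finite_subset) simp
  qed (simp only: finite.emptyI)
  then have "AE t in lborel. t \<notin> insert 1 ?A"
    by (intro AE_not_in countable_imp_null_set_lborel countable_finite) auto
  then show "AE t in lborel. t \<in> {0..1} \<longrightarrow> cis (2 * pi * t) \<noteq> z"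
    by eventually_elim auto
qed measurable

lemma integral_haar_circle_continuous:
  fixes f :: "complex \<Rightarrow> 'a::euclidean_space"
  assumes [measurable]: "f \<in> borel_measurable borel" and "continuous_on (sphere 0 1) f"
  shows "integrable haar_circle f"
    and "integral\<^sup>L haar_circle f = integral {0..1} (\<lambda>t. f (cis (2 * pi * t)))"
proof -
  have "continuous_on {0..1} (\<lambda>t. f (cis (2 * pi * t)))"
    by (rule continuous_on_compose2[OF assms(2)]) (auto intro!: continuous_intros)
  then have si: "set_integrable lborel {0..1} (\<lambda>t. f (cis (2 * pi * t)))"
    unfolding set_integrable_def by (intro borel_integrable_compact) auto
  show "integrable haar_circle f"
    using si unfolding haar_circle_eq set_integrable_def
    by (simp add: integrable_distr_eq integrable_density)
  have "integral\<^sup>L haar_circle f = (LBINT t:{0..1}. f (cis (2 * pi * t)))"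
    unfolding haar_circle_eq set_lebesgue_integral_def
    by (simp add: integral_distr integral_density)
  also have "\<dots> = integral {0..1} (\<lambda>t. f (cis (2 * pi * t)))"
    by (rule set_borel_integral_eq_integral(2)[OF si])
  finally show "integral\<^sup>L haar_circle f = integral {0..1} (\<lambda>t. f (cis (2 * pi * t)))" .
qed

text \<open>The mean value property, read off from Cauchy's formula at the centre: on the unit
  circle the derivative of the path is 2 pi i times the point itself, which cancels the
  denominator.\<close>

lemma integral_haar_circle_holomorphic:
  assumes [measurable]: "f \<in> borel_measurable borel" and f: "f holomorphic_on cball 0 1"
  shows "integrable haar_circle f" and "integral\<^sup>L haar_circle f = f 0"
proof -
  have cont: "continuous_on (sphere 0 1) f"
    using holomorphic_on_imp_continuous_on[OF f] by (rule continuous_on_subset) auto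
  show "integrable haar_circle f" by (rule integral_haar_circle_continuous[OF assms(1) cont])
  define c :: complex where "c = 2 * of_real pi * \<i>"
  have "((\<lambda>u. f u / (u - 0)) has_contour_integral (2 * of_real pi * \<i> * f 0)) (circlepath 0 1)"
    by (rule Cauchy_integral_circlepath_simple[OF f]) auto
  then have "((\<lambda>t. (2 * of_real pi * \<i>) * f (cis (2 * pi * t))) has_integral (2 * of_real pi * \<i> * f 0)) {0..1}"
    unfolding has_contour_integral_def
  proof (rule has_integral_cong[THEN iffD1, rotated])
    fix t :: real assume t: "t \<in> {0..1}"
    have "circlepath 0 1 t = cis (2 * pi * t)"
      by (simp add: circlepath cis_conv_exp mult_ac)
    moreover have "vector_derivative (circlepath 0 1) (at t within {0..1}) = 2 * of_real pi * \<i> * cis (2 * pi * t)"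
      using t by (simp add: vector_derivative_circlepath01 cis_conv_exp mult_ac)
    ultimately show "f (circlepath 0 1 t) / (circlepath 0 1 t - 0)
        * vector_derivative (circlepath 0 1) (at t within {0..1}) = (2 * of_real pi * \<i>) * f (cis (2 * pi * t))"
      by simp
  qed
  then have "((\<lambda>t. inverse c * (c * f (cis (2 * pi * t)))) has_integral inverse c * (c * f 0)) {0..1}"
    unfolding c_def by (rule has_integral_mult_right)
  moreover have "c \<noteq> 0" by (simp add: c_def)
  ultimately have "((\<lambda>t. f (cis (2 * pi * t))) has_integral f 0) {0..1}"
    by (simp flip: mult.assoc)
  then show "integral\<^sup>L haar_circle f = f 0"
    using integral_haar_circle_continuous(2)[OF assms(1) cont] by (simp add: integral_unique)
qed

lemma measurable_poly [measurable]: "poly f \<in> borel_measurable (borel :: complex measure)"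
  by (intro borel_measurable_continuous_onI continuous_intros)

lemma integral_haar_circle_monom:
  "(\<integral>\<zeta>. \<zeta> ^ m * cnj (\<zeta> ^ n) \<partial>haar_circle) = (if m = n then 1 else 0)"
proof -
  \<comment> \<open>\<open>0 ^ k\<close> covers both cases, being 1 for \<open>k = 0\<close> and 0
    otherwise.\<close>
  have pow: "(\<integral>\<zeta>. \<zeta> ^ k \<partial>haar_circle) = 0 ^ k" for k :: nat
    by (rule integral_haar_circle_holomorphic) (auto intro!: holomorphic_intros)
  have unit: "\<zeta> ^ k * cnj (\<zeta> ^ k) = 1" if "cmod \<zeta> = 1" for \<zeta> and k :: nat
    using that by (simp add: complex_norm_square[symmetric] norm_power flip: power_mult_distrib)
  have ge: "(\<integral>\<zeta>. \<zeta> ^ m * cnj (\<zeta> ^ n) \<partial>haar_circle) = 0 ^ (m - n)" if "n \<le> m" for m n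
  proof -
    have "(\<integral>\<zeta>. \<zeta> ^ m * cnj (\<zeta> ^ n) \<partial>haar_circle) = (\<integral>\<zeta>. \<zeta> ^ (m - n) \<partial>haar_circle)"
    proof (rule integral_cong_AE)
      show "AE \<zeta> in haar_circle. \<zeta> ^ m * cnj (\<zeta> ^ n) = \<zeta> ^ (m - n)"
        using AE_haar_circle_norm
      proof eventually_elim
        case (elim \<zeta>)
        have "\<zeta> ^ m * cnj (\<zeta> ^ n) = \<zeta> ^ (m - n) * (\<zeta> ^ n * cnj (\<zeta> ^ n))"
          using that by (simp only: mult.assoc[symmetric] power_add[symmetric] le_add_diff_inverse2)
        then show ?case unfolding unit[OF elim] mult_1_right .
      qed
    qed auto
    then show ?thesis using pow by simp
  qed
  show ?thesis
  proof (cases "n \<le> m")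
    case True then show ?thesis using ge by auto
  next
    case False
    then have "(\<integral>\<zeta>. \<zeta> ^ n * cnj (\<zeta> ^ m) \<partial>haar_circle) = 0" using ge[of m n] by auto
    moreover have "(\<integral>\<zeta>. \<zeta> ^ m * cnj (\<zeta> ^ n) \<partial>haar_circle) = cnj (\<integral>\<zeta>. \<zeta> ^ n * cnj (\<zeta> ^ m) \<partial>haar_circle)"
    proof -
      have "cnj (\<integral>\<zeta>. \<zeta> ^ n * cnj (\<zeta> ^ m) \<partial>haar_circle) = (\<integral>\<zeta>. cnj (\<zeta> ^ n * cnj (\<zeta> ^ m)) \<partial>haar_circle)"
        by (rule Bochner_Integration.integral_cnj[symmetric])
      then show ?thesis by (simp add: mult.commute)
    qed
    ultimately show ?thesis using False by simp
  qed
qed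

lemma integral_haar_circle_poly:
  assumes "degree f \<le> N" "degree g \<le> N"
  shows "(\<integral>\<zeta>. poly f \<zeta> * cnj (poly g \<zeta>) \<partial>haar_circle) = (\<Sum>k\<le>N. coeff f k * cnj (coeff g k))"
proof -
  have int: "integrable haar_circle (\<lambda>\<zeta>. \<zeta> ^ m * cnj (\<zeta> ^ n))" for m n :: nat
    by (rule integral_haar_circle_continuous) (auto intro!: continuous_intros)
  have "(\<integral>\<zeta>. poly f \<zeta> * cnj (poly g \<zeta>) \<partial>haar_circle)
      = (\<integral>\<zeta>. (\<Sum>m\<le>N. \<Sum>n\<le>N. (coeff f m * cnj (coeff g n)) * (\<zeta> ^ m * cnj (\<zeta> ^ n))) \<partial>haar_circle)"
  proof (rule Bochner_Integration.integral_cong[OF refl])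
    fix \<zeta> :: complex
    have "poly h \<zeta> = (\<Sum>k\<le>N. coeff h k * \<zeta> ^ k)" if "degree h \<le> N" for h
      unfolding poly_altdef using that
      by (intro sum.mono_neutral_left) (auto simp: coeff_eq_0)
    then show "poly f \<zeta> * cnj (poly g \<zeta>)
        = (\<Sum>m\<le>N. \<Sum>n\<le>N. (coeff f m * cnj (coeff g n)) * (\<zeta> ^ m * cnj (\<zeta> ^ n)))"
      using assms by (simp add: sum_product mult_ac)
  qed
  also have "\<dots> = (\<Sum>m\<le>N. \<Sum>n\<le>N. (coeff f m * cnj (coeff g n)) * (if m = n then 1 else 0))"
    by (subst Bochner_Integration.integral_sum, intro Bochner_Integration.integrable_sum integrable_mult_right int,
        intro sum.cong refl, subst Bochner_Integration.integral_sum, intro integrable_mult_right int,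
        intro sum.cong refl) (simp only: integral_mult_right_zero integral_haar_circle_monom)
  also have "\<dots> = (\<Sum>k\<le>N. coeff f k * cnj (coeff g k))"
    by (simp add: if_distrib sum.delta' cong: if_cong)
  finally show ?thesis .
qed

lemma L2_norm_circle_sq:
  assumes "degree f \<le> N"
  shows "(L2_norm_circle f)\<^sup>2 = (\<Sum>k\<le>N. (cmod (coeff f k))\<^sup>2)"
proof -
  have "complex_of_real (\<integral>\<zeta>. (cmod (poly f \<zeta>))\<^sup>2 \<partial>haar_circle)
      = (\<integral>\<zeta>. poly f \<zeta> * cnj (poly f \<zeta>) \<partial>haar_circle)"
    by (simp only: integral_complex_of_real[symmetric] complex_norm_square)
  also have "\<dots> = complex_of_real (\<Sum>k\<le>N. (cmod (coeff f k))\<^sup>2)"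
    unfolding integral_haar_circle_poly[OF assms assms] of_real_sum complex_norm_square ..
  finally have "(\<integral>\<zeta>. (cmod (poly f \<zeta>))\<^sup>2 \<partial>haar_circle) = (\<Sum>k\<le>N. (cmod (coeff f k))\<^sup>2)"
    by (rule of_real_eq_iff[THEN iffD1])
  then show ?thesis by (simp add: L2_norm_circle_def sum_nonneg)
qed

lemma L2_norm_circle_pos:
  assumes "f \<noteq> 0"
  shows "L2_norm_circle f > 0"
proof -
  have "0 < (cmod (lead_coeff f))\<^sup>2" using assms by simp
  also have "\<dots> \<le> (\<Sum>k\<le>degree f. (cmod (coeff f k))\<^sup>2)"
    by (rule member_le_sum) auto
  finally have "0 < (L2_norm_circle f)\<^sup>2" using L2_norm_circle_sq[of f "degree f"] by simp
  moreover have "0 \<le> L2_norm_circle f"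
    by (simp add: L2_norm_circle_def integral_nonneg_AE)
  ultimately show ?thesis by (simp add: zero_less_power2 less_le)
qed

section \<open>The Mahler measure\<close>

text \<open>The integrand is the real part of \<open>Ln (1 - a * \<zeta>)\<close>, which is
  holomorphic on the closed disc because its argument stays in the right half-plane, and which
  vanishes at 0; the mean value property gives the integral.\<close>

lemma integral_ln_norm_one_minus:
  assumes a: "cmod a < 1"
  shows "integrable haar_circle (\<lambda>\<zeta>. ln (cmod (1 - a * \<zeta>)))"
    and "(\<integral>\<zeta>. ln (cmod (1 - a * \<zeta>)) \<partial>haar_circle) = 0"
proof -
  have small: "cmod (a * \<zeta>) < 1" if "cmod \<zeta> \<le> 1" for \<zeta>
    using a mult_left_le[of "cmod \<zeta>" "cmod a"] that by (simp add: norm_mult)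
  have pos: "1 - a * \<zeta> \<notin> \<real>\<^sub>\<le>\<^sub>0" if "cmod \<zeta> \<le> 1" for \<zeta>
  proof
    assume "1 - a * \<zeta> \<in> \<real>\<^sub>\<le>\<^sub>0"
    then have "Re (1 - a * \<zeta>) \<le> 0" by (auto simp: complex_nonpos_Reals_iff)
    then show False using small[OF that] complex_Re_le_cmod[of "a * \<zeta>"] by simp
  qed
  have hol: "(\<lambda>\<zeta>. Ln (1 - a * \<zeta>)) holomorphic_on cball 0 1"
    by (intro holomorphic_intros) (use pos in auto)
  \<comment> \<open>Cut off outside the closed disc, since the mean value lemma asks for Borel
    measurability on the whole plane and \<open>Ln\<close> may meet its branch cut
    elsewhere.\<close>
  define f where "f \<zeta> = (if \<zeta> \<in> cball 0 1 then Ln (1 - a * \<zeta>) else 0)" for \<zeta>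
  have meas: "f \<in> borel_measurable borel"
    unfolding f_def
    by (rule borel_measurable_continuous_on_if)
       (auto intro: holomorphic_on_imp_continuous_on[OF hol])
  have "f holomorphic_on cball 0 1"
    by (rule holomorphic_transform[OF hol]) (simp add: f_def)
  note f = integral_haar_circle_holomorphic[OF meas this]
  have ae: "AE \<zeta> in haar_circle. Re (f \<zeta>) = ln (cmod (1 - a * \<zeta>))"
    using AE_haar_circle_norm
  proof eventually_elim
    case (elim \<zeta>)
    then have "1 - a * \<zeta> \<noteq> 0" using pos[of \<zeta>] by auto
    with elim show ?case by (simp add: f_def)
  qed
  note [measurable] = meas
  have m: "(\<lambda>\<zeta>. Re (f \<zeta>)) \<in> borel_measurable haar_circle"
    "(\<lambda>\<zeta>. ln (cmod (1 - a * \<zeta>))) \<in> borel_measurable haar_circle" by measurable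
  show "integrable haar_circle (\<lambda>\<zeta>. ln (cmod (1 - a * \<zeta>)))"
    using integrable_cong_AE[OF m ae] integrable_Re[OF f(1)] by simp
  have "(\<integral>\<zeta>. ln (cmod (1 - a * \<zeta>)) \<partial>haar_circle) = (\<integral>\<zeta>. Re (f \<zeta>) \<partial>haar_circle)"
    using integral_cong_AE[OF m ae] by simp
  also have "\<dots> = 0"
    using integral_Re[OF f(1)] f(2) by (simp add: f_def)
  finally show "(\<integral>\<zeta>. ln (cmod (1 - a * \<zeta>)) \<partial>haar_circle) = 0" .
qed

text \<open>On the unit circle \<open>\<bar>1 - r\<zeta>\<bar>\<^sup>2 / r = \<bar>1 - \<zeta>\<bar>\<^sup>2 + (1 - r)\<^sup>2 / r\<close> decreases to \<open>\<bar>1 - \<zeta>\<bar>\<^sup>2\<close>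
  as \<open>r\<close> increases to \<open>1\<close>, so monotone convergence reaches the boundary case.\<close>

lemma integral_ln_norm_one_minus_unimodular:
  assumes b: "cmod b = 1"
  shows "integrable haar_circle (\<lambda>\<zeta>. ln (cmod (1 - b * \<zeta>)))"
    and "(\<integral>\<zeta>. ln (cmod (1 - b * \<zeta>)) \<partial>haar_circle) = 0"
proof -
  \<comment> \<open>An explicit sequence increasing to 1 for which
    \<open>(1 - r)\<^sup>2 / r\<close> has the simple form \<open>s n\<close>, visibly decreasing to
    0.\<close>
  define r where "r n = real (n + 1) / real (n + 2)" for n
  define s where "s n = 1 / (real (n + 1) * real (n + 2))" for n
  have r: "0 < r n" "r n < 1" for n by (auto simp: r_def)
  have s_eq: "s n = (1 - r n)\<^sup>2 / r n" for n
  proof -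
    have "1 - r n = 1 / real (n + 2)" by (simp add: r_def field_simps)
    moreover have "1 / (x * y) = (1 / y)\<^sup>2 / (x / y)" if "x > 0" "y > 0" for x y :: real
      using that by (simp add: power2_eq_square)
    ultimately show ?thesis by (simp add: s_def r_def)
  qed
  \<comment> \<open>Minus the logarithm of
    \<open>(cmod (1 - of_real (r n) * b * \<zeta>))\<^sup>2 / r n\<close>. On the circle this
    increases with \<open>n\<close>, while its integral is \<open>ln (r n)\<close> by the case of
    modulus less than one.\<close>
  define f where "f n \<zeta> = ln (r n) - 2 * ln (cmod (1 - (of_real (r n) * b) * \<zeta>))" for n \<zeta>
  have f_eq: "f n \<zeta> = - ln ((cmod (1 - b * \<zeta>))\<^sup>2 + s n)" if "cmod \<zeta> = 1" for n \<zeta>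
  proof -
    define w where "w = b * \<zeta>"
    have w: "(Re w)\<^sup>2 + (Im w)\<^sup>2 = 1"
    proof -
      have "cmod w = 1" using b that by (simp add: w_def norm_mult)
      then show ?thesis by (metis cmod_power2 one_power2)
    qed
    have id: "(cmod (1 - of_real (r n) * w))\<^sup>2 = r n * ((cmod (1 - w))\<^sup>2 + s n)"
    proof -
      have "(cmod (1 - of_real (r n) * w))\<^sup>2 = 1 - 2 * r n * Re w + (r n)\<^sup>2 * ((Re w)\<^sup>2 + (Im w)\<^sup>2)"
        unfolding cmod_power2 by (simp add: power2_eq_square algebra_simps)
      moreover have "(cmod (1 - w))\<^sup>2 = 1 - 2 * Re w + ((Re w)\<^sup>2 + (Im w)\<^sup>2)"
        unfolding cmod_power2 by (simp add: power2_eq_square algebra_simps)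
      moreover have "r n * s n = (1 - r n)\<^sup>2" using r[of n] by (simp add: s_eq)
      ultimately show ?thesis
        using w by algebra
    qed
    have s0: "s n > 0" by (simp add: s_def)
    have pos: "(cmod (1 - w))\<^sup>2 + s n > 0" using s0 by (simp add: add_nonneg_pos)
    then have "cmod (1 - of_real (r n) * w) > 0"
      using id r[of n] by (metis mult_pos_pos zero_less_power2 norm_ge_zero less_le)
    then have "2 * ln (cmod (1 - of_real (r n) * w)) = ln ((cmod (1 - of_real (r n) * w))\<^sup>2)"
      by (simp add: ln_realpow)
    also have "\<dots> = ln (r n) + ln ((cmod (1 - w))\<^sup>2 + s n)"
      unfolding id using r[of n] pos by (simp add: ln_mult)
    finally show ?thesis by (simp add: f_def w_def mult.assoc)
  qed
  have small: "cmod (of_real (r n) * b) < 1" for n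
    using b r[of n] by (simp add: norm_mult)
  note ln_r = integral_ln_norm_one_minus[OF small]
  interpret finite_measure haar_circle by (rule finite_measure_haar_circle)
  have int: "integrable haar_circle (f n)" for n
    unfolding f_def by (intro Bochner_Integration.integrable_diff integrable_mult_right ln_r(1)) simp
  have int_val: "integral\<^sup>L haar_circle (f n) = ln (r n)" for n
    unfolding f_def
    by (subst Bochner_Integration.integral_diff)
       (simp_all add: ln_r integrable_mult_right measure_haar_circle_UNIV)
  have s_mono: "s n \<le> s m" if "m \<le> n" for m n
    unfolding s_def using that by (intro divide_left_mono mult_mono) auto
  have s_lim: "s \<longlonglongrightarrow> 0" unfolding s_def by real_asymp
  have mono: "AE \<zeta> in haar_circle. mono (\<lambda>n. f n \<zeta>)"
    using AE_haar_circle_norm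
  proof eventually_elim
    case (elim \<zeta>)
    have "s n > 0" for n by (simp add: s_def)
    then have "(cmod (1 - b * \<zeta>))\<^sup>2 + s n > 0" for n by (simp add: add_nonneg_pos)
    then show ?case
      unfolding f_eq[OF elim] by (intro monoI) (simp add: s_mono)
  qed
  have lim: "AE \<zeta> in haar_circle. (\<lambda>n. f n \<zeta>) \<longlonglongrightarrow> - (2 * ln (cmod (1 - b * \<zeta>)))"
    using AE_haar_circle_norm AE_haar_circle_neq[of "1 / b"]
  proof eventually_elim
    case (elim \<zeta>)
    have "b \<noteq> 0" using b by auto
    with elim have nz: "cmod (1 - b * \<zeta>) \<noteq> 0" by (auto simp: field_simps)
    have "(\<lambda>n. - ln ((cmod (1 - b * \<zeta>))\<^sup>2 + s n)) \<longlonglongrightarrow> - ln ((cmod (1 - b * \<zeta>))\<^sup>2 + 0)"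
      by (intro tendsto_intros s_lim) (use nz in auto)
    then show ?case using nz f_eq[OF elim(1)] by (simp add: ln_realpow)
  qed
  have ilim: "(\<lambda>n. integral\<^sup>L haar_circle (f n)) \<longlonglongrightarrow> 0"
    unfolding int_val r_def by real_asymp
  have meas: "(\<lambda>\<zeta>. - (2 * ln (cmod (1 - b * \<zeta>)))) \<in> borel_measurable haar_circle" by measurable
  \<comment> \<open>Because the integrals converge, monotone convergence also delivers integrability
    of the limit, whose logarithmic singularity lies at \<open>1 / b\<close>.\<close>
  note mc = integrable_monotone_convergence[OF int mono lim ilim meas]
    integral_monotone_convergence[OF int mono lim ilim meas]
  show "integrable haar_circle (\<lambda>\<zeta>. ln (cmod (1 - b * \<zeta>)))"
    using integrable_mult_right[OF mc(1), of "- 1 / 2"] by simp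
  show "(\<integral>\<zeta>. ln (cmod (1 - b * \<zeta>)) \<partial>haar_circle) = 0"
    using mc(2) by simp
qed

text \<open>Jensen's formula for one linear factor. For \<open>cmod a \<le> 1\<close>,
  \<open>\<zeta> - a\<close> and \<open>1 - cnj a * \<zeta>\<close> have equal modulus on the
  circle; otherwise the factor \<open>a\<close> is pulled out and \<open>1 / a\<close> lies in the
  open disc.\<close>

lemma integral_ln_norm_diff:
  shows "integrable haar_circle (\<lambda>\<zeta>. ln (cmod (\<zeta> - a)))" (is ?I)
    and "(\<integral>\<zeta>. ln (cmod (\<zeta> - a)) \<partial>haar_circle) = ln (max 1 (cmod a))" (is ?V)
proof -
  have "?I \<and> ?V"
  proof (cases "cmod a \<le> 1")
    case True
    then have b: "cmod (cnj a) < 1 \<or> cmod (cnj a) = 1" by auto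
    have eq: "AE \<zeta> in haar_circle. ln (cmod (1 - cnj a * \<zeta>)) = ln (cmod (\<zeta> - a))"
      using AE_haar_circle_norm
    proof eventually_elim
      case (elim \<zeta>)
      have "cnj \<zeta> * (\<zeta> - a) = cnj (1 - cnj a * \<zeta>)"
        using elim complex_norm_square[of \<zeta>] by (simp add: algebra_simps)
      then have "cmod (cnj \<zeta> * (\<zeta> - a)) = cmod (1 - cnj a * \<zeta>)" by (metis complex_mod_cnj)
      with elim show ?case by (simp add: norm_mult)
    qed
    have m: "(\<lambda>\<zeta>. ln (cmod (1 - cnj a * \<zeta>))) \<in> borel_measurable haar_circle"
      "(\<lambda>\<zeta>. ln (cmod (\<zeta> - a))) \<in> borel_measurable haar_circle" by measurable
    have "integrable haar_circle (\<lambda>\<zeta>. ln (cmod (1 - cnj a * \<zeta>))) \<and>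
        (\<integral>\<zeta>. ln (cmod (1 - cnj a * \<zeta>)) \<partial>haar_circle) = 0"
      using b integral_ln_norm_one_minus integral_ln_norm_one_minus_unimodular by blast
    then show ?thesis
      using integrable_cong_AE[OF m eq] integral_cong_AE[OF m eq] True by (simp add: max_def)
  next
    case False
    then have a: "a \<noteq> 0" "cmod (1 / a) < 1" by (auto simp: norm_divide divide_less_eq)
    interpret finite_measure haar_circle by (rule finite_measure_haar_circle)
    have eq: "AE \<zeta> in haar_circle. ln (cmod a) + ln (cmod (1 - 1 / a * \<zeta>)) = ln (cmod (\<zeta> - a))"
      using AE_haar_circle_norm
    proof eventually_elim
      case (elim \<zeta>)
      have "1 - 1 / a * \<zeta> \<noteq> 0" using elim False by (auto simp: field_simps)
      then have "ln (cmod a) + ln (cmod (1 - 1 / a * \<zeta>)) = ln (cmod (a * (1 - 1 / a * \<zeta>)))"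
        unfolding norm_mult using a by (simp add: ln_mult)
      also have "a * (1 - 1 / a * \<zeta>) = - (\<zeta> - a)" using a by (simp add: algebra_simps)
      finally show ?case by (simp only: norm_minus_cancel)
    qed
    have m: "(\<lambda>\<zeta>. ln (cmod a) + ln (cmod (1 - 1 / a * \<zeta>))) \<in> borel_measurable haar_circle"
      "(\<lambda>\<zeta>. ln (cmod (\<zeta> - a))) \<in> borel_measurable haar_circle" by measurable
    note l = integral_ln_norm_one_minus[OF a(2)]
    have "integrable haar_circle (\<lambda>\<zeta>. ln (cmod a) + ln (cmod (1 - 1 / a * \<zeta>)))"
      by (intro Bochner_Integration.integrable_add l(1)) simp
    moreover have "(\<integral>\<zeta>. ln (cmod a) + ln (cmod (1 - 1 / a * \<zeta>)) \<partial>haar_circle) = ln (cmod a)"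
      by (subst Bochner_Integration.integral_add[OF _ l(1)]) (use l(2) in \<open>auto simp: measure_haar_circle_UNIV\<close>)
    ultimately show ?thesis
      using integrable_cong_AE[OF m eq] integral_cong_AE[OF m eq] False by (simp add: max_def)
  qed
  then show ?I ?V by blast+
qed

section \<open>From linear factors to arbitrary polynomials\<close>

lemma AE_haar_circle_poly_nonzero:
  assumes "f \<noteq> 0"
  shows "AE \<zeta> in haar_circle. poly f \<zeta> \<noteq> 0"
proof -
  have "AE \<zeta> in haar_circle. \<forall>z\<in>{z. poly f z = 0}. \<zeta> \<noteq> z"
    by (intro AE_finite_allI poly_roots_finite assms AE_haar_circle_neq)
  then show ?thesis by eventually_elim auto
qed

lemma poly_root_induct_complex [consumes 1, case_names const root]:
  fixes f :: "complex poly"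
  assumes "f \<noteq> 0" and "\<And>c. c \<noteq> 0 \<Longrightarrow> P [:c:]"
    and "\<And>a f. f \<noteq> 0 \<Longrightarrow> P f \<Longrightarrow> P ([:- a, 1:] * f)"
  shows "P f"
  using assms(1)
proof (induction "degree f" arbitrary: f)
  case 0
  then show ?case using assms(2) by (metis degree_eq_zeroE pCons_eq_0_iff)
next
  case (Suc n)
  then have "\<not> constant (poly f)" by (simp add: constant_degree)
  then obtain a where "poly f a = 0" using fundamental_theorem_of_algebra by blast
  then obtain g where g: "f = [:- a, 1:] * g" by (auto simp: poly_eq_0_iff_dvd)
  with Suc.prems have "g \<noteq> 0" by auto
  then have "degree f = Suc (degree g)" unfolding g by (subst degree_mult_eq) auto
  with Suc \<open>g \<noteq> 0\<close> have "P g" by simp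
  then show ?case unfolding g using \<open>g \<noteq> 0\<close> by (rule assms(3)[rotated])
qed

lemma AE_ln_poly_mult:
  assumes "f \<noteq> 0" "g \<noteq> 0"
  shows "AE \<zeta> in haar_circle. ln (cmod (poly f \<zeta>)) + ln (cmod (poly g \<zeta>)) = ln (cmod (poly (f * g) \<zeta>))"
  using AE_haar_circle_poly_nonzero[OF assms(1)] AE_haar_circle_poly_nonzero[OF assms(2)]
  by eventually_elim (simp add: norm_mult ln_mult)

lemma ln_poly_measurable: "(\<lambda>\<zeta>. ln (cmod (poly f \<zeta>))) \<in> borel_measurable haar_circle"
  by measurable

lemma ln_poly_add_measurable:
  "(\<lambda>\<zeta>. ln (cmod (poly f \<zeta>)) + ln (cmod (poly g \<zeta>))) \<in> borel_measurable haar_circle"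
  by measurable

lemma integrable_ln_poly:
  assumes "f \<noteq> 0"
  shows "integrable haar_circle (\<lambda>\<zeta>. ln (cmod (poly f \<zeta>)))"
  using assms
proof (induction f rule: poly_root_induct_complex)
  case (const c)
  interpret finite_measure haar_circle by (rule finite_measure_haar_circle)
  show ?case by simp
next
  case (root a f)
  have int: "integrable haar_circle (\<lambda>\<zeta>. ln (cmod (poly [:- a, 1:] \<zeta>)) + ln (cmod (poly f \<zeta>)))"
    using integral_ln_norm_diff(1)[of a] root by (intro Bochner_Integration.integrable_add) auto
  have "AE \<zeta> in haar_circle. ln (cmod (poly [:- a, 1:] \<zeta>)) + ln (cmod (poly f \<zeta>))
      = ln (cmod (poly ([:- a, 1:] * f) \<zeta>))"
    using root by (intro AE_ln_poly_mult) auto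
  from integrable_cong_AE[OF ln_poly_add_measurable ln_poly_measurable this] int show ?case
    by blast
qed

lemma mahler_measure_mult:
  assumes "f \<noteq> 0" "g \<noteq> 0"
  shows "mahler_measure (f * g) = mahler_measure f * mahler_measure g"
proof -
  have "(\<integral>\<zeta>. ln (cmod (poly (f * g) \<zeta>)) \<partial>haar_circle)
      = (\<integral>\<zeta>. ln (cmod (poly f \<zeta>)) + ln (cmod (poly g \<zeta>)) \<partial>haar_circle)"
    by (rule integral_cong_AE[OF ln_poly_add_measurable ln_poly_measurable AE_ln_poly_mult[OF assms], symmetric])
  then show ?thesis
    by (simp only: mahler_measure_def exp_add[symmetric]
        Bochner_Integration.integral_add[OF integrable_ln_poly[OF assms(1)] integrable_ln_poly[OF assms(2)]])
qed

lemma mahler_measure_linear: "mahler_measure [:- a, 1:] = max 1 (cmod a)"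
  using integral_ln_norm_diff(2)[of a] by (simp add: mahler_measure_def)

section \<open>Mahler measure, coefficients and quadratic mean\<close>

lemma mahler_measure_pos: "mahler_measure f > 0"
  by (simp add: mahler_measure_def)

text \<open>Mahler's inequality, by induction over linear factors. A coefficient of
  \<open>(\<zeta> - a) f\<close> combines two neighbouring coefficients of \<open>f\<close> with
  weights 1 and \<open>a\<close>, both at most \<open>max 1 (cmod a)\<close> in modulus, and
  Pascal's rule adds the two binomials.\<close>

lemma coeff_le_mahler_measure:
  assumes "f \<noteq> 0"
  shows "cmod (coeff f j) \<le> real (degree f choose j) * mahler_measure f"
  using assms
proof (induction f arbitrary: j rule: poly_root_induct_complex)
  case (const c)
  then show ?case
    by (cases j) (auto simp: mahler_measure_def measure_haar_circle_UNIV)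
next
  case (root a f)
  let ?M = "mahler_measure f" and ?d = "degree f"
  have deg: "degree ([:- a, 1:] * f) = Suc ?d"
    using root by (subst degree_mult_eq) auto
  have M: "mahler_measure ([:- a, 1:] * f) = max 1 (cmod a) * ?M"
    using root by (subst mahler_measure_mult) (auto simp: mahler_measure_linear)
  \<comment> \<open>The factor \<open>if j = 0 then 0 else 1\<close> removes the predecessor term at
    \<open>j = 0\<close>, where \<open>j - 1\<close> would truncate to 0.\<close>
  have "cmod (coeff f (j - 1)) * (if j = 0 then 0 else 1) \<le> real (?d choose (j - 1)) * (if j = 0 then 0 else 1) * ?M"
    using root(2)[of "j - 1"] by auto
  also have "\<dots> \<le> max 1 (cmod a) * (real (?d choose (j - 1)) * (if j = 0 then 0 else 1) * ?M)"
    using mult_right_mono[of 1 "max 1 (cmod a)" "real (?d choose (j - 1)) * (if j = 0 then 0 else 1) * ?M"]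
      mahler_measure_pos[of f] by simp
  finally have 1: "cmod (coeff f (j - 1)) * (if j = 0 then 0 else 1)
      \<le> max 1 (cmod a) * (real (?d choose (j - 1)) * (if j = 0 then 0 else 1) * ?M)" .
  have 2: "cmod a * cmod (coeff f j) \<le> max 1 (cmod a) * (real (?d choose j) * ?M)"
    using root(2)[of j] by (intro mult_mono) auto
  have "cmod (coeff ([:- a, 1:] * f) j) \<le> cmod (coeff f (j - 1)) * (if j = 0 then 0 else 1) + cmod a * cmod (coeff f j)"
  proof (cases j)
    case 0 then show ?thesis by (simp add: norm_mult)
  next
    case (Suc i)
    then have "coeff ([:- a, 1:] * f) j = coeff f i - a * coeff f j" by simp
    then show ?thesis using Suc norm_triangle_ineq4[of "coeff f i" "a * coeff f j"] by (simp add: norm_mult)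
  qed
  also have "\<dots> \<le> max 1 (cmod a) * (real (?d choose (j - 1)) * (if j = 0 then 0 else 1) * ?M)
      + max 1 (cmod a) * (real (?d choose j) * ?M)"
    using 1 2 by (rule add_mono)
  also have "\<dots> = real (Suc ?d choose j) * (max 1 (cmod a) * ?M)"
    by (cases j) (auto simp: algebra_simps)
  finally show ?case unfolding deg M .
qed

text \<open>The top case of Mahler's coefficient bound, where the binomial is 1.\<close>

lemma mahler_measure_monic_ge_1:
  assumes "lead_coeff f = 1"
  shows "mahler_measure f \<ge> 1"
proof -
  have "f \<noteq> 0" using assms by auto
  from coeff_le_mahler_measure[OF this, of "degree f"] assms show ?thesis by simp
qed

text \<open>Jensen's inequality for the logarithm in tangent-line form:
  \<open>ln t \<le> t - 1\<close> at the ratio of \<open>(cmod (poly f \<zeta>))\<^sup>2\<close> to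
  its mean \<open>?c\<close>, integrated over the circle.\<close>

lemma mahler_measure_sq_le_L2:
  assumes "f \<noteq> 0"
  shows "(mahler_measure f)\<^sup>2 \<le> (L2_norm_circle f)\<^sup>2"
proof -
  let ?c = "(L2_norm_circle f)\<^sup>2" and ?I = "\<integral>\<zeta>. ln (cmod (poly f \<zeta>)) \<partial>haar_circle"
  have c: "?c > 0" using L2_norm_circle_pos[OF assms] by simp
  interpret finite_measure haar_circle by (rule finite_measure_haar_circle)
  have int: "integrable haar_circle (\<lambda>\<zeta>. (cmod (poly f \<zeta>))\<^sup>2)"
    by (rule integral_haar_circle_continuous) (auto intro!: continuous_intros)
  have c_eq: "(\<integral>\<zeta>. (cmod (poly f \<zeta>))\<^sup>2 \<partial>haar_circle) = ?c"
    by (simp add: L2_norm_circle_def integral_nonneg_AE)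
  have "2 * ?I = (\<integral>\<zeta>. 2 * ln (cmod (poly f \<zeta>)) \<partial>haar_circle)" by simp
  also have "\<dots> \<le> (\<integral>\<zeta>. (cmod (poly f \<zeta>))\<^sup>2 / ?c + (ln ?c - 1) \<partial>haar_circle)"
  proof (rule integral_mono_AE)
    show "integrable haar_circle (\<lambda>\<zeta>. 2 * ln (cmod (poly f \<zeta>)))"
      using integrable_ln_poly[OF assms] by simp
    show "integrable haar_circle (\<lambda>\<zeta>. (cmod (poly f \<zeta>))\<^sup>2 / ?c + (ln ?c - 1))"
      using int by simp
    show "AE \<zeta> in haar_circle. 2 * ln (cmod (poly f \<zeta>)) \<le> (cmod (poly f \<zeta>))\<^sup>2 / ?c + (ln ?c - 1)"
      using AE_haar_circle_poly_nonzero[OF assms]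
    proof eventually_elim
      case (elim \<zeta>)
      then have pos: "(cmod (poly f \<zeta>))\<^sup>2 > 0" by simp
      have "ln ((cmod (poly f \<zeta>))\<^sup>2 / ?c) \<le> (cmod (poly f \<zeta>))\<^sup>2 / ?c - 1"
        using pos c by (intro ln_le_minus_one) simp
      moreover have "ln ((cmod (poly f \<zeta>))\<^sup>2 / ?c) = 2 * ln (cmod (poly f \<zeta>)) - ln ?c"
        using elim c by (simp add: ln_div ln_realpow)
      ultimately show ?case by linarith
    qed
  qed
  also have "\<dots> = ln ?c"
    using int c by (simp add: c_eq measure_haar_circle_UNIV)
  finally have "exp (2 * ?I) \<le> ?c" using c by (simp add: ln_ge_iff)
  then show ?thesis by (simp add: mahler_measure_def power2_eq_square flip: exp_add)
qed

text \<open>Parseval turns the left side into a sum over coefficients, each controlled by Mahler's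
  bound; the squares of the binomials add up to the central binomial coefficient.\<close>

lemma L2_norm_le_mahler_measure:
  assumes "f \<noteq> 0" "degree f \<le> D"
  shows "(L2_norm_circle f)\<^sup>2 \<le> real ((2 * D) choose D) * (mahler_measure f)\<^sup>2"
proof -
  have "(cmod (coeff f k))\<^sup>2 \<le> (real (D choose k) * mahler_measure f)\<^sup>2" for k
  proof (rule power_mono)
    have "cmod (coeff f k) \<le> real (degree f choose k) * mahler_measure f"
      by (rule coeff_le_mahler_measure[OF assms(1)])
    also have "\<dots> \<le> real (D choose k) * mahler_measure f"
      using mahler_measure_pos[of f] assms(2) by (intro mult_right_mono) (auto intro: binomial_right_mono)
    finally show "cmod (coeff f k) \<le> real (D choose k) * mahler_measure f" .
  qed simp
  then have "(L2_norm_circle f)\<^sup>2 \<le> (\<Sum>k\<le>D. (real (D choose k) * mahler_measure f)\<^sup>2)"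
    unfolding L2_norm_circle_sq[OF assms(2)] by (intro sum_mono)
  also have "\<dots> = real (\<Sum>k\<le>D. (D choose k)\<^sup>2) * (mahler_measure f)\<^sup>2"
    by (simp add: power_mult_distrib sum_distrib_right)
  also have "(\<Sum>k\<le>D. (D choose k)\<^sup>2) = (2 * D) choose D"
    by (rule choose_square_sum)
  finally show ?thesis .
qed

text \<open>Strictness comes from a second entry in row \<open>2 * D\<close> of Pascal's triangle:
  the one at position 0, distinct from position \<open>D\<close> since
  \<open>D \<ge> 1\<close>.\<close>

lemma central_binomial_less:
  assumes "D \<ge> 1"
  shows "real ((2 * D) choose D) < 4 ^ D"
proof -
  have "((2 * D) choose D) + ((2 * D) choose 0) = (\<Sum>k\<in>{D, 0}. (2 * D) choose k)"
    using assms by simp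
  also have "\<dots> \<le> (\<Sum>k\<le>2 * D. (2 * D) choose k)"
    by (rule sum_mono2) auto
  also have "\<dots> = 4 ^ D"
    by (simp add: choose_row_sum power_mult)
  finally have "(2 * D) choose D < 4 ^ D" by simp
  then have "real ((2 * D) choose D) < real (4 ^ D)" by (simp only: of_nat_less_iff)
  then show ?thesis by simp
qed

section \<open>Orthogonal polynomials on the unit circle\<close>

text \<open>The star operation as a genuine polynomial, agreeing with
  \<open>star_reversed n f\<close> away from 0 when \<open>degree f \<le> n\<close>. The formal
  degree \<open>n\<close> is explicit because the actual degree may be smaller.\<close>

definition rev_poly :: "nat \<Rightarrow> complex poly \<Rightarrow> complex poly" where
  "rev_poly n f = (\<Sum>k\<le>n. monom (cnj (coeff f (n - k))) k)"

lemma coeff_rev_poly: "coeff (rev_poly n f) k = (if k \<le> n then cnj (coeff f (n - k)) else 0)"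
  by (simp add: rev_poly_def coeff_sum sum.delta)

lemma degree_rev_poly_le: "degree (rev_poly n f) \<le> n"
  by (rule degree_le) (simp add: coeff_rev_poly)

lemma rev_poly_rev_poly: "degree f \<le> n \<Longrightarrow> rev_poly n (rev_poly n f) = f"
  by (rule poly_eqI) (auto simp: coeff_rev_poly coeff_eq_0)

lemma rev_poly_smult: "rev_poly n (smult c f) = smult (cnj c) (rev_poly n f)"
  by (rule poly_eqI) (auto simp: coeff_rev_poly)

lemma rev_poly_diff: "rev_poly n (f - g) = rev_poly n f - rev_poly n g"
  by (rule poly_eqI) (auto simp: coeff_rev_poly)

lemma rev_poly_Suc_pCons: "rev_poly (Suc n) (pCons 0 f) = rev_poly n f"
  by (rule poly_eqI) (auto simp: coeff_rev_poly Suc_diff_le le_Suc_eq)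

lemma rev_poly_Suc: "degree f \<le> n \<Longrightarrow> rev_poly (Suc n) f = pCons 0 (rev_poly n f)"
  by (rule poly_eqI) (auto simp: coeff_rev_poly coeff_pCons coeff_eq_0 split: nat.splits)

lemma poly_eq_sum_le:
  fixes f :: "'a::comm_semiring_1 poly"
  shows "degree f \<le> n \<Longrightarrow> poly f x = (\<Sum>k\<le>n. coeff f k * x ^ k)"
  unfolding poly_altdef by (rule sum.mono_neutral_left) (auto simp: coeff_eq_0)

lemma star_reversed_eq_poly:
  assumes "degree f \<le> n" "z \<noteq> 0"
  shows "star_reversed n f z = poly (rev_poly n f) z"
proof -
  have "star_reversed n f z = (\<Sum>k\<le>n. z ^ n * (cnj (coeff f k) * (1 / z) ^ k))"
    by (simp add: star_reversed_def poly_eq_sum_le[OF assms(1)] sum_distrib_left)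
  also have "\<dots> = (\<Sum>k\<le>n. cnj (coeff f (n - k)) * z ^ k)"
    by (rule sum.reindex_bij_witness[of _ "\<lambda>k. n - k" "\<lambda>k. n - k"])
       (use assms(2) in \<open>auto simp: power_diff power_one_over field_simps\<close>)
  also have "\<dots> = poly (rev_poly n f) z"
    unfolding poly_eq_sum_le[OF degree_rev_poly_le] by (simp add: coeff_rev_poly)
  finally show ?thesis .
qed

lemma poly_rev_poly_circle:
  assumes "degree f \<le> n" "cmod z = 1"
  shows "poly (rev_poly n f) z = z ^ n * cnj (poly f z)"
proof -
  have "z \<noteq> 0" using assms by auto
  moreover have "z * cnj z = 1" using complex_norm_square[of z] assms by simp
  ultimately have "1 / cnj z = z" by (auto simp: field_simps)
  then show ?thesis
    using star_reversed_eq_poly[OF assms(1) \<open>z \<noteq> 0\<close>] by (simp add: star_reversed_def)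
qed

text \<open>Nondegeneracy says that the measure is not carried by finitely many points. It makes the
  pairing \<open>ip\<close> definite on all polynomials, so the recursion never stops.\<close>

locale circle_probability =
  fixes \<mu> :: "complex measure"
  assumes sets_eq [measurable_cong]: "sets \<mu> = sets borel"
    and total: "emeasure \<mu> UNIV = 1"
    and on_circle: "AE \<zeta> in \<mu>. cmod \<zeta> = 1"
    and nondegenerate: "\<And>f. f \<noteq> 0 \<Longrightarrow> (\<integral>\<zeta>. (cmod (poly f \<zeta>))\<^sup>2 \<partial>\<mu>) \<noteq> 0"
begin

lemma space_eq: "space \<mu> = UNIV"
  using sets_eq_imp_space_eq[OF sets_eq] by simp

lemma finite_mu: "finite_measure \<mu>"
  by (rule finite_measureI) (simp add: space_eq total)

definition ip :: "complex poly \<Rightarrow> complex poly \<Rightarrow> complex" where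
  "ip f g = (\<integral>\<zeta>. poly f \<zeta> * cnj (poly g \<zeta>) \<partial>\<mu>)"

lemma integrable_ip: "integrable \<mu> (\<lambda>\<zeta>. poly f \<zeta> * cnj (poly g \<zeta>))"
proof -
  interpret finite_measure \<mu> by (rule finite_mu)
  have "continuous_on (sphere 0 1) (\<lambda>\<zeta>. poly f \<zeta> * cnj (poly g \<zeta>))"
    by (intro continuous_intros)
  then have "compact ((\<lambda>\<zeta>. poly f \<zeta> * cnj (poly g \<zeta>)) ` sphere 0 1)"
    by (intro compact_continuous_image) auto
  then have "bounded ((\<lambda>\<zeta>. poly f \<zeta> * cnj (poly g \<zeta>)) ` sphere 0 1)"
    by (rule compact_imp_bounded)
  then obtain C where "\<forall>x\<in>(\<lambda>\<zeta>. poly f \<zeta> * cnj (poly g \<zeta>)) ` sphere 0 1. cmod x \<le> C"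
    unfolding bounded_iff by blast
  then have C: "cmod (poly f \<zeta> * cnj (poly g \<zeta>)) \<le> C" if "cmod \<zeta> = 1" for \<zeta>
    using that by simp
  show ?thesis
  proof (rule integrable_const_bound[of _ C])
    show "AE \<zeta> in \<mu>. cmod (poly f \<zeta> * cnj (poly g \<zeta>)) \<le> C"
      by (rule eventually_mono[OF on_circle C])
  qed measurable
qed

lemma ip_add_left: "ip (f + g) h = ip f h + ip g h"
  unfolding ip_def by (simp add: distrib_right integrable_ip)

lemma ip_diff_left: "ip (f - g) h = ip f h - ip g h"
  unfolding ip_def by (simp add: left_diff_distrib integrable_ip)

lemma ip_smult_left: "ip (smult c f) h = c * ip f h"
  unfolding ip_def by (simp add: mult.assoc)

lemma ip_commute: "ip g f = cnj (ip f g)"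
  unfolding ip_def Bochner_Integration.integral_cnj[symmetric] by (simp add: mult.commute)

lemma ip_diff_right: "ip h (f - g) = ip h f - ip h g"
  by (metis ip_commute ip_diff_left complex_cnj_diff)

lemma ip_smult_right: "ip h (smult c f) = cnj c * ip h f"
  by (metis ip_commute ip_smult_left complex_cnj_mult)

lemma ip_zero [simp]: "ip 0 f = 0" "ip f 0 = 0"
  by (simp_all add: ip_def)

lemma ip_self: "ip f f = complex_of_real (\<integral>\<zeta>. (cmod (poly f \<zeta>))\<^sup>2 \<partial>\<mu>)"
  unfolding ip_def by (simp only: integral_complex_of_real[symmetric] complex_norm_square)

lemma ip_self_eq_0: "ip f f = 0 \<longleftrightarrow> f = 0"
  using nondegenerate[of f] by (auto simp: ip_self)

lemma ip_self_nonneg: "0 \<le> Re (ip f f)"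
  by (simp add: ip_self integral_nonneg_AE)

lemma ip_self_pos: "f \<noteq> 0 \<Longrightarrow> 0 < Re (ip f f)"
  using nondegenerate[of f] ip_self_nonneg[of f] by (simp add: ip_self less_le)

lemma ip_shift: "ip (pCons 0 f) (pCons 0 g) = ip f g"
  unfolding ip_def
proof (rule integral_cong_AE)
  show "AE \<zeta> in \<mu>. poly (pCons 0 f) \<zeta> * cnj (poly (pCons 0 g) \<zeta>) = poly f \<zeta> * cnj (poly g \<zeta>)"
    using on_circle
  proof eventually_elim
    case (elim \<zeta>)
    then have "\<zeta> * cnj \<zeta> = 1" using complex_norm_square[of \<zeta>] by simp
    then show ?case by (simp add: algebra_simps)
  qed
qed measurable

text \<open>On the circle, reversal is conjugation followed by multiplication by the unimodular
  \<open>\<zeta> ^ n\<close>, hence antiunitary; this is why the arguments change places.\<close>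

lemma ip_rev_poly:
  assumes "degree f \<le> n" "degree g \<le> n"
  shows "ip (rev_poly n f) (rev_poly n g) = ip g f"
  unfolding ip_def
proof (rule integral_cong_AE)
  show "AE \<zeta> in \<mu>. poly (rev_poly n f) \<zeta> * cnj (poly (rev_poly n g) \<zeta>) = poly g \<zeta> * cnj (poly f \<zeta>)"
    using on_circle
  proof eventually_elim
    case (elim \<zeta>)
    then have "\<zeta> ^ n * cnj (\<zeta> ^ n) = 1"
      by (simp add: complex_norm_square[symmetric] norm_power flip: power_mult_distrib)
    then have "\<zeta> ^ n * cnj (poly f \<zeta>) * (cnj (\<zeta> ^ n) * poly g \<zeta>) = poly g \<zeta> * cnj (poly f \<zeta>)"
      by (metis mult.assoc mult.commute mult.left_commute mult_1)
    then show ?case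
      unfolding poly_rev_poly_circle[OF assms(1) elim] poly_rev_poly_circle[OF assms(2) elim] by simp
  qed
qed measurable

text \<open>For an orthonormal polynomial \<open>f\<close> of degree \<open>n\<close> this is the
  conjugate of the Verblunsky coefficient: the component of \<open>\<zeta> f\<close> along the unit
  vector \<open>rev_poly n f\<close>.\<close>

definition cnj_verb :: "nat \<Rightarrow> complex poly \<Rightarrow> complex" where
  "cnj_verb n f = ip (pCons 0 f) (rev_poly n f)"

text \<open>The Szego recursion serves as the construction of the orthonormal polynomials.\<close>

definition szego_step :: "nat \<Rightarrow> complex poly \<Rightarrow> complex poly" where
  "szego_step n f = smult (1 / complex_of_real (sqrt (1 - (cmod (cnj_verb n f))\<^sup>2)))
     (pCons 0 f - smult (cnj_verb n f) (rev_poly n f))"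

primrec opoly :: "nat \<Rightarrow> complex poly" where
  "opoly 0 = 1"
| "opoly (Suc n) = szego_step n (opoly n)"

text \<open>Orthogonality to lower degrees is phrased through coefficients rather than
  \<open>degree g < n\<close>, so that the zero polynomial is handled uniformly and nothing else
  remains at \<open>n = 0\<close>.\<close>

definition is_opoly :: "nat \<Rightarrow> complex poly \<Rightarrow> bool" where
  "is_opoly n f \<longleftrightarrow> degree f = n \<and> (\<exists>k>0. lead_coeff f = complex_of_real k) \<and> ip f f = 1 \<and>
     (\<forall>g. (\<forall>k\<ge>n. coeff g k = 0) \<longrightarrow> ip f g = 0)"

text \<open>Reversal of length \<open>n\<close> carries polynomials of degree at most
  \<open>n\<close> without constant term to polynomials of degree below \<open>n\<close>, to which
  \<open>f\<close> is orthogonal.\<close>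

lemma is_opoly_rev_orthogonal:
  assumes "is_opoly n f" and g: "\<forall>k\<ge>n. coeff g k = 0"
  shows "ip (rev_poly n f) (pCons 0 g) = 0"
proof -
  have deg: "degree (pCons 0 g) \<le> n"
    by (rule degree_le) (use g in \<open>auto simp: coeff_pCons split: nat.splits\<close>)
  have df: "degree f \<le> n" using assms(1) by (simp add: is_opoly_def)
  have "ip (rev_poly n f) (pCons 0 g) = ip (rev_poly n f) (rev_poly n (rev_poly n (pCons 0 g)))"
    using rev_poly_rev_poly[OF deg] by simp
  also have "\<dots> = ip (rev_poly n (pCons 0 g)) f"
    by (rule ip_rev_poly[OF df degree_rev_poly_le])
  also have "\<dots> = cnj (ip f (rev_poly n (pCons 0 g)))"
    by (rule ip_commute)
  also have "ip f (rev_poly n (pCons 0 g)) = 0"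
    using assms(1) by (auto simp: is_opoly_def coeff_rev_poly)
  finally show ?thesis by simp
qed

text \<open>The vector \<open>\<psi>\<close> is \<open>\<zeta> f\<close> minus its projection onto
  the reversed polynomial. Both ingredients are orthogonal to \<open>\<zeta>\<close> times degree
  below \<open>n\<close>, and together with the reversed polynomial these span degree at most
  \<open>n\<close>. The squared norm of \<open>\<psi>\<close> is
  \<open>1 - (cmod (cnj_verb n f))\<^sup>2\<close>; its positivity bounds the coefficient.\<close>

lemma is_opoly_step:
  assumes f: "is_opoly n f"
  shows "cmod (cnj_verb n f) < 1" and "is_opoly (Suc n) (szego_step n f)"
    and "lead_coeff (szego_step n f) * complex_of_real (sqrt (1 - (cmod (cnj_verb n f))\<^sup>2)) = lead_coeff f"
    and "smult (complex_of_real (sqrt (1 - (cmod (cnj_verb n f))\<^sup>2))) (szego_step n f)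
      = pCons 0 f - smult (cnj_verb n f) (rev_poly n f)"
proof -
  let ?c = "cnj_verb n f" and ?r = "rev_poly n f"
  define \<psi> where "\<psi> = pCons 0 f - smult ?c ?r"
  obtain \<kappa> where \<kappa>: "\<kappa> > 0" "coeff f n = complex_of_real \<kappa>" and deg: "degree f = n" and norm: "ip f f = 1"
    and orth: "\<And>g. (\<forall>k\<ge>n. coeff g k = 0) \<Longrightarrow> ip f g = 0"
    using f unfolding is_opoly_def by auto
  have rr: "ip ?r ?r = 1" using ip_rev_poly[of f n f] deg norm by simp
  have \<psi>r: "ip \<psi> ?r = 0"
    by (simp add: \<psi>_def ip_diff_left ip_smult_left rr cnj_verb_def)
  have \<psi>_orth: "ip \<psi> g = 0" if g: "\<forall>k\<ge>Suc n. coeff g k = 0" for g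
  proof -
    \<comment> \<open>The reversed polynomial has constant term \<open>\<kappa>\<close>, so this
      multiple removes the constant term of \<open>g\<close> and leaves something divisible by
      \<open>\<zeta>\<close>.\<close>
    define h where "h = g - smult (coeff g 0 / complex_of_real \<kappa>) ?r"
    have "coeff h 0 = 0" using \<kappa> by (simp add: h_def coeff_rev_poly)
    then obtain s where s: "h = pCons 0 s" by (cases h) auto
    have s0: "\<forall>k\<ge>n. coeff s k = 0"
    proof safe
      fix k assume "k \<ge> n"
      then have "coeff h (Suc k) = 0" using g by (simp add: h_def coeff_rev_poly)
      then show "coeff s k = 0" by (simp add: s)
    qed
    have "ip \<psi> h = 0"
      unfolding \<psi>_def s ip_diff_left ip_smult_left ip_shift
      using orth[OF s0] is_opoly_rev_orthogonal[OF f s0] by simp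
    then show ?thesis
      using \<psi>r unfolding h_def ip_diff_right ip_smult_right by simp
  qed
  have coeff\<psi>: "coeff \<psi> (Suc n) = complex_of_real \<kappa>"
    using \<kappa> by (simp add: \<psi>_def coeff_rev_poly)
  have deg\<psi>: "degree \<psi> = Suc n"
  proof (rule antisym)
    show "degree \<psi> \<le> Suc n"
      by (rule degree_le) (use deg in \<open>auto simp: \<psi>_def coeff_rev_poly coeff_pCons coeff_eq_0 split: nat.splits\<close>)
    show "Suc n \<le> degree \<psi>" by (rule le_degree) (use coeff\<psi> \<kappa> in auto)
  qed
  \<comment> \<open>Only the part \<open>pCons 0 f\<close> of the right argument survives, since
    \<open>\<psi>\<close> is orthogonal to the reversed polynomial.\<close>
  have "ip \<psi> \<psi> = ip \<psi> (pCons 0 f)"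
    by (simp add: \<psi>_def[unfolded atomize_eq] ip_diff_right ip_smult_right \<psi>r[unfolded \<psi>_def])
  also have "\<dots> = 1 - ?c * cnj ?c"
    unfolding \<psi>_def ip_diff_left ip_smult_left ip_shift norm cnj_verb_def[symmetric]
    by (simp add: cnj_verb_def ip_commute[of "rev_poly n f"])
  finally have \<psi>\<psi>: "ip \<psi> \<psi> = complex_of_real (1 - (cmod ?c)\<^sup>2)"
    by (simp only: complex_norm_square of_real_diff of_real_1)
  have "\<psi> \<noteq> 0" using deg\<psi> by auto
  from ip_self_pos[OF this] have pos: "1 - (cmod ?c)\<^sup>2 > 0" by (simp add: \<psi>\<psi>)
  then have "(cmod ?c)\<^sup>2 < 1\<^sup>2" by simp
  then show "cmod ?c < 1" by (rule power2_less_imp_less) simp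
  define \<rho> where "\<rho> = sqrt (1 - (cmod ?c)\<^sup>2)"
  have \<rho>: "\<rho> > 0" "\<rho>\<^sup>2 = 1 - (cmod ?c)\<^sup>2" using pos by (auto simp: \<rho>_def)
  have step: "szego_step n f = smult (1 / complex_of_real \<rho>) \<psi>"
    by (simp add: szego_step_def \<psi>_def \<rho>_def)
  have degs: "degree (szego_step n f) = Suc n" using \<rho> deg\<psi> by (simp add: step)
  have lead: "coeff (szego_step n f) (Suc n) = complex_of_real (\<kappa> / \<rho>)"
    by (simp add: step coeff\<psi>)
  show "lead_coeff (szego_step n f) * complex_of_real (sqrt (1 - (cmod ?c)\<^sup>2)) = lead_coeff f"
    using \<rho> \<kappa> deg by (simp add: degs lead flip: \<rho>_def)
  show "smult (complex_of_real (sqrt (1 - (cmod ?c)\<^sup>2))) (szego_step n f) = pCons 0 f - smult ?c ?r"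
    using \<rho> by (simp add: step \<psi>_def flip: \<rho>_def)
  have "ip (szego_step n f) (szego_step n f) = complex_of_real (1 - (cmod ?c)\<^sup>2) / (complex_of_real \<rho> * complex_of_real \<rho>)"
    unfolding step ip_smult_left ip_smult_right \<psi>\<psi> by simp
  also have "\<dots> = 1"
    unfolding \<rho>(2)[symmetric] using \<rho>(1) by (simp add: power2_eq_square)
  finally have "ip (szego_step n f) (szego_step n f) = 1" .
  moreover have "\<exists>k>0. lead_coeff (szego_step n f) = complex_of_real k"
    unfolding degs lead using \<rho> \<kappa> by (intro exI[of _ "\<kappa> / \<rho>"]) simp
  moreover have "ip (szego_step n f) g = 0" if "\<forall>k\<ge>Suc n. coeff g k = 0" for g
    unfolding step ip_smult_left using \<psi>_orth[OF that] by simp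
  ultimately show "is_opoly (Suc n) (szego_step n f)"
    unfolding is_opoly_def using degs by blast
qed

lemma ip_one: "ip 1 1 = 1"
  using total by (simp add: ip_def space_eq measure_def)

lemma is_opoly_opoly: "is_opoly n (opoly n)"
proof (induction n)
  case 0
  have "ip 1 g = 0" if "\<forall>k. coeff g k = 0" for g
  proof -
    have "g = 0" using that by (simp add: poly_eq_iff)
    then show ?thesis by simp
  qed
  then show ?case
    by (auto simp: is_opoly_def ip_one intro: exI[of _ "1::real"])
next
  case (Suc n)
  then show ?case by (simp add: is_opoly_step)
qed

lemma degree_opoly: "degree (opoly n) = n"
  using is_opoly_opoly by (simp add: is_opoly_def)

lemma lead_coeff_opoly: "\<exists>k>0. coeff (opoly n) n = complex_of_real k"
  using is_opoly_opoly[of n] by (auto simp: is_opoly_def)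

lemma ip_opoly_lower: "\<forall>k\<ge>n. coeff g k = 0 \<Longrightarrow> ip (opoly n) g = 0"
  using is_opoly_opoly[of n] by (simp add: is_opoly_def)

lemma ip_opoly: "ip (opoly m) (opoly n) = (if m = n then 1 else 0)"
proof -
  have lt: "ip (opoly m) (opoly n) = 0" if "n < m" for m n
    using that by (intro ip_opoly_lower) (auto simp: coeff_eq_0 degree_opoly)
  consider "m = n" | "n < m" | "m < n" by linarith
  then show ?thesis
  proof cases
    case 1 then show ?thesis using is_opoly_opoly[of n] by (simp add: is_opoly_def)
  next
    case 2 then show ?thesis using lt by simp
  next
    case 3 then show ?thesis using lt[OF 3] ip_commute[of "opoly m" "opoly n"] by simp
  qed
qed

lemma opoly_span:
  assumes "\<forall>k\<ge>n. coeff f k = 0"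
  shows "\<exists>c. f = (\<Sum>k<n. smult (c k) (opoly k))"
  using assms
proof (induction n arbitrary: f)
  case 0
  then have "f = 0" by (simp add: poly_eq_iff)
  then show ?case by simp
next
  case (Suc n)
  obtain \<kappa> where \<kappa>: "\<kappa> > 0" "coeff (opoly n) n = complex_of_real \<kappa>" using lead_coeff_opoly by blast
  define d where "d = coeff f n / complex_of_real \<kappa>"
  have "\<forall>k\<ge>n. coeff (f - smult d (opoly n)) k = 0"
  proof safe
    fix k assume "n \<le> k"
    then consider "k = n" | "k \<ge> Suc n" by linarith
    then show "coeff (f - smult d (opoly n)) k = 0"
    proof cases
      case 1 then show ?thesis using \<kappa> by (simp add: d_def)
    next
      case 2 then show ?thesis using Suc.prems by (simp add: coeff_eq_0 degree_opoly)
    qed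
  qed
  from Suc.IH[OF this] obtain c where c: "f - smult d (opoly n) = (\<Sum>k<n. smult (c k) (opoly k))" by blast
  have "f = (\<Sum>k<Suc n. smult ((c(n := d)) k) (opoly k))"
    using c by (simp add: algebra_simps)
  then show ?case by blast
qed

lemma ip_sum_left: "ip (sum f A) g = (\<Sum>k\<in>A. ip (f k) g)"
  by (induction A rule: infinite_finite_induct)
     (simp_all add: ip_add_left)

lemma ip_sum_right: "ip g (sum f A) = (\<Sum>k\<in>A. ip g (f k))"
proof -
  have "ip g (sum f A) = cnj (\<Sum>k\<in>A. ip (f k) g)"
    by (simp only: ip_commute[of g] ip_sum_left)
  also have "\<dots> = (\<Sum>k\<in>A. ip g (f k))"
    unfolding cnj_sum by (intro sum.cong refl ip_commute[symmetric])
  finally show ?thesis .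
qed

text \<open>Matching leading coefficients, \<open>\<eta> n\<close> minus a positive multiple of
  \<open>opoly n\<close> has lower degree, yet is orthogonal to all earlier members, which coincide
  by induction. It vanishes, and normalization forces the multiple to be 1.\<close>

lemma opoly_unique:
  assumes deg: "\<And>n. degree (\<eta> n) = n" and lead: "\<And>n. \<exists>k>0. lead_coeff (\<eta> n) = complex_of_real k"
    and on: "\<And>m n. ip (\<eta> m) (\<eta> n) = (if m = n then 1 else 0)"
  shows "\<eta> n = opoly n"
proof (induction n rule: less_induct)
  case (less n)
  obtain \<kappa> where \<kappa>: "\<kappa> > 0" "coeff (opoly n) n = complex_of_real \<kappa>" using lead_coeff_opoly by blast
  obtain l where l: "l > 0" "coeff (\<eta> n) n = complex_of_real l" using lead[of n] deg by auto
  define r where "r = l / \<kappa>"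
  have r: "r > 0" using l \<kappa> by (simp add: r_def)
  define g where "g = \<eta> n - smult (complex_of_real r) (opoly n)"
  have "\<forall>k\<ge>n. coeff g k = 0"
  proof safe
    fix k assume "n \<le> k"
    then show "coeff g k = 0"
      using l \<kappa> deg[of n] by (cases "k = n") (auto simp: g_def r_def coeff_eq_0 degree_opoly)
  qed
  then obtain c where c: "g = (\<Sum>k<n. smult (c k) (opoly k))" using opoly_span by blast
  have "ip g (opoly k) = 0" if "k < n" for k
  proof -
    have "ip (\<eta> n) (opoly k) = 0" using on[of n k] less[OF that] that by simp
    then show ?thesis using that by (simp add: g_def ip_diff_left ip_smult_left ip_opoly)
  qed
  then have "ip g g = 0"
    by (subst (2) c) (simp add: ip_sum_right ip_smult_right)
  then have "g = 0" by (simp add: ip_self_eq_0)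
  then have eq: "\<eta> n = smult (complex_of_real r) (opoly n)" by (simp add: g_def)
  have "ip (\<eta> n) (\<eta> n) = complex_of_real (r * r)"
    unfolding eq ip_smult_left ip_smult_right by (simp add: ip_opoly)
  then have "r * r = 1" using on[of n n] by (metis of_real_eq_1_iff)
  then have "r = 1" using r by (metis abs_of_pos abs_square_eq_1 power2_eq_square)
  then show ?case using eq by simp
qed

lemma orthonormal_polys_eq: "orthonormal_polys \<mu> = opoly"
  unfolding orthonormal_polys_def ip_def[symmetric]
proof (rule the_equality)
  show "(\<forall>n. degree (opoly n) = n \<and> (\<exists>\<kappa>>0. lead_coeff (opoly n) = complex_of_real \<kappa>)) \<and>
    (\<forall>m n. ip (opoly m) (opoly n) = (if m = n then 1 else 0))"
    using lead_coeff_opoly by (simp add: degree_opoly ip_opoly)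
next
  fix \<eta> assume "(\<forall>n. degree (\<eta> n) = n \<and> (\<exists>\<kappa>>0. lead_coeff (\<eta> n) = complex_of_real \<kappa>)) \<and>
    (\<forall>m n. ip (\<eta> m) (\<eta> n) = (if m = n then 1 else 0))"
  then show "\<eta> = opoly" using opoly_unique[of \<eta>] by blast
qed

section \<open>Verblunsky coefficients and the Szego recursions\<close>

abbreviation "kappa \<equiv> op_kappa \<mu>"
abbreviation "alpha \<equiv> verblunsky \<mu>"
definition "opoly_star n = rev_poly n (opoly n)"
definition "rho n = sqrt (1 - (cmod (alpha n))\<^sup>2)"

lemma coeff_opoly_top: "coeff (opoly n) n = complex_of_real (kappa n)" and kappa_pos: "kappa n > 0"
  using lead_coeff_opoly[of n] by (auto simp: op_kappa_def orthonormal_polys_eq degree_opoly)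

lemma verblunsky_eq: "alpha n = cnj (cnj_verb n (opoly n))"
  unfolding verblunsky_def orthonormal_polys_eq
proof (rule the_equality)
  note st = is_opoly_step[OF is_opoly_opoly[of n]]
  let ?c = "cnj_verb n (opoly n)"
  have star: "star_reversed n (opoly n) \<zeta> = poly (rev_poly n (opoly n)) \<zeta>" if "\<zeta> \<noteq> 0" for \<zeta>
    using star_reversed_eq_poly[OF _ that] by (simp add: degree_opoly)
  show "cmod (cnj ?c) < 1 \<and> (\<forall>\<zeta>. \<zeta> \<noteq> 0 \<longrightarrow>
      complex_of_real (sqrt (1 - (cmod (cnj ?c))\<^sup>2)) * poly (opoly (Suc n)) \<zeta> =
      \<zeta> * poly (opoly n) \<zeta> - cnj (cnj ?c) * star_reversed n (opoly n) \<zeta>)"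
  proof (intro conjI allI impI)
    show "cmod (cnj ?c) < 1" using st(1) by simp
    fix \<zeta> :: complex assume "\<zeta> \<noteq> 0"
    have "poly (smult (complex_of_real (sqrt (1 - (cmod ?c)\<^sup>2))) (szego_step n (opoly n))) \<zeta>
        = poly (pCons 0 (opoly n) - smult ?c (rev_poly n (opoly n))) \<zeta>"
      using st(4) by simp
    then show "complex_of_real (sqrt (1 - (cmod (cnj ?c))\<^sup>2)) * poly (opoly (Suc n)) \<zeta> =
      \<zeta> * poly (opoly n) \<zeta> - cnj (cnj ?c) * star_reversed n (opoly n) \<zeta>"
      by (simp add: star[OF \<open>\<zeta> \<noteq> 0\<close>])
  qed
  fix \<alpha> assume \<alpha>: "cmod \<alpha> < 1 \<and> (\<forall>\<zeta>. \<zeta> \<noteq> 0 \<longrightarrow>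
      complex_of_real (sqrt (1 - (cmod \<alpha>)\<^sup>2)) * poly (opoly (Suc n)) \<zeta> =
      \<zeta> * poly (opoly n) \<zeta> - cnj \<alpha> * star_reversed n (opoly n) \<zeta>)"
  let ?r = "complex_of_real (sqrt (1 - (cmod \<alpha>)\<^sup>2))"
  let ?d = "smult ?r (opoly (Suc n)) - (pCons 0 (opoly n) - smult (cnj \<alpha>) (rev_poly n (opoly n)))"
  have "poly ?d \<zeta> = 0" if "\<zeta> \<noteq> 0" for \<zeta>
    using \<alpha> that star[OF that] by simp
  then have "UNIV - {0} \<subseteq> {\<zeta>. poly ?d \<zeta> = 0}" by auto
  moreover have "infinite (UNIV - {0 :: complex})"
    by (simp add: infinite_UNIV_char_0)
  ultimately have "?d = 0" using poly_roots_finite finite_subset by blast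
  then have \<alpha>_eq: "smult ?r (opoly (Suc n)) = pCons 0 (opoly n) - smult (cnj \<alpha>) (rev_poly n (opoly n))" by simp
  let ?s = "complex_of_real (sqrt (1 - (cmod ?c)\<^sup>2))"
  have c_eq: "smult ?s (opoly (Suc n)) = pCons 0 (opoly n) - smult ?c (rev_poly n (opoly n))"
    using st(4) by simp
  \<comment> \<open>Uniqueness needs two comparisons. The top coefficients do not see the reversed
    polynomial, so the two square roots agree; afterwards its nonzero constant term separates the
    coefficients themselves.\<close>
  have "coeff (smult ?r (opoly (Suc n))) (Suc n) = coeff (smult ?s (opoly (Suc n))) (Suc n)"
    unfolding \<alpha>_eq c_eq by (simp add: coeff_rev_poly)
  moreover have "coeff (opoly (Suc n)) (Suc n) \<noteq> 0"
    using coeff_opoly_top[of "Suc n"] kappa_pos[of "Suc n"] by simp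
  ultimately have "?r = ?s" by (simp del: opoly.simps)
  then have "smult ?r (opoly (Suc n)) = smult ?s (opoly (Suc n))"
    by (rule arg_cong[where f = "\<lambda>x. smult x (opoly (Suc n))"])
  then have "pCons 0 (opoly n) - smult (cnj \<alpha>) (rev_poly n (opoly n)) = pCons 0 (opoly n) - smult ?c (rev_poly n (opoly n))"
    unfolding \<alpha>_eq c_eq .
  then have "smult (cnj \<alpha>) (rev_poly n (opoly n)) = smult ?c (rev_poly n (opoly n))"
    by (metis diff_diff_eq2 add_diff_cancel_left')
  then have "coeff (smult (cnj \<alpha>) (rev_poly n (opoly n))) 0 = coeff (smult ?c (rev_poly n (opoly n))) 0" by simp
  then have "cnj \<alpha> = ?c"
    using coeff_opoly_top[of n] kappa_pos[of n] by (simp add: coeff_rev_poly)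
  then show "\<alpha> = cnj ?c" by (metis complex_cnj_cnj)
qed

lemma norm_alpha: "cmod (alpha n) < 1"
  using is_opoly_step(1)[OF is_opoly_opoly[of n]] by (simp add: verblunsky_eq)

lemma rho_pos: "rho n > 0" and rho_sq: "(rho n)\<^sup>2 = 1 - (cmod (alpha n))\<^sup>2"
proof -
  have "(cmod (alpha n))\<^sup>2 < 1" using norm_alpha[of n] by (simp add: power_less_one_iff abs_square_less_1)
  then show "rho n > 0" "(rho n)\<^sup>2 = 1 - (cmod (alpha n))\<^sup>2" by (auto simp: rho_def)
qed

lemma szego: "smult (complex_of_real (rho n)) (opoly (Suc n))
    = pCons 0 (opoly n) - smult (cnj (alpha n)) (opoly_star n)"
  using is_opoly_step(4)[OF is_opoly_opoly[of n]] by (simp add: rho_def verblunsky_eq opoly_star_def)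

lemma kappa_Suc: "kappa (Suc n) * rho n = kappa n"
proof -
  have "lead_coeff (opoly (Suc n)) * complex_of_real (rho n) = lead_coeff (opoly n)"
    using is_opoly_step(3)[OF is_opoly_opoly[of n]] by (simp add: rho_def verblunsky_eq)
  then have "complex_of_real (kappa (Suc n) * rho n) = complex_of_real (kappa n)"
    by (simp only: degree_opoly coeff_opoly_top of_real_mult)
  then show ?thesis by (simp only: of_real_eq_iff)
qed

lemma kappa_0: "kappa 0 = 1"
  by (simp add: op_kappa_def orthonormal_polys_eq)

lemma degree_opoly_star: "degree (opoly_star n) \<le> n"
  by (simp add: opoly_star_def degree_rev_poly_le)

text \<open>Reversal of length \<open>Suc n\<close> applied to both sides of the Szego
  recursion.\<close>

lemma szego_star: "smult (complex_of_real (rho n)) (opoly_star (Suc n))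
    = opoly_star n - smult (alpha n) (pCons 0 (opoly n))"
proof -
  have "smult (complex_of_real (rho n)) (opoly_star (Suc n))
      = rev_poly (Suc n) (smult (complex_of_real (rho n)) (opoly (Suc n)))"
    by (simp add: opoly_star_def rev_poly_smult del: opoly.simps)
  also have "\<dots> = opoly_star n - smult (alpha n) (rev_poly (Suc n) (opoly_star n))"
    unfolding szego by (simp add: rev_poly_diff rev_poly_smult rev_poly_Suc_pCons flip: opoly_star_def)
  also have "rev_poly (Suc n) (opoly_star n) = pCons 0 (opoly n)"
    unfolding rev_poly_Suc[OF degree_opoly_star]
    by (simp add: opoly_star_def rev_poly_rev_poly degree_opoly)
  finally show ?thesis .
qed

text \<open>Eliminates \<open>opoly_star n\<close> from the two recursions, using that 1 minus the
  squared modulus of the coefficient is the square of \<open>rho n\<close>. In this form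
  \<open>\<zeta>\<close> times level \<open>n\<close> is expressed by level \<open>Suc n\<close>
  alone, as the cross commutator requires.\<close>

lemma szego_inverse: "smult (complex_of_real (rho n)) (pCons 0 (opoly n))
    = opoly (Suc n) + smult (cnj (alpha n)) (opoly_star (Suc n))"
proof -
  let ?r = "complex_of_real (rho n)"
  have "smult ?r (opoly (Suc n) + smult (cnj (alpha n)) (opoly_star (Suc n)))
      = smult ?r (opoly (Suc n)) + smult (cnj (alpha n)) (smult ?r (opoly_star (Suc n)))"
    by (simp add: smult_add_right mult.commute del: opoly.simps)
  also have "\<dots> = smult (1 - cnj (alpha n) * alpha n) (pCons 0 (opoly n))"
    unfolding szego szego_star by (simp add: smult_diff_right smult_diff_left del: smult_pCons)
  also have "1 - cnj (alpha n) * alpha n = ?r * ?r"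
    using rho_sq[of n] complex_norm_square[of "alpha n"]
    by (metis mult.commute of_real_1 of_real_diff of_real_mult power2_eq_square)
  also have "smult (?r * ?r) (pCons 0 (opoly n)) = smult ?r (smult ?r (pCons 0 (opoly n)))"
    by (simp only: smult_smult)
  finally show ?thesis
    using rho_pos[of n] by (metis smult_cancel of_real_eq_0_iff less_irrefl)
qed

lemma ip_opoly_star_lower: "\<forall>k\<ge>n. coeff g k = 0 \<Longrightarrow> ip (opoly_star n) (pCons 0 g) = 0"
  unfolding opoly_star_def by (rule is_opoly_rev_orthogonal[OF is_opoly_opoly])

lemma ip_opoly_star_self: "ip (opoly_star n) (opoly_star n) = 1"
  by (simp add: opoly_star_def ip_rev_poly degree_opoly ip_opoly)

lemma coeff_opoly_star_0: "coeff (opoly_star n) 0 = complex_of_real (kappa n)"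
  by (simp add: opoly_star_def coeff_rev_poly coeff_opoly_top)

text \<open>The logarithm of \<open>(kappa n)\<^sup>2\<close> telescopes into the terms
  \<open>- ln (1 - (cmod (alpha j))\<^sup>2)\<close>, each of which dominates
  \<open>(cmod (alpha j))\<^sup>2\<close>.\<close>

lemma sum_verblunsky_le: "(\<Sum>j<n. (cmod (alpha j))\<^sup>2) \<le> ln ((kappa n)\<^sup>2)"
proof (induction n)
  case 0
  show ?case by (simp add: kappa_0)
next
  case (Suc n)
  have "(kappa n)\<^sup>2 = (kappa (Suc n))\<^sup>2 * (1 - (cmod (alpha n))\<^sup>2)"
    by (metis kappa_Suc power_mult_distrib rho_sq)
  moreover have pos: "1 - (cmod (alpha n))\<^sup>2 > 0" using rho_pos[of n] rho_sq[of n] by (metis zero_less_power)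
  ultimately have "ln ((kappa n)\<^sup>2) = ln ((kappa (Suc n))\<^sup>2) + ln (1 - (cmod (alpha n))\<^sup>2)"
    using kappa_pos[of "Suc n"] by (simp add: ln_mult)
  moreover have "ln (1 - (cmod (alpha n))\<^sup>2) \<le> - (cmod (alpha n))\<^sup>2"
    using ln_le_minus_one[OF pos] by simp
  ultimately show ?case using Suc by simp
qed

end


section \<open>The measure with density |q|^2\<close>

lemma integral_circle_measure:
  "(\<integral>\<zeta>. poly f \<zeta> * cnj (poly g \<zeta>) \<partial>circle_measure q)
    = (\<integral>\<zeta>. poly (q * f) \<zeta> * cnj (poly (q * g) \<zeta>) \<partial>haar_circle) / complex_of_real ((L2_norm_circle q)\<^sup>2)"
proof -
  have "(\<integral>\<zeta>. poly f \<zeta> * cnj (poly g \<zeta>) \<partial>circle_measure q)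
      = (\<integral>\<zeta>. ((cmod (poly q \<zeta>))\<^sup>2 / (L2_norm_circle q)\<^sup>2) *\<^sub>R (poly f \<zeta> * cnj (poly g \<zeta>)) \<partial>haar_circle)"
    unfolding circle_measure_def by (rule integral_density) auto
  also have "\<dots> = (\<integral>\<zeta>. poly (q * f) \<zeta> * cnj (poly (q * g) \<zeta>) / complex_of_real ((L2_norm_circle q)\<^sup>2) \<partial>haar_circle)"
  proof (rule Bochner_Integration.integral_cong[OF refl])
    fix \<zeta> :: complex
    have "complex_of_real ((cmod (poly q \<zeta>))\<^sup>2) = poly q \<zeta> * cnj (poly q \<zeta>)"
      by (rule complex_norm_square)
    then show "((cmod (poly q \<zeta>))\<^sup>2 / (L2_norm_circle q)\<^sup>2) *\<^sub>R (poly f \<zeta> * cnj (poly g \<zeta>))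
        = poly (q * f) \<zeta> * cnj (poly (q * g) \<zeta>) / complex_of_real ((L2_norm_circle q)\<^sup>2)"
      unfolding scaleR_conv_of_real of_real_divide by (simp add: mult_ac)
  qed
  also have "\<dots> = (\<integral>\<zeta>. poly (q * f) \<zeta> * cnj (poly (q * g) \<zeta>) \<partial>haar_circle) / complex_of_real ((L2_norm_circle q)\<^sup>2)"
    by (rule integral_divide_zero)
  finally show ?thesis .
qed

lemma integral_circle_measure_norm_sq:
  "(\<integral>\<zeta>. (cmod (poly f \<zeta>))\<^sup>2 \<partial>circle_measure q) = (L2_norm_circle (q * f))\<^sup>2 / (L2_norm_circle q)\<^sup>2"
proof -
  have haar: "(\<integral>\<zeta>. poly g \<zeta> * cnj (poly g \<zeta>) \<partial>haar_circle) = complex_of_real ((L2_norm_circle g)\<^sup>2)" for g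
  proof -
    have "(L2_norm_circle g)\<^sup>2 = (\<integral>\<zeta>. (cmod (poly g \<zeta>))\<^sup>2 \<partial>haar_circle)"
      by (simp add: L2_norm_circle_def integral_nonneg_AE)
    then show ?thesis
      by (simp only: integral_complex_of_real[symmetric] complex_norm_square)
  qed
  have "complex_of_real (\<integral>\<zeta>. (cmod (poly f \<zeta>))\<^sup>2 \<partial>circle_measure q)
      = (\<integral>\<zeta>. poly f \<zeta> * cnj (poly f \<zeta>) \<partial>circle_measure q)"
    by (simp only: integral_complex_of_real[symmetric] complex_norm_square)
  also have "\<dots> = complex_of_real ((L2_norm_circle (q * f))\<^sup>2 / (L2_norm_circle q)\<^sup>2)"
    unfolding integral_circle_measure haar by simp
  finally show ?thesis by (rule of_real_eq_iff[THEN iffD1])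
qed

lemma circle_probability_circle_measure:
  assumes "q \<noteq> 0"
  shows "circle_probability (circle_measure q)"
proof
  show sets: "sets (circle_measure q) = sets borel" by (simp add: circle_measure_def)
  have L2: "L2_norm_circle q > 0" using assms by (rule L2_norm_circle_pos)
  have int: "integrable haar_circle (\<lambda>\<zeta>. (cmod (poly q \<zeta>))\<^sup>2)"
    by (rule integral_haar_circle_continuous) (auto intro!: continuous_intros)
  have "emeasure (circle_measure q) UNIV = (\<integral>\<^sup>+\<zeta>. ennreal ((cmod (poly q \<zeta>))\<^sup>2 / (L2_norm_circle q)\<^sup>2) \<partial>haar_circle)"
    unfolding circle_measure_def by (simp add: emeasure_density)
  also have "\<dots> = ennreal (\<integral>\<zeta>. (cmod (poly q \<zeta>))\<^sup>2 / (L2_norm_circle q)\<^sup>2 \<partial>haar_circle)"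
    using int by (intro nn_integral_eq_integral) auto
  also have "(\<integral>\<zeta>. (cmod (poly q \<zeta>))\<^sup>2 / (L2_norm_circle q)\<^sup>2 \<partial>haar_circle) = 1"
  proof -
    have "(\<integral>\<zeta>. (cmod (poly q \<zeta>))\<^sup>2 \<partial>haar_circle) = (L2_norm_circle q)\<^sup>2"
      by (simp add: L2_norm_circle_def integral_nonneg_AE)
    then show ?thesis using L2 by simp
  qed
  finally show "emeasure (circle_measure q) UNIV = 1" by simp
  show "AE \<zeta> in circle_measure q. cmod \<zeta> = 1"
    unfolding circle_measure_def
    by (subst AE_density) (use AE_haar_circle_norm in \<open>auto elim: eventually_mono\<close>)
  show "(\<integral>\<zeta>. (cmod (poly f \<zeta>))\<^sup>2 \<partial>circle_measure q) \<noteq> 0" if "f \<noteq> 0" for f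
    using L2_norm_circle_pos[of "q * f"] L2 that assms
    unfolding integral_circle_measure_norm_sq by simp
qed

lemma op_kappa_le_mahler:
  assumes "q \<noteq> 0"
  shows "(op_kappa (circle_measure q) n)\<^sup>2 \<le> (L2_norm_circle q)\<^sup>2 / (mahler_measure q)\<^sup>2"
proof -
  interpret circle_probability "circle_measure q" by (rule circle_probability_circle_measure[OF assms])
  define f where "f = smult (1 / complex_of_real (kappa n)) (opoly n)"
  have k: "kappa n > 0" by (rule kappa_pos)
  have lead: "lead_coeff f = 1"
    using k by (simp add: f_def degree_opoly coeff_opoly_top)
  then have "f \<noteq> 0" by auto
  have "ip f f = complex_of_real (1 / (kappa n)\<^sup>2)"
    unfolding f_def ip_smult_left ip_smult_right by (simp add: ip_opoly power2_eq_square)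
  then have L2: "(L2_norm_circle (q * f))\<^sup>2 = (L2_norm_circle q)\<^sup>2 / (kappa n)\<^sup>2"
    using L2_norm_circle_pos[OF assms]
    unfolding ip_self integral_circle_measure_norm_sq of_real_eq_iff by (simp add: field_simps)
  have "(mahler_measure q)\<^sup>2 \<le> (mahler_measure q * mahler_measure f)\<^sup>2"
    using mahler_measure_monic_ge_1[OF lead] mahler_measure_pos[of q] by (intro power_mono) auto
  also have "\<dots> = (mahler_measure (q * f))\<^sup>2"
    using mahler_measure_mult[OF assms \<open>f \<noteq> 0\<close>] by simp
  also have "\<dots> \<le> (L2_norm_circle (q * f))\<^sup>2"
    using assms \<open>f \<noteq> 0\<close> by (intro mahler_measure_sq_le_L2) simp
  finally show ?thesis
    using k mahler_measure_pos[of q] unfolding L2 by (simp add: field_simps)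
qed

lemma verblunsky_sums:
  assumes "q \<noteq> 0"
  shows "summable (\<lambda>n. (cmod (verblunsky (circle_measure q) n))\<^sup>2)"
    and "(\<Sum>n. (cmod (verblunsky (circle_measure q) n))\<^sup>2) \<le> ln ((L2_norm_circle q)\<^sup>2 / (mahler_measure q)\<^sup>2)"
proof -
  interpret circle_probability "circle_measure q" by (rule circle_probability_circle_measure[OF assms])
  have le: "(\<Sum>j<n. (cmod (alpha j))\<^sup>2) \<le> ln ((L2_norm_circle q)\<^sup>2 / (mahler_measure q)\<^sup>2)" for n
  proof -
    have "ln ((kappa n)\<^sup>2) \<le> ln ((L2_norm_circle q)\<^sup>2 / (mahler_measure q)\<^sup>2)"
      using op_kappa_le_mahler[OF assms, of n] kappa_pos[of n] by (intro ln_mono) auto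
    then show ?thesis using sum_verblunsky_le[of n] by linarith
  qed
  show "summable (\<lambda>n. (cmod (alpha n))\<^sup>2)"
    by (rule summableI_nonneg_bounded[OF _ le]) simp
  then show "(\<Sum>n. (cmod (alpha n))\<^sup>2) \<le> ln ((L2_norm_circle q)\<^sup>2 / (mahler_measure q)\<^sup>2)"
    by (rule suminf_le_const[OF _ le])
qed

section \<open>The Hardy space as a sequence space\<close>

text \<open>For the index shifts below, \<open>pull\<close> is the backward shift and
  \<open>push\<close> the multiplication operator. The guard keeps the definition total: composition
  with a non-injective map can destroy square-summability.\<close>

lift_definition pull :: "('a \<Rightarrow> 'b) \<Rightarrow> 'b ell2 \<Rightarrow> 'a ell2" is
  "\<lambda>h b k. if inj h then b (h k) else 0"
proof -
  fix h :: "'a \<Rightarrow> 'b" and b :: "'b \<Rightarrow> complex"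
  assume b: "(\<lambda>k. (cmod (b k))\<^sup>2) summable_on UNIV"
  show "(\<lambda>k. (cmod (if inj h then b (h k) else 0))\<^sup>2) summable_on UNIV"
  proof (cases "inj h")
    case True
    have "(\<lambda>k. (cmod (b k))\<^sup>2) summable_on range h"
      using b by (rule summable_on_subset_banach) simp
    then show ?thesis using summable_on_reindex[OF True, of "\<lambda>k. (cmod (b k))\<^sup>2"] True by (simp add: o_def)
  qed simp
qed

lift_definition push :: "('a \<Rightarrow> 'b) \<Rightarrow> 'a ell2 \<Rightarrow> 'b ell2" is
  "\<lambda>h a k. if inj h \<and> k \<in> range h then a (inv h k) else 0"
proof -
  fix h :: "'a \<Rightarrow> 'b" and a :: "'a \<Rightarrow> complex"
  assume a: "(\<lambda>k. (cmod (a k))\<^sup>2) summable_on UNIV"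
  show "(\<lambda>k. (cmod (if inj h \<and> k \<in> range h then a (inv h k) else 0))\<^sup>2) summable_on UNIV"
  proof (cases "inj h")
    case True
    have "(\<lambda>k. (cmod (a (inv h k)))\<^sup>2) summable_on range h"
      using summable_on_reindex[OF True, of "\<lambda>k. (cmod (a (inv h k)))\<^sup>2"] a True by (simp add: o_def)
    then have "(\<lambda>k. (cmod (if inj h \<and> k \<in> range h then a (inv h k) else 0))\<^sup>2) summable_on range h"
      by (rule summable_on_cong[THEN iffD1, rotated]) (simp add: True)
    then show ?thesis
      by (rule summable_on_cong_neutral[THEN iffD1, rotated -1]) auto
  qed simp
qed

lemma coord_pull: "inj h \<Longrightarrow> coord (pull h y) k = coord y (h k)"
  by transfer simp

lemma coord_push: "inj h \<Longrightarrow> coord (push h x) (h k) = coord x k"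
  by transfer simp

lemma coord_push_outside: "k \<notin> range h \<Longrightarrow> coord (push h x) k = 0"
  by transfer simp

lemma pull_push: "inj h \<Longrightarrow> pull h (push h x) = x"
  by (rule ell2_eqI) (simp add: coord_pull coord_push)

lemma cinner_push:
  assumes "inj h"
  shows "cinner (push h x) y = cinner x (pull h y)"
proof -
  have "cinner (push h x) y = (\<Sum>\<^sub>\<infinity>k\<in>range h. coord (push h x) k * cnj (coord y k))"
    unfolding cinner_def by (rule infsum_cong_neutral) (auto simp: coord_push_outside)
  also have "\<dots> = cinner x (pull h y)"
    unfolding cinner_def infsum_reindex[OF assms] o_def
    by (simp add: coord_push coord_pull assms)
  finally show ?thesis .
qed

lemma cinner_pull: "inj h \<Longrightarrow> cinner (pull h x) y = cinner x (push h y)"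
  by (metis cinner_commute cinner_push)

lemma norm_push: "inj h \<Longrightarrow> norm (push h x) = norm x"
  by (simp add: norm_ell2_def inner_ell2_def cinner_push pull_push)

text \<open>The norm defect consists of the coordinates outside the range. For homogeneous vectors
  it will be a single edge coefficient.\<close>

lemma norm_pull_sq:
  assumes "inj h"
  shows "(norm (pull h x))\<^sup>2 = (norm x)\<^sup>2 - (\<Sum>\<^sub>\<infinity>k\<in>- range h. (cmod (coord x k))\<^sup>2)"
proof -
  have s: "(\<lambda>k. (cmod (coord x k))\<^sup>2) summable_on A" for A
    using summable_coord by (rule summable_on_subset_banach) simp
  have "(norm x)\<^sup>2 = (\<Sum>\<^sub>\<infinity>k\<in>range h. (cmod (coord x k))\<^sup>2) + (\<Sum>\<^sub>\<infinity>k\<in>- range h. (cmod (coord x k))\<^sup>2)"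
    unfolding norm_sq_ell2 by (subst infsum_Un_disjoint[symmetric]) (auto intro: s)
  also have "(\<Sum>\<^sub>\<infinity>k\<in>range h. (cmod (coord x k))\<^sup>2) = (norm (pull h x))\<^sup>2"
    unfolding norm_sq_ell2 infsum_reindex[OF assms] o_def by (simp add: coord_pull assms)
  finally show ?thesis by simp
qed

lemma norm_pull_le:
  assumes "inj h"
  shows "norm (pull h x) \<le> norm x"
proof (rule power2_le_imp_le)
  have "0 \<le> (\<Sum>\<^sub>\<infinity>k\<in>- range h. (cmod (coord x k))\<^sup>2)" by (rule infsum_nonneg) simp
  then show "(norm (pull h x))\<^sup>2 \<le> (norm x)\<^sup>2" unfolding norm_pull_sq[OF assms] by linarith
qed simp

lemma bounded_linear_pull:
  assumes "inj h"
  shows "bounded_linear (pull h)"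
proof (rule bounded_linear_intro)
  show "pull h (x + y) = pull h x + pull h y" "pull h (r *\<^sub>R x) = r *\<^sub>R pull h x" for x y r
    by (rule ell2_eqI, simp add: coord_pull assms)+
  show "norm (pull h x) \<le> norm x * 1" for x
    using norm_pull_le[OF assms, of x] by simp
qed

section \<open>Square-summable power series on the bidisc\<close>

lemma summable_power_series2:
  assumes "cmod z < 1" "cmod w < 1"
  shows "(\<lambda>(i, j). coord x (i, j) * z ^ i * w ^ j) summable_on UNIV"
proof (rule abs_summable_summable, rule summable_on_comparison_test)
  have geo: "((\<lambda>n. r ^ n) has_sum (1 / (1 - r))) UNIV" if "0 \<le> r" "r < 1" for r :: real
    using that geometric_sums[of r] by (intro sums_nonneg_imp_has_sum) auto
  have "(\<lambda>(i, j). cmod z ^ i * cmod w ^ j) summable_on (UNIV \<times> UNIV)"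
  proof (rule summable_on_SigmaI)
    show "((\<lambda>j. case (i, j) of (i, j) \<Rightarrow> cmod z ^ i * cmod w ^ j) has_sum cmod z ^ i * (1 / (1 - cmod w))) UNIV" for i
      unfolding prod.case by (intro has_sum_cmult_right geo) (use assms in auto)
    show "(\<lambda>i. cmod z ^ i * (1 / (1 - cmod w))) summable_on UNIV"
      by (intro summable_on_cmult_left has_sum_imp_summable[OF geo]) (use assms in auto)
  qed auto
  then show "(\<lambda>p. norm x * (cmod z ^ fst p * cmod w ^ snd p)) summable_on UNIV"
    by (intro summable_on_cmult_right) (simp add: case_prod_unfold)
  fix p :: "nat \<times> nat"
  show "norm (case p of (i, j) \<Rightarrow> coord x (i, j) * z ^ i * w ^ j) \<le> norm x * (cmod z ^ fst p * cmod w ^ snd p)"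
    using cmod_coord_le[of x p] by (auto simp: norm_mult norm_power mult.assoc split: prod.splits intro!: mult_right_mono)
qed simp

definition hfun :: "(nat \<times> nat) ell2 \<Rightarrow> complex \<times> complex \<Rightarrow> complex" where
  "hfun x = power_series2 (coord x)"

lemma hfun_in: "cmod z < 1 \<Longrightarrow> cmod w < 1 \<Longrightarrow> hfun x (z, w) = (\<Sum>\<^sub>\<infinity>(i, j). coord x (i, j) * z ^ i * w ^ j)"
  by (simp add: hfun_def power_series2_def bidisc_def)

lemma hfun_out: "\<not> (cmod z < 1 \<and> cmod w < 1) \<Longrightarrow> hfun x (z, w) = 0"
  by (auto simp: hfun_def power_series2_def bidisc_def)

lemma hfun_has_sum:
  "cmod z < 1 \<Longrightarrow> cmod w < 1 \<Longrightarrow> ((\<lambda>(i, j). coord x (i, j) * z ^ i * w ^ j) has_sum hfun x (z, w)) UNIV"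
  unfolding hfun_in by (intro has_sum_infsum summable_power_series2)

lemma hfun_eqI:
  assumes "cmod z < 1" "cmod w < 1"
    and "((\<lambda>(i, j). coord x (i, j) * z ^ i * w ^ j) has_sum s) UNIV"
  shows "hfun x (z, w) = s"
  using hfun_has_sum[OF assms(1,2)] assms(3) by (rule has_sum_unique)

lemma hfun_add: "hfun (x + y) = (\<lambda>v. hfun x v + hfun y v)"
proof
  fix v :: "complex \<times> complex"
  obtain z w where v: "v = (z, w)" by force
  show "hfun (x + y) v = hfun x v + hfun y v"
  proof (cases "cmod z < 1 \<and> cmod w < 1")
    case True
    then have "((\<lambda>p. (case p of (i, j) \<Rightarrow> coord x (i, j) * z ^ i * w ^ j)
        + (case p of (i, j) \<Rightarrow> coord y (i, j) * z ^ i * w ^ j)) has_sum (hfun x v + hfun y v)) UNIV"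
      unfolding v by (intro has_sum_add hfun_has_sum) auto
    then have "((\<lambda>(i, j). coord (x + y) (i, j) * z ^ i * w ^ j) has_sum (hfun x v + hfun y v)) UNIV"
      by (simp add: case_prod_unfold distrib_right)
    then show ?thesis using True unfolding v by (intro hfun_eqI) auto
  next
    case False then show ?thesis by (simp add: v hfun_out)
  qed
qed

lemma hfun_cscale: "hfun (cscale c x) = (\<lambda>v. c * hfun x v)"
proof
  fix v :: "complex \<times> complex"
  obtain z w where v: "v = (z, w)" by force
  show "hfun (cscale c x) v = c * hfun x v"
  proof (cases "cmod z < 1 \<and> cmod w < 1")
    case True
    then have "((\<lambda>p. c * (case p of (i, j) \<Rightarrow> coord x (i, j) * z ^ i * w ^ j)) has_sum (c * hfun x v)) UNIV"
      unfolding v by (intro has_sum_cmult_right hfun_has_sum) auto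
    then have "((\<lambda>(i, j). coord (cscale c x) (i, j) * z ^ i * w ^ j) has_sum (c * hfun x v)) UNIV"
      by (simp add: case_prod_unfold mult.assoc)
    then show ?thesis using True unfolding v by (intro hfun_eqI) auto
  next
    case False then show ?thesis by (simp add: v hfun_out)
  qed
qed

lemma hfun_diff: "hfun (x - y) = (\<lambda>v. hfun x v - hfun y v)"
proof -
  have "x - y = x + cscale (-1) y" by (rule ell2_eqI) simp
  then have "hfun (x - y) = (\<lambda>v. hfun x v + (-1) * hfun y v)"
    by (simp only: hfun_add hfun_cscale)
  then show ?thesis by simp
qed

lemma hfun_zero: "hfun 0 = (\<lambda>_. 0)"
  using hfun_diff[of 0 0] by simp

lemma powser_eq_0D:
  fixes b :: "nat \<Rightarrow> complex"
  assumes "\<And>z. cmod z < 1 \<Longrightarrow> ((\<lambda>i. b i * z ^ i) has_sum 0) UNIV"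
  shows "b i = 0"
proof (rule ccontr)
  assume nz: "b i \<noteq> 0"
  have sums: "(\<lambda>i. b i * z ^ i) sums 0" if "cmod z < 1" for z
    using assms[OF that] by (rule has_sum_imp_sums)
  \<comment> \<open>The constant coefficient is treated separately because the isolation of zeros
    invoked below starts from a nonzero coefficient of positive index.\<close>
  have "i \<noteq> 0"
  proof
    assume "i = 0"
    have "(\<lambda>i. b i * 0 ^ i) sums b 0" by (rule powser_sums_zero)
    then have "b 0 = 0" using sums[of 0] sums_unique2 by fastforce
    with nz \<open>i = 0\<close> show False by simp
  qed
  show False
  proof (rule powser_0_nonzero[of 1 0 b "\<lambda>_. 0" i])
    fix s :: real
    assume s: "0 < s" "\<And>z::complex. z \<in> cball 0 s - {0} \<Longrightarrow> (0 :: complex) \<noteq> 0"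
    have "complex_of_real s \<in> cball 0 s - {0}" using s(1) by simp
    then show False using s(2) by blast
  qed (use sums nz \<open>i \<noteq> 0\<close> in auto)
qed

text \<open>The identity theorem in one variable at a time: for fixed \<open>w\<close> the
  coefficients of the powers of \<open>z\<close> vanish, and these are themselves power series in
  \<open>w\<close>.\<close>

lemma inj_hfun: "inj hfun"
proof (rule injI)
  fix x y :: "(nat \<times> nat) ell2" assume "hfun x = hfun y"
  then have zero: "hfun (x - y) = (\<lambda>_. 0)" by (simp add: hfun_diff)
  define a where "a = coord (x - y)"
  have hs: "((\<lambda>(i, j). a (i, j) * z ^ i * w ^ j) has_sum 0) (UNIV \<times> UNIV)" if "cmod z < 1" "cmod w < 1" for z w
    using hfun_has_sum[OF that, of "x - y"] zero by (simp add: a_def)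
  have row: "((\<lambda>j. a (i, j) * w ^ j) has_sum (\<Sum>\<^sub>\<infinity>j. a (i, j) * w ^ j)) UNIV" if "cmod w < 1" for i w
  proof -
    \<comment> \<open>Any nonzero point of the disc would do: convergence of the double sum there
      gives convergence of each row once the factor \<open>(1/2) ^ i\<close> is divided out.\<close>
    have half: "cmod (1 / 2) < 1" by simp
    have "(\<lambda>j. a (i, j) * (1/2) ^ i * w ^ j) summable_on UNIV"
      using summable_on_SigmaD1[of "\<lambda>i j. a (i, j) * (1/2) ^ i * w ^ j" UNIV "\<lambda>_. UNIV" i]
        has_sum_imp_summable[OF hs[OF half that]] by simp
    then have "(\<lambda>j. 2 ^ i * (a (i, j) * (1/2) ^ i * w ^ j)) summable_on UNIV"
      by (rule summable_on_cmult_right)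
    then have "(\<lambda>j. a (i, j) * w ^ j) summable_on UNIV"
      by (simp add: power_one_over field_simps)
    then show ?thesis by (rule has_sum_infsum)
  qed
  have inner: "(\<Sum>\<^sub>\<infinity>j. a (i, j) * w ^ j) = 0" if w: "cmod w < 1" for i w
  proof (rule powser_eq_0D[where b = "\<lambda>i. \<Sum>\<^sub>\<infinity>j. a (i, j) * w ^ j"])
    fix z :: complex assume z: "cmod z < 1"
    show "((\<lambda>i. (\<Sum>\<^sub>\<infinity>j. a (i, j) * w ^ j) * z ^ i) has_sum 0) UNIV"
    proof (rule has_sum_SigmaD[OF hs[OF z w]])
      fix i :: nat
      show "((\<lambda>j. case (i, j) of (i, j) \<Rightarrow> a (i, j) * z ^ i * w ^ j) has_sum (\<Sum>\<^sub>\<infinity>j. a (i, j) * w ^ j) * z ^ i) UNIV"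
        using has_sum_cmult_left[OF row[OF w, of i], of "z ^ i"] by (simp add: mult_ac)
    qed
  qed
  have "a (i, j) = 0" for i j
    by (rule powser_eq_0D[where b = "\<lambda>j. a (i, j)"]) (use row inner in fastforce)
  then have "coord x k = coord y k" for k
    by (cases k) (simp add: a_def)
  then show "x = y" by (rule ell2_eqI)
qed

lemma hardy2_eq: "hardy2 = range hfun"
proof
  show "range hfun \<subseteq> hardy2"
    by (auto simp: hardy2_def hfun_def square_summable_def summable_coord)
  show "hardy2 \<subseteq> range hfun"
  proof
    fix f assume "f \<in> hardy2"
    then obtain a where a: "square_summable a" "f = power_series2 a" by (auto simp: hardy2_def)
    then have "coord (Abs_ell2 a) = a"
      by (simp add: coord.rep_eq Abs_ell2_inverse square_summable_def)
    then show "f \<in> range hfun" using a(2) by (metis hfun_def rangeI)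
  qed
qed

lemma taylor_coeff_hfun: "taylor_coeff (hfun x) = coord x"
  unfolding taylor_coeff_def
proof (rule the_equality)
  show "square_summable (coord x) \<and> hfun x = power_series2 (coord x)"
    by (simp add: square_summable_def summable_coord hfun_def)
  fix a assume a: "square_summable a \<and> hfun x = power_series2 a"
  then have c: "coord (Abs_ell2 a) = a"
    by (simp add: coord.rep_eq Abs_ell2_inverse square_summable_def)
  with a have "hfun x = hfun (Abs_ell2 a)" by (simp add: hfun_def)
  then have "x = Abs_ell2 a" using inj_hfun by (simp add: inj_def)
  with c show "a = coord x" by simp
qed

lemma hinner_hfun: "hinner (hfun x) (hfun y) = cinner x y"
  by (simp add: hinner_def taylor_coeff_hfun cinner_def)

lemma hnorm_hfun: "hnorm (hfun x) = norm x"
  by (simp add: hnorm_def hinner_hfun norm_ell2_def inner_ell2_def)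

section \<open>Multiplication by the coordinates as index shifts\<close>

definition z_step :: "nat \<times> nat \<Rightarrow> nat \<times> nat" where "z_step = (\<lambda>(i, j). (Suc i, j))"
definition w_step :: "nat \<times> nat \<Rightarrow> nat \<times> nat" where "w_step = (\<lambda>(i, j). (i, Suc j))"

lemma inj_z_step: "inj z_step" and inj_w_step: "inj w_step"
  by (auto simp: inj_def z_step_def w_step_def)

lemma range_z_step: "k \<in> range z_step \<longleftrightarrow> fst k \<noteq> 0"
proof
  assume "fst k \<noteq> 0"
  then have "k = z_step (fst k - 1, snd k)" by (simp add: z_step_def)
  then show "k \<in> range z_step" by blast
qed (auto simp: z_step_def)

lemma range_w_step: "k \<in> range w_step \<longleftrightarrow> snd k \<noteq> 0"
proof
  assume "snd k \<noteq> 0"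
  then have "k = w_step (fst k, snd k - 1)" by (simp add: w_step_def)
  then show "k \<in> range w_step" by blast
qed (auto simp: w_step_def)

lemma hfun_push:
  assumes h: "inj h" and m: "\<And>i j z w. (case h (i, j) of (i', j') \<Rightarrow> z ^ i' * w ^ j') = c z w * (z ^ i * w ^ j :: complex)"
  shows "hfun (push h x) (z, w) = c z w * hfun x (z, w)"
proof (cases "cmod z < 1 \<and> cmod w < 1")
  case True
  let ?t = "\<lambda>x p. coord x p * (case p of (i, j) \<Rightarrow> z ^ i * w ^ j)"
  have hs: "(?t x has_sum hfun x (z, w)) UNIV" for x
    using hfun_has_sum[of z w x] True by (simp add: case_prod_unfold mult.assoc)
  have "((\<lambda>p. c z w * ?t x p) has_sum c z w * hfun x (z, w)) UNIV"
    by (intro has_sum_cmult_right hs)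
  also have "(\<lambda>p. c z w * ?t x p) = ?t (push h x) \<circ> h"
  proof
    fix p :: "nat \<times> nat"
    obtain i j where "p = (i, j)" by force
    then show "c z w * ?t x p = (?t (push h x) \<circ> h) p"
      using m[where i = i and j = j and z = z and w = w] by (simp add: coord_push[OF h])
  qed
  finally have "(?t (push h x) has_sum c z w * hfun x (z, w)) (range h)"
    using has_sum_reindex[OF h] by blast
  then have "(?t (push h x) has_sum c z w * hfun x (z, w)) UNIV"
    by (rule has_sum_cong_neutral[THEN iffD1, rotated -1]) (auto simp: coord_push_outside)
  then show ?thesis using hs has_sum_unique by blast
next
  case False then show ?thesis by (simp add: hfun_out)
qed

lemma mult_z_hfun: "mult_z (hfun x) = hfun (push z_step x)"
proof -
  have "hfun (push z_step x) (z, w) = z * hfun x (z, w)" for z w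
    by (rule hfun_push[OF inj_z_step, where c = "\<lambda>z w. z"]) (simp add: z_step_def)
  then show ?thesis by (auto simp: mult_z_def)
qed

lemma mult_w_hfun: "mult_w (hfun x) = hfun (push w_step x)"
proof -
  have "hfun (push w_step x) (z, w) = w * hfun x (z, w)" for z w
    by (rule hfun_push[OF inj_w_step, where c = "\<lambda>z w. w"]) (simp add: w_step_def)
  then show ?thesis by (auto simp: mult_w_def)
qed

text \<open>On the full Hardy space the backward shift in \<open>z\<close> commutes with
  multiplication by \<open>w\<close>, so the cross commutator only feels the projection
  terms.\<close>

lemma pull_z_push_w: "pull z_step (push w_step x) = push w_step (pull z_step x)"
proof (rule ell2_eqI)
  fix k :: "nat \<times> nat"
  obtain i j where k: "k = (i, j)" by force
  show "coord (pull z_step (push w_step x)) k = coord (push w_step (pull z_step x)) k"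
  proof (cases j)
    case 0
    then have "z_step k \<notin> range w_step" "k \<notin> range w_step" by (auto simp: range_w_step k z_step_def)
    then show ?thesis by (simp add: coord_pull inj_z_step coord_push_outside)
  next
    case (Suc j')
    then have "z_step k = w_step (z_step (i, j'))" "k = w_step (i, j')" by (auto simp: k z_step_def w_step_def)
    then show ?thesis by (metis coord_pull coord_push inj_z_step inj_w_step)
  qed
qed

subsection \<open>Operators on subspaces\<close>

lemma hproj_hfun:
  assumes "y \<in> Q" "\<And>h. h \<in> Q \<Longrightarrow> cinner (x - y) h = 0" "subspace Q"
  shows "hproj (hfun ` Q) (hfun x) = hfun y"
  unfolding hproj_def
proof (rule the_equality)
  show "hfun y \<in> hfun ` Q \<and> (\<forall>h\<in>hfun ` Q. hinner (\<lambda>v. hfun x v - hfun y v) h = 0)"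
    using assms by (auto simp: hinner_hfun simp flip: hfun_diff)
  fix g assume g: "g \<in> hfun ` Q \<and> (\<forall>h\<in>hfun ` Q. hinner (\<lambda>v. hfun x v - g v) h = 0)"
  then obtain u where u: "g = hfun u" "u \<in> Q" by blast
  have "u - y \<in> Q" using u assms by (simp add: subspace_diff)
  moreover have "\<And>h. h \<in> Q \<Longrightarrow> cinner (x - u) h = 0"
    using g by (auto simp: u hinner_hfun simp flip: hfun_diff)
  ultimately have "cinner (x - y) (u - y) - cinner (x - u) (u - y) = 0" using assms by simp
  then have "cinner (u - y) (u - y) = 0" by (simp flip: cinner_diff_left)
  then show "g = hfun y" by (simp add: cinner_self_norm u)
qed

lemma hadjoint_hfun:
  assumes "y \<in> Q" "\<And>f. f \<in> Q \<Longrightarrow> hinner (T (hfun f)) (hfun x) = cinner f y" "subspace Q"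
  shows "hadjoint (hfun ` Q) T (hfun x) = hfun y"
  unfolding hadjoint_def
proof (rule the_equality)
  show "hfun y \<in> hfun ` Q \<and> (\<forall>f\<in>hfun ` Q. hinner (T f) (hfun x) = hinner f (hfun y))"
    using assms by (auto simp: hinner_hfun)
  fix g assume g: "g \<in> hfun ` Q \<and> (\<forall>f\<in>hfun ` Q. hinner (T f) (hfun x) = hinner f g)"
  then obtain u where u: "g = hfun u" "u \<in> Q" by blast
  have d: "u - y \<in> Q" using u assms by (simp add: subspace_diff)
  have "cinner (u - y) u = cinner (u - y) y"
    using g d assms(2)[OF d] by (auto simp: u hinner_hfun)
  then have "cinner (u - y) (u - y) = 0" by (simp add: cinner_diff_right)
  then show "g = hfun y" by (simp add: cinner_self_norm u)
qed

lemma horth_hclosure: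
  assumes "A \<subseteq> hardy2"
  shows "horth (hclosure A) = {f \<in> hardy2. \<forall>g\<in>A. hinner f g = 0}"
proof safe
  fix f assume f: "f \<in> horth (hclosure A)"
  then show "f \<in> hardy2" by (simp add: horth_def)
  fix g assume g: "g \<in> A"
  have "hnorm (\<lambda>v. g v - g v) = 0" using hnorm_hfun[of 0] by (simp add: hfun_zero)
  then have "g \<in> hclosure A" using g assms by (auto simp: hclosure_def intro!: bexI[of _ g])
  then show "hinner f g = 0" using f by (simp add: horth_def)
next
  fix f assume f: "f \<in> hardy2" "\<forall>g\<in>A. hinner f g = 0"
  then obtain x where x: "f = hfun x" by (auto simp: hardy2_eq)
  show "f \<in> horth (hclosure A)"
    unfolding horth_def
  proof safe
    show "f \<in> hardy2" by fact
    fix g assume g: "g \<in> hclosure A"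
    then obtain y where y: "g = hfun y" by (auto simp: hclosure_def hardy2_eq)
    have "cmod (cinner x y) \<le> 0"
    proof (rule field_le_epsilon)
      fix e :: real assume e: "0 < e"
      \<comment> \<open>The summand 1 keeps the denominator positive when
        \<open>x = 0\<close>.\<close>
      define d where "d = e / (norm x + 1)"
      have d: "d > 0" using e by (simp add: d_def add_nonneg_pos)
      then obtain h where h: "h \<in> A" "hnorm (\<lambda>v. g v - h v) < d"
        using g unfolding hclosure_def by blast
      then obtain u where u: "h = hfun u" using assms by (auto simp: hardy2_eq)
      have n: "norm (y - u) < d" using h(2) by (simp add: y u hnorm_hfun flip: hfun_diff)
      have "cinner x u = 0" using f(2) h(1) unfolding x u hinner_hfun[symmetric] by blast
      then have "cmod (cinner x y) = cmod (cinner x (y - u))" by (simp add: cinner_diff_right)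
      also have "\<dots> \<le> norm x * norm (y - u)" by (rule norm_cinner_le)
      also have "\<dots> \<le> (norm x + 1) * d" using n by (intro mult_mono) auto
      also have "\<dots> = e" by (simp add: d_def add_nonneg_eq_0_iff)
      finally show "cmod (cinner x y) \<le> 0 + e" by simp
    qed
    then show "hinner f g = 0" by (simp add: x y hinner_hfun)
  qed
qed

lemma orthonormal_basis_hfun_iff:
  "orthonormal_basis (hfun ` Q) (hfun ` E) \<longleftrightarrow> E \<subseteq> Q \<and>
     (\<forall>e\<in>E. \<forall>f\<in>E. cinner e f = (if e = f then 1 else 0)) \<and>
     (\<forall>x\<in>Q. (\<forall>e\<in>E. cinner x e = 0) \<longrightarrow> x = 0)"
  unfolding orthonormal_basis_def hfun_zero[symmetric]
  using inj_hfun by (simp add: inj_image_subset_iff hinner_hfun inj_eq)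

section \<open>Homogeneous vectors\<close>

text \<open>The form \<open>w^N f(z / w)\<close>: index \<open>i\<close> of \<open>f\<close> becomes
  the monomial \<open>z^i w^(N - i)\<close>, and coefficients of index above \<open>N\<close> are
  discarded.\<close>

lift_definition hom_vec :: "nat \<Rightarrow> complex poly \<Rightarrow> (nat \<times> nat) ell2" is
  "\<lambda>N f (i, j). if i + j = N then coeff f i else 0"
proof -
  fix N :: nat and f :: "complex poly"
  have "finite ({..N} \<times> {..N})" by simp
  then have "(\<lambda>k. (cmod (case k of (i, j) \<Rightarrow> if i + j = N then coeff f i else 0))\<^sup>2) summable_on ({..N} \<times> {..N})"
    by (rule summable_on_finite)
  then show "(\<lambda>k. (cmod (case k of (i, j) \<Rightarrow> if i + j = N then coeff f i else 0))\<^sup>2) summable_on UNIV"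
    by (rule summable_on_cong_neutral[THEN iffD1, rotated -1]) (auto split: if_splits)
qed

lemma coord_hom_vec: "coord (hom_vec N f) (i, j) = (if i + j = N then coeff f i else 0)"
  by (simp add: coord.rep_eq hom_vec.rep_eq)

lemma hom_vec_add: "hom_vec N (f + g) = hom_vec N f + hom_vec N g"
  by (rule ell2_eqI) (auto simp: coord_hom_vec)

lemma hom_vec_smult: "hom_vec N (smult c f) = cscale c (hom_vec N f)"
  by (rule ell2_eqI) (auto simp: coord_hom_vec)

lemma push_z_hom_vec: "push z_step (hom_vec N f) = hom_vec (Suc N) (pCons 0 f)"
proof (rule ell2_eqI)
  fix k :: "nat \<times> nat"
  obtain i j where k: "k = (i, j)" by force
  show "coord (push z_step (hom_vec N f)) k = coord (hom_vec (Suc N) (pCons 0 f)) k"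
  proof (cases i)
    case 0
    then show ?thesis by (simp add: k coord_push_outside range_z_step coord_hom_vec)
  next
    case (Suc i')
    then have "k = z_step (i', j)" by (simp add: k z_step_def)
    then show ?thesis by (simp only: coord_push[OF inj_z_step]) (simp add: coord_hom_vec z_step_def)
  qed
qed

lemma push_w_hom_vec:
  assumes "degree f \<le> N"
  shows "push w_step (hom_vec N f) = hom_vec (Suc N) f"
proof (rule ell2_eqI)
  fix k :: "nat \<times> nat"
  obtain i j where k: "k = (i, j)" by force
  show "coord (push w_step (hom_vec N f)) k = coord (hom_vec (Suc N) f) k"
  proof (cases j)
    case 0
    then show ?thesis using assms by (simp add: k coord_push_outside range_w_step coord_hom_vec coeff_eq_0)
  next
    case (Suc j')
    then have "k = w_step (i, j')" by (simp add: k w_step_def)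
    then show ?thesis by (simp only: coord_push[OF inj_w_step]) (simp add: coord_hom_vec w_step_def)
  qed
qed

lemma cinner_eq_0_disjoint:
  assumes "\<And>k. coord x k = 0 \<or> coord y k = 0"
  shows "cinner x y = 0"
  unfolding cinner_def by (rule infsum_0) (use assms in auto)

lemma cinner_hom_vec:
  assumes "degree f \<le> N" "degree g \<le> N"
  shows "cinner (hom_vec N f) (hom_vec N g) = (\<Sum>i\<le>N. coeff f i * cnj (coeff g i))"
proof -
  let ?h = "\<lambda>i. (i, N - i)"
  have inj: "inj_on ?h {..N}" by (auto simp: inj_on_def)
  have "cinner (hom_vec N f) (hom_vec N g)
      = (\<Sum>\<^sub>\<infinity>k\<in>?h ` {..N}. coord (hom_vec N f) k * cnj (coord (hom_vec N g) k))"
    unfolding cinner_def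
  proof (rule infsum_cong_neutral)
    fix k assume k: "k \<in> UNIV - ?h ` {..N}"
    obtain i j where ij: "k = (i, j)" by force
    have "i + j \<noteq> N" using k ij by force
    then show "coord (hom_vec N f) k * cnj (coord (hom_vec N g) k) = 0" by (simp add: ij coord_hom_vec)
  qed auto
  also have "\<dots> = (\<Sum>i\<le>N. coord (hom_vec N f) (?h i) * cnj (coord (hom_vec N g) (?h i)))"
    by (simp add: sum.reindex[OF inj])
  also have "\<dots> = (\<Sum>i\<le>N. coeff f i * cnj (coeff g i))"
    by (intro sum.cong) (auto simp: coord_hom_vec)
  finally show ?thesis .
qed

section \<open>Polynomials in two variables as vectors\<close>

lemma inner_degree_bound:
  fixes r :: "'a::zero poly poly"
  obtains A where "\<And>i j. i > A \<Longrightarrow> coeff (coeff r j) i = 0"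
proof (rule that)
  fix i j assume i: "i > (\<Sum>j\<le>degree r. degree (coeff r j))"
  show "coeff (coeff r j) i = 0"
  proof (cases "j > degree r")
    case False
    then have "degree (coeff r j) \<le> (\<Sum>j\<le>degree r. degree (coeff r j))" by (intro member_le_sum) auto
    then show ?thesis using i by (intro coeff_eq_0) auto
  qed (simp add: coeff_eq_0)
qed

lift_definition poly_vec :: "complex poly poly \<Rightarrow> (nat \<times> nat) ell2" is
  "\<lambda>r (i, j). coeff (coeff r j) i"
proof -
  fix r :: "complex poly poly"
  obtain A where A: "\<And>i j. i > A \<Longrightarrow> coeff (coeff r j) i = 0" using inner_degree_bound by blast
  have A': "i \<le> A \<and> j \<le> degree r" if "coeff (coeff r j) i \<noteq> 0" for i j
  proof (rule conjI; rule ccontr)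
    assume "\<not> i \<le> A" then show False using A[of i j] that by simp
  next
    assume "\<not> j \<le> degree r" then show False using that by (simp add: coeff_eq_0)
  qed
  have "finite ({..A} \<times> {..degree r})" by simp
  then have "(\<lambda>k. (cmod (case k of (i, j) \<Rightarrow> coeff (coeff r j) i))\<^sup>2) summable_on ({..A} \<times> {..degree r})"
    by (rule summable_on_finite)
  then show "(\<lambda>k. (cmod (case k of (i, j) \<Rightarrow> coeff (coeff r j) i))\<^sup>2) summable_on UNIV"
    by (rule summable_on_cong_neutral[THEN iffD1, rotated -1]) (auto dest: A')
qed

lemma coord_poly_vec: "coord (poly_vec r) (i, j) = coeff (coeff r j) i"
  by (simp add: coord.rep_eq poly_vec.rep_eq)

lemma poly_vec_sum: "poly_vec (sum r A) = (\<Sum>i\<in>A. poly_vec (r i))"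
proof (induction A rule: infinite_finite_induct)
  case (insert i A)
  have "poly_vec (r i + sum r A) = poly_vec (r i) + poly_vec (sum r A)"
    by (rule ell2_eqI) (auto simp: coord_poly_vec)
  with insert show ?case by simp
qed (auto intro!: ell2_eqI simp: coord_poly_vec)

lemma poly_fun_eq_hfun: "poly_fun r = hfun (poly_vec r)"
proof
  fix v :: "complex \<times> complex"
  obtain z w where v: "v = (z, w)" by force
  show "poly_fun r v = hfun (poly_vec r) v"
  proof (cases "cmod z < 1 \<and> cmod w < 1")
    case True
    obtain A where A: "\<And>i j. i > A \<Longrightarrow> coeff (coeff r j) i = 0" using inner_degree_bound by blast
    let ?S = "{..A} \<times> {..degree r}"
    have "((\<lambda>(i, j). coord (poly_vec r) (i, j) * z ^ i * w ^ j) has_sum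
        (\<Sum>(i, j)\<in>?S. coord (poly_vec r) (i, j) * z ^ i * w ^ j)) ?S"
      by (rule has_sum_finite) simp
    then have "((\<lambda>(i, j). coord (poly_vec r) (i, j) * z ^ i * w ^ j) has_sum
        (\<Sum>(i, j)\<in>?S. coord (poly_vec r) (i, j) * z ^ i * w ^ j)) UNIV"
    proof (rule has_sum_cong_neutral[THEN iffD1, rotated -1])
      fix k assume k: "k \<in> UNIV - ?S"
      obtain i j where ij: "k = (i, j)" by force
      with k have "i > A \<or> j > degree r" by auto
      then have "coeff (coeff r j) i = 0" using A by (auto simp: coeff_eq_0)
      then show "(case k of (i, j) \<Rightarrow> coord (poly_vec r) (i, j) * z ^ i * w ^ j) = 0"
        by (simp add: ij coord_poly_vec)
    qed auto
    then have "hfun (poly_vec r) (z, w) = (\<Sum>(i, j)\<in>?S. coord (poly_vec r) (i, j) * z ^ i * w ^ j)"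
      using True by (intro hfun_eqI) auto
    also have "\<dots> = (\<Sum>j\<le>degree r. (\<Sum>i\<le>A. coeff (coeff r j) i * z ^ i) * w ^ j)"
      unfolding sum.cartesian_product[symmetric]
      by (subst sum.swap) (simp add: coord_poly_vec sum_distrib_right)
    also have "\<dots> = (\<Sum>j\<le>degree r. poly (coeff r j) z * w ^ j)"
    proof (intro sum.cong refl)
      fix j
      have "degree (coeff r j) \<le> A" by (rule degree_le) (use A in auto)
      then show "(\<Sum>i\<le>A. coeff (coeff r j) i * z ^ i) * w ^ j = poly (coeff r j) z * w ^ j"
        by (simp add: poly_eq_sum_le)
    qed
    also have "\<dots> = eval2 r z w"
      unfolding eval2_def poly_altdef[of r] by (simp add: poly_sum)
    finally show ?thesis using True by (simp add: v poly_fun_def bidisc_def)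
  next
    case False
    then show ?thesis by (auto simp: v hfun_out poly_fun_def bidisc_def)
  qed
qed

definition homogenize :: "nat \<Rightarrow> complex poly \<Rightarrow> complex poly poly" where
  "homogenize N f = (\<Sum>i\<le>N. monom (monom (coeff f i) i) (N - i))"

lemma coeff_homogenize: "coeff (coeff (homogenize N f) j) i = (if i + j = N then coeff f i else 0)"
proof -
  have "coeff (coeff (homogenize N f) j) i
      = (\<Sum>l\<le>N. if l = i then (if i + j = N then coeff f i else 0) else 0)"
    unfolding homogenize_def coeff_sum
    by (intro sum.cong refl) (auto simp: coeff_monom)
  also have "\<dots> = (if i + j = N then coeff f i else 0)"
    by (subst sum.delta) auto
  finally show ?thesis .
qed

lemma poly_vec_homogenize: "poly_vec (homogenize N f) = hom_vec N f"
  by (rule ell2_eqI) (auto simp: coord_poly_vec coord_hom_vec coeff_homogenize)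

lemma coeff_mult_double:
  fixes r s :: "'a::comm_semiring_0 poly poly"
  shows "coeff (coeff (r * s) j) i = (\<Sum>l\<le>i. \<Sum>k\<le>j. coeff (coeff r k) l * coeff (coeff s (j - k)) (i - l))"
  by (simp add: coeff_mult coeff_sum sum.swap[of _ "{..i}"])

lemma homogenize_mult:
  assumes f: "degree f \<le> M" and g: "degree g \<le> N"
  shows "homogenize M f * homogenize N g = homogenize (M + N) (f * g)"
proof (intro poly_eqI)
  fix j i
  have "coeff (coeff (homogenize M f * homogenize N g) j) i
      = (\<Sum>l\<le>i. if i + j = M + N then coeff f l * coeff g (i - l) else 0)"
    unfolding coeff_mult_double
  proof (intro sum.cong refl)
    fix l assume l: "l \<in> {..i}"
    let ?t = "\<lambda>k. coeff (coeff (homogenize M f) k) l * coeff (coeff (homogenize N g) (j - k)) (i - l)"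
    show "(\<Sum>k\<le>j. ?t k) = (if i + j = M + N then coeff f l * coeff g (i - l) else 0)"
    proof (cases "i + j = M + N \<and> l \<le> M \<and> M - l \<le> j")
      case True
      have "(\<Sum>k\<le>j. ?t k) = (\<Sum>k\<le>j. if k = M - l then coeff f l * coeff g (i - l) else 0)"
        by (intro sum.cong refl) (use True l in \<open>auto simp: coeff_homogenize\<close>)
      then show ?thesis using True by simp
    next
      case False
      have "(\<Sum>k\<le>j. ?t k) = 0"
        by (intro sum.neutral ballI) (use False l in \<open>auto simp: coeff_homogenize\<close>)
      moreover have "coeff f l * coeff g (i - l) = 0" if "i + j = M + N"
      proof (cases "l \<le> M")
        case True
        with that False have "i - l > N" by auto
        then show ?thesis using g by (simp add: coeff_eq_0)
      next
        case False
        then show ?thesis using f by (simp add: coeff_eq_0)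
      qed
      ultimately show ?thesis by simp
    qed
  qed
  also have "\<dots> = coeff (coeff (homogenize (M + N) (f * g)) j) i"
    by (simp add: coeff_homogenize coeff_mult)
  finally show "coeff (coeff (homogenize M f * homogenize N g) j) i
    = coeff (coeff (homogenize (M + N) (f * g)) j) i" .
qed

lemma homogeneous_decomposition:
  obtains M f where "r = (\<Sum>m\<le>M. homogenize m (f m))" "\<And>m. degree (f m) \<le> m"
proof -
  obtain A where A: "\<And>i j. i > A \<Longrightarrow> coeff (coeff r j) i = 0" using inner_degree_bound by blast
  define f where "f m = (\<Sum>i\<le>m. monom (coeff (coeff r (m - i)) i) i)" for m
  have cf: "coeff (f m) i = (if i \<le> m then coeff (coeff r (m - i)) i else 0)" for m i
    by (simp add: f_def coeff_sum sum.delta)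
  have "degree (f m) \<le> m" for m by (rule degree_le) (simp add: cf)
  moreover have "r = (\<Sum>m\<le>A + degree r. homogenize m (f m))"
  proof (intro poly_eqI)
    fix j i
    have "coeff (coeff (\<Sum>m\<le>A + degree r. homogenize m (f m)) j) i
        = (\<Sum>m\<le>A + degree r. if m = i + j then coeff (f (i + j)) i else 0)"
      by (auto simp: coeff_sum coeff_homogenize intro!: sum.cong)
    also have "\<dots> = (if i + j \<le> A + degree r then coeff (coeff r j) i else 0)"
      by (simp add: cf)
    also have "\<dots> = coeff (coeff r j) i"
    proof (cases "i + j \<le> A + degree r")
      case False
      then have "i > A \<or> j > degree r" by linarith
      then show ?thesis using A by (auto simp: coeff_eq_0)
    qed simp
    finally show "coeff (coeff r j) i = coeff (coeff (\<Sum>m\<le>A + degree r. homogenize m (f m)) j) i" by simp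
  qed
  ultimately show ?thesis by (rule that[rotated])
qed

lemma coeff_poly_outer_1:
  fixes p :: "'a::comm_semiring_1 poly poly"
  shows "coeff (poly p 1) i = (\<Sum>j\<le>degree p. coeff (coeff p j) i)"
  by (simp add: poly_altdef coeff_sum)

lemma homogeneous2_eq_homogenize:
  assumes "homogeneous2 D p"
  shows "p = homogenize D (poly p 1)" and "degree (poly p 1) \<le> D"
proof -
  have z: "coeff (coeff p j) i = 0" if "i + j \<noteq> D" for i j
    using assms that unfolding homogeneous2_def by blast
  have c: "coeff (poly p 1) i = (if i \<le> D then coeff (coeff p (D - i)) i else 0)" for i
  proof -
    \<comment> \<open>Setting \<open>w = 1\<close> merges all powers of \<open>w\<close>, but
      homogeneity leaves only \<open>D - i\<close>. The guard is needed because this difference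
      truncates to 0 for \<open>i > D\<close>.\<close>
    have "coeff (poly p 1) i = (\<Sum>j\<le>degree p. if j = D - i then (if i \<le> D then coeff (coeff p (D - i)) i else 0) else 0)"
      unfolding coeff_poly_outer_1 by (intro sum.cong refl) (auto intro: z)
    also have "\<dots> = (if D - i \<le> degree p then (if i \<le> D then coeff (coeff p (D - i)) i else 0) else 0)"
      by simp
    also have "\<dots> = (if i \<le> D then coeff (coeff p (D - i)) i else 0)"
      by (auto simp: coeff_eq_0 not_le)
    finally show ?thesis .
  qed
  show "degree (poly p 1) \<le> D" by (rule degree_le) (simp add: c)
  show "p = homogenize D (poly p 1)"
    by (intro poly_eqI) (auto simp: coeff_homogenize c z)
qed

text \<open>The quotient module on the sequence side. Every multiple of a homogeneous
  \<open>p\<close> splits into homogeneous pieces, and in degree \<open>D + m\<close> such a piece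
  dehomogenizes to \<open>q * f\<close> with \<open>degree f \<le> m\<close>, so orthogonality is
  tested degree by degree.\<close>

definition qspace :: "nat \<Rightarrow> complex poly \<Rightarrow> (nat \<times> nat) ell2 set" where
  "qspace D q = {x. \<forall>m f. degree f \<le> m \<longrightarrow> cinner x (hom_vec (D + m) (q * f)) = 0}"

lemma quotient_module_eq:
  assumes "homogeneous2 D p" "q = poly p 1"
  shows "quotient_module p = hfun ` qspace D q"
proof -
  have p: "p = homogenize D q" and q: "degree q \<le> D"
    using homogeneous2_eq_homogenize[OF assms(1)] assms(2) by auto
  have sub: "range (\<lambda>r. poly_fun (p * r)) \<subseteq> hardy2"
    by (auto simp: poly_fun_eq_hfun hardy2_eq)
  have hv: "poly_vec (p * homogenize m f) = hom_vec (D + m) (q * f)" if "degree f \<le> m" for m f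
    unfolding p homogenize_mult[OF q that] by (rule poly_vec_homogenize)
  have iff: "(\<forall>r. cinner x (poly_vec (p * r)) = 0) \<longleftrightarrow> x \<in> qspace D q" for x
  proof
    assume x: "\<forall>r. cinner x (poly_vec (p * r)) = 0"
    show "x \<in> qspace D q"
      unfolding qspace_def mem_Collect_eq
    proof (intro allI impI)
      fix m and f :: "complex poly" assume f: "degree f \<le> m"
      show "cinner x (hom_vec (D + m) (q * f)) = 0"
        unfolding hv[OF f, symmetric] using x by blast
    qed
  next
    assume x: "x \<in> qspace D q"
    show "\<forall>r. cinner x (poly_vec (p * r)) = 0"
    proof
      fix r
      obtain M f where r: "r = (\<Sum>m\<le>M. homogenize m (f m))" and f: "\<And>m. degree (f m) \<le> m"
        using homogeneous_decomposition by blast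
      have "cinner x (poly_vec (p * r)) = (\<Sum>m\<le>M. cinner x (hom_vec (D + m) (q * f m)))"
        unfolding r sum_distrib_left poly_vec_sum cinner_sum_right by (simp add: hv f)
      also have "\<dots> = 0" using x f by (simp add: qspace_def)
      finally show "cinner x (poly_vec (p * r)) = 0" .
    qed
  qed
  have "quotient_module p = {f \<in> hardy2. \<forall>g\<in>range (\<lambda>r. poly_fun (p * r)). hinner f g = 0}"
    unfolding quotient_module_def submodule_gen_def by (rule horth_hclosure[OF sub])
  also have "\<dots> = hfun ` {x. \<forall>r. cinner x (poly_vec (p * r)) = 0}"
    by (auto simp: hardy2_eq poly_fun_eq_hfun hinner_hfun)
  finally show ?thesis by (simp add: iff)
qed

lemma subspace_qspace: "subspace (qspace D q)"
  by (auto simp: subspace_def qspace_def cinner_add_left scaleR_ell2_def)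

lemma cscale_qspace: "x \<in> qspace D q \<Longrightarrow> cscale c x \<in> qspace D q"
  by (simp add: qspace_def)

lemma closed_qspace: "closed (qspace D q)"
proof -
  have "qspace D q = (\<Inter>(m, f)\<in>{(m, f). degree f \<le> m}. {x. cinner x (hom_vec (D + m) (q * f)) = 0})"
    by (auto simp: qspace_def)
  moreover have "closed {x. cinner x y = 0}" for y :: "(nat \<times> nat) ell2"
    by (intro closed_Collect_eq continuous_on_const linear_continuous_on bounded_linear_cinner_left)
  ultimately show ?thesis by auto
qed

section \<open>The cross commutator\<close>

lemma bessel_ell2:
  fixes \<Omega> :: "nat \<Rightarrow> 'a ell2"
  assumes on: "\<And>m n. cinner (\<Omega> m) (\<Omega> n) = (if m = n then 1 else 0)"
  shows "summable (\<lambda>m. (cmod (cinner v (\<Omega> m)))\<^sup>2)"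
    and "(\<Sum>m. (cmod (cinner v (\<Omega> m)))\<^sup>2) \<le> (norm v)\<^sup>2"
    and "summable (\<lambda>m. cscale (cinner v (\<Omega> m)) (\<Omega> m))"
proof -
  let ?c = "\<lambda>m. cinner v (\<Omega> m)"
  have bessel: "(\<Sum>m<n. (cmod (?c m))\<^sup>2) \<le> (norm v)\<^sup>2" for n
  proof -
    let ?s = "\<Sum>m<n. cscale (?c m) (\<Omega> m)"
    let ?B = "complex_of_real (\<Sum>m<n. (cmod (?c m))\<^sup>2)"
    have B: "?B = (\<Sum>m<n. ?c m * cnj (?c m))"
      by (simp only: of_real_sum complex_norm_square)
    have vs: "cinner v ?s = ?B"
      unfolding B cinner_sum_right by (simp add: mult.commute)
    have sv: "cinner ?s v = ?B"
      by (subst cinner_commute) (simp add: vs del: of_real_sum)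
    have sO: "cinner ?s (\<Omega> k) = ?c k" if "k < n" for k
      using that by (simp add: cinner_sum_left on if_distrib cong: if_cong)
    have ss: "cinner ?s ?s = ?B"
      unfolding B cinner_sum_right[of ?s] by (intro sum.cong refl) (simp add: sO mult.commute)
    have "complex_of_real ((norm (v - ?s))\<^sup>2) = complex_of_real ((norm v)\<^sup>2 - (\<Sum>m<n. (cmod (?c m))\<^sup>2))"
      unfolding cinner_self_norm[symmetric] cinner_diff_left cinner_diff_right vs sv ss of_real_diff by simp
    then have "(norm (v - ?s))\<^sup>2 = (norm v)\<^sup>2 - (\<Sum>m<n. (cmod (?c m))\<^sup>2)"
      by (simp only: of_real_eq_iff)
    then show ?thesis using zero_le_power2[of "norm (v - ?s)"] by linarith
  qed
  show summ: "summable (\<lambda>m. (cmod (?c m))\<^sup>2)"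
    by (rule summableI_nonneg_bounded[OF _ bessel]) simp
  then show "(\<Sum>m. (cmod (?c m))\<^sup>2) \<le> (norm v)\<^sup>2"
    by (rule suminf_le_const[OF _ bessel])
  have norm1: "norm (\<Omega> m) = 1" for m
  proof -
    have "complex_of_real ((norm (\<Omega> m))\<^sup>2) = 1" using on[of m m] by (simp only: cinner_self_norm) simp
    then have "(norm (\<Omega> m))\<^sup>2 = 1" by (metis of_real_eq_1_iff)
    then show ?thesis by (simp add: power2_eq_1_iff) (metis norm_ge_zero not_one_le_zero neg_0_le_iff_le order_trans zero_le_one)
  qed
  show "summable (\<lambda>m. cscale (?c m) (\<Omega> m))"
    by (rule summable_orthogonal(1)) (use summ in \<open>auto simp: inner_ell2_def on norm1\<close>)
qed

lemma cinner_suminf_left: "summable f \<Longrightarrow> cinner (suminf f) y = (\<Sum>m. cinner (f m) y)"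
  by (rule bounded_linear.suminf[OF bounded_linear_cinner_left])

lemma cinner_suminf_cscale:
  assumes "summable (\<lambda>m. cscale (c m) (\<Omega> m))" and "\<And>m. m \<noteq> k \<Longrightarrow> cinner (\<Omega> m) y = 0"
  shows "cinner (\<Sum>m. cscale (c m) (\<Omega> m)) y = c k * cinner (\<Omega> k) y"
proof -
  have "(\<lambda>m. cinner (cscale (c m) (\<Omega> m)) y) sums (\<Sum>m\<in>{k}. cinner (cscale (c m) (\<Omega> m)) y)"
    by (rule sums_finite) (use assms(2) in auto)
  then show ?thesis
    unfolding cinner_suminf_left[OF assms(1)] by (simp add: sums_iff)
qed

section \<open>The isometric copy of the submodule and its projections\<close>

locale homogeneous_quotient =
  fixes D :: nat and q :: "complex poly"
  assumes q_nonzero: "q \<noteq> 0" and degree_q: "degree q \<le> D"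

sublocale homogeneous_quotient \<subseteq> circle_probability "circle_measure q"
  by (rule circle_probability_circle_measure[OF q_nonzero])

context homogeneous_quotient
begin

abbreviation "L \<equiv> L2_norm_circle q"
abbreviation "Q \<equiv> qspace D q"

text \<open>Division by \<open>L\<close> matches the normalization of the circle measure, so
  \<open>cinner\<close> becomes \<open>ip\<close>; \<open>f\<close> is meant to have degree at most
  \<open>m\<close>.\<close>

definition emb :: "nat \<Rightarrow> complex poly \<Rightarrow> (nat \<times> nat) ell2" where
  "emb m f = cscale (1 / complex_of_real L) (hom_vec (D + m) (q * f))"

lemma L_pos: "L > 0"
  by (rule L2_norm_circle_pos[OF q_nonzero])

lemma degree_q_mult: "degree f \<le> m \<Longrightarrow> degree (q * f) \<le> D + m"
  using degree_mult_le[of q f] degree_q by linarith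

lemma coord_emb: "coord (emb m f) (i, j) = (if i + j = D + m then coeff (q * f) i / complex_of_real L else 0)"
  by (simp add: emb_def coord_hom_vec)

lemma emb_add: "emb m (f + g) = emb m f + emb m g"
  by (simp add: emb_def distrib_left hom_vec_add cscale_add)

lemma emb_smult: "emb m (smult c f) = cscale c (emb m f)"
  by (rule ell2_eqI) (simp add: emb_def hom_vec_smult)

lemma emb_zero: "emb m 0 = 0"
  using emb_smult[of m 0 0] by (intro ell2_eqI) (metis coord_cscale coord_zero mult_zero_left smult_0_left)

lemma cinner_emb:
  assumes "degree f \<le> m" "degree g \<le> m"
  shows "cinner (emb m f) (emb m g) = ip f g"
proof -
  have "cinner (emb m f) (emb m g)
      = (\<Sum>i\<le>D + m. coeff (q * f) i * cnj (coeff (q * g) i)) / complex_of_real (L\<^sup>2)"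
    unfolding emb_def cinner_cscale_left cinner_cscale_right
      cinner_hom_vec[OF degree_q_mult[OF assms(1)] degree_q_mult[OF assms(2)]]
    by (simp add: power2_eq_square)
  then show ?thesis
    unfolding ip_def integral_circle_measure
      integral_haar_circle_poly[OF degree_q_mult[OF assms(1)] degree_q_mult[OF assms(2)]] .
qed

lemma cinner_emb_neq: "m \<noteq> n \<Longrightarrow> cinner (emb m f) (emb n g) = 0"
  by (rule cinner_eq_0_disjoint) (auto simp: coord_emb split: prod.splits)

lemma push_z_emb: "push z_step (emb m f) = emb (Suc m) (pCons 0 f)"
proof -
  have "push z_step (cscale c x) = cscale c (push z_step x)" for c x
  proof (rule ell2_eqI)
    fix k show "coord (push z_step (cscale c x)) k = coord (cscale c (push z_step x)) k"
      by (cases "k \<in> range z_step") (auto simp: coord_push[OF inj_z_step] coord_push_outside)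
  qed
  then show ?thesis by (simp add: emb_def push_z_hom_vec)
qed

lemma push_w_emb:
  assumes "degree f \<le> m"
  shows "push w_step (emb m f) = emb (Suc m) f"
proof -
  have "push w_step (cscale c x) = cscale c (push w_step x)" for c x
  proof (rule ell2_eqI)
    fix k show "coord (push w_step (cscale c x)) k = coord (cscale c (push w_step x)) k"
      by (cases "k \<in> range w_step") (auto simp: coord_push[OF inj_w_step] coord_push_outside)
  qed
  then show ?thesis by (simp add: emb_def push_w_hom_vec[OF degree_q_mult[OF assms]])
qed

lemma mem_Q_iff: "x \<in> Q \<longleftrightarrow> (\<forall>m f. degree f \<le> m \<longrightarrow> cinner x (emb m f) = 0)"
  using L_pos by (simp add: qspace_def emb_def)

lemma cinner_Q: "x \<in> Q \<Longrightarrow> degree f \<le> m \<Longrightarrow> cinner x (emb m f) = 0"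
  by (simp add: mem_Q_iff)

lemma pull_z_step_Q:
  assumes "x \<in> Q"
  shows "pull z_step x \<in> Q"
  unfolding mem_Q_iff cinner_pull[OF inj_z_step] push_z_emb
  using assms by (auto simp: mem_Q_iff intro: order_trans[OF degree_pCons_le])

text \<open>The \<open>m\<close>-th vector \<open>emb m (\<omega> m)\<close> spans the part of the submodule in degree \<open>D + m\<close> that is
  orthogonal to \<open>w\<close> (for \<open>\<omega> = opoly\<close>) or \<open>z\<close> (for \<open>\<omega> = opoly_star\<close>) times the part in degree \<open>D + m - 1\<close>;
  a shifted element of the quotient module therefore meets the submodule only in these directions.\<close>

lemma projection:
  assumes deg: "\<And>m. degree (\<omega> m) \<le> m" and unit: "\<And>m. ip (\<omega> m) (\<omega> m) = 1"
    and dec: "\<And>m f. degree f \<le> m \<Longrightarrow> \<exists>c g. f = smult c (\<omega> m) + g \<and> degree g \<le> m \<and> ip (\<omega> m) g = 0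
      \<and> cinner v (emb m g) = 0"
  defines "s \<equiv> \<Sum>m. cscale (cinner v (emb m (\<omega> m))) (emb m (\<omega> m))"
  shows "hproj (hfun ` Q) (hfun v) = hfun (v - s)" and "v - s \<in> Q" and "\<And>h. h \<in> Q \<Longrightarrow> cinner s h = 0"
proof -
  have on: "cinner (emb m (\<omega> m)) (emb n (\<omega> n)) = (if m = n then 1 else 0)" for m n
    by (cases "m = n") (simp_all add: cinner_emb deg unit cinner_emb_neq)
  note summ = bessel_ell2(3)[OF on, of v]
  show orth: "cinner s h = 0" if "h \<in> Q" for h
  proof -
    have "cinner (emb m (\<omega> m)) h = 0" for m
      using cinner_Q[OF that deg[of m]] by (metis cinner_commute complex_cnj_zero)
    \<comment> \<open>All coefficients vanish, so the distinguished index 0 is an arbitrary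
      choice.\<close>
    then show ?thesis unfolding s_def by (subst cinner_suminf_cscale[OF summ, of 0]) auto
  qed
  show mem: "v - s \<in> Q"
    unfolding mem_Q_iff
  proof (intro allI impI)
    fix m and f :: "complex poly" assume "degree f \<le> m"
    then obtain c g where f: "f = smult c (\<omega> m) + g" and g: "degree g \<le> m" "ip (\<omega> m) g = 0" "cinner v (emb m g) = 0"
      using dec by blast
    have s: "cinner s (emb m h) = cinner v (emb m (\<omega> m)) * cinner (emb m (\<omega> m)) (emb m h)" for h
      unfolding s_def by (rule cinner_suminf_cscale[OF summ]) (rule cinner_emb_neq)
    have "cinner (v - s) (emb m (\<omega> m)) = 0" "cinner (v - s) (emb m g) = 0"
      unfolding cinner_diff_left s using g by (simp_all add: cinner_emb deg unit)
    then show "cinner (v - s) (emb m f) = 0"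
      by (simp add: f emb_add emb_smult cinner_add_right)
  qed
  show "hproj (hfun ` Q) (hfun v) = hfun (v - s)"
    by (rule hproj_hfun[OF mem _ subspace_qspace]) (simp add: orth)
qed

definition w_coeff :: "(nat \<times> nat) ell2 \<Rightarrow> nat \<Rightarrow> complex" where
  "w_coeff x m = cinner (push w_step x) (emb m (opoly m))"

definition w_part :: "(nat \<times> nat) ell2 \<Rightarrow> (nat \<times> nat) ell2" where
  "w_part x = (\<Sum>m. cscale (w_coeff x m) (emb m (opoly m)))"

text \<open>Below degree \<open>m\<close> the embedded polynomial is \<open>w\<close> times its copy
  one degree lower, and multiplication by \<open>w\<close> is isometric, so orthogonality to the
  submodule carries over.\<close>

lemma cinner_push_w_emb:
  assumes "x \<in> Q" "\<forall>k\<ge>m. coeff g k = 0"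
  shows "cinner (push w_step x) (emb m g) = 0"
proof (cases m)
  case 0
  then have "g = 0" using assms(2) by (simp add: poly_eq_iff)
  then show ?thesis by (simp add: emb_zero)
next
  case (Suc n)
  then have "degree g \<le> n" using assms(2) by (intro degree_le) auto
  then have "cinner (push w_step x) (emb m g) = cinner (push w_step x) (push w_step (emb n g))"
    using push_w_emb Suc by simp
  also have "\<dots> = 0"
    using cinner_Q[OF assms(1) \<open>degree g \<le> n\<close>] by (simp add: cinner_push[OF inj_w_step] pull_push[OF inj_w_step])
  finally show ?thesis .
qed

lemma projection_w:
  assumes x: "x \<in> Q"
  shows "hproj (hfun ` Q) (hfun (push w_step x)) = hfun (push w_step x - w_part x)" and "push w_step x - w_part x \<in> Q"
    and "\<And>h. h \<in> Q \<Longrightarrow> cinner (w_part x) h = 0"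
proof -
  have dec: "\<exists>c g. f = smult c (opoly m) + g \<and> degree g \<le> m \<and> ip (opoly m) g = 0 \<and> cinner (push w_step x) (emb m g) = 0"
    if f: "degree f \<le> m" for m f
  proof -
    \<comment> \<open>Cancels the top coefficient, so that the remainder has degree below
      \<open>m\<close> and hence lies in \<open>w\<close> times the submodule.\<close>
    define c where "c = coeff f m / complex_of_real (kappa m)"
    define g where "g = f - smult c (opoly m)"
    have g: "\<forall>k\<ge>m. coeff g k = 0"
    proof safe
      fix k assume "m \<le> k"
      then show "coeff g k = 0"
        using f kappa_pos[of m] by (cases "k = m") (auto simp: g_def c_def coeff_opoly_top coeff_eq_0 degree_opoly)
    qed
    have "f = smult c (opoly m) + g" by (simp add: g_def)
    moreover have "degree g \<le> m" by (rule degree_le) (use g in auto)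
    ultimately show ?thesis
      using ip_opoly_lower[OF g] cinner_push_w_emb[OF x g] by blast
  qed
  note pr = projection[of opoly "push w_step x", OF _ _ dec]
  show "hproj (hfun ` Q) (hfun (push w_step x)) = hfun (push w_step x - w_part x)" "push w_step x - w_part x \<in> Q"
    "\<And>h. h \<in> Q \<Longrightarrow> cinner (w_part x) h = 0"
    unfolding w_part_def w_coeff_def by (rule pr; simp add: degree_opoly ip_opoly)+
qed

text \<open>The series for \<open>s\<close> is not recorded: its orthogonality to the quotient
  module already makes the compression of \<open>z\<close> agree with plain multiplication inside
  inner products, which identifies the adjoint.\<close>

lemma projection_z:
  assumes x: "x \<in> Q"
  obtains s where "hproj (hfun ` Q) (hfun (push z_step x)) = hfun (push z_step x - s)"
    and "\<And>h. h \<in> Q \<Longrightarrow> cinner s h = 0"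
proof -
  have dec: "\<exists>c g. f = smult c (opoly_star m) + g \<and> degree g \<le> m \<and> ip (opoly_star m) g = 0 \<and> cinner (push z_step x) (emb m g) = 0"
    if f: "degree f \<le> m" for m f
  proof -
    \<comment> \<open>Here the constant term is cancelled, possible because
      \<open>opoly_star m\<close> has constant term \<open>kappa m > 0\<close>; the remainder lies
      in \<open>z\<close> times the submodule.\<close>
    define c where "c = coeff f 0 / complex_of_real (kappa m)"
    define g where "g = f - smult c (opoly_star m)"
    have dg: "degree g \<le> m"
      unfolding g_def using f degree_opoly_star[of m] by (intro degree_diff_le) (auto intro: order_trans[OF degree_smult_le])
    have "coeff g 0 = 0" using kappa_pos[of m] by (simp add: g_def c_def coeff_opoly_star_0)
    then obtain h where h: "g = pCons 0 h" by (cases g) auto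
    have h0: "\<forall>k\<ge>m. coeff h k = 0"
    proof safe
      fix k assume "m \<le> k"
      then have "coeff g (Suc k) = 0" using dg by (intro coeff_eq_0) simp
      then show "coeff h k = 0" by (simp add: h)
    qed
    have "cinner (push z_step x) (emb m g) = 0"
    proof (cases m)
      case 0
      then have "h = 0" using h0 by (simp add: poly_eq_iff)
      then show ?thesis by (simp add: h emb_zero)
    next
      case (Suc n)
      then have dh: "degree h \<le> n" using h0 by (intro degree_le) auto
      have "cinner (push z_step x) (emb m g) = cinner (push z_step x) (push z_step (emb n h))"
        by (simp add: push_z_emb h Suc)
      also have "\<dots> = 0"
        using cinner_Q[OF x dh] by (simp add: cinner_push[OF inj_z_step] pull_push[OF inj_z_step])
      finally show ?thesis .
    qed
    moreover have "ip (opoly_star m) g = 0" unfolding h by (rule ip_opoly_star_lower[OF h0])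
    moreover have "f = smult c (opoly_star m) + g" by (simp add: g_def)
    ultimately show ?thesis using dg by blast
  qed
  show ?thesis
    by (rule that; rule projection[of opoly_star "push z_step x", OF degree_opoly_star ip_opoly_star_self dec])
qed

lemma summable_w_coeff: "summable (\<lambda>m. (cmod (w_coeff x m))\<^sup>2)" "(\<Sum>m. (cmod (w_coeff x m))\<^sup>2) \<le> (norm x)\<^sup>2"
  and summable_w_part: "summable (\<lambda>m. cscale (w_coeff x m) (emb m (opoly m)))"
proof -
  have on: "cinner (emb m (opoly m)) (emb n (opoly n)) = (if m = n then 1 else 0)" for m n
    by (cases "m = n") (simp_all add: cinner_emb degree_opoly ip_opoly cinner_emb_neq)
  show "summable (\<lambda>m. (cmod (w_coeff x m))\<^sup>2)" "(\<Sum>m. (cmod (w_coeff x m))\<^sup>2) \<le> (norm x)\<^sup>2"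
    "summable (\<lambda>m. cscale (w_coeff x m) (emb m (opoly m)))"
    unfolding w_coeff_def using bessel_ell2[OF on, of "push w_step x"] by (simp_all add: norm_push inj_w_step)
qed

text \<open>The common term \<open>pull z_step (push w_step x)\<close>, equal to
  \<open>push w_step (pull z_step x)\<close>, has already been cancelled.\<close>

definition cross_comm :: "(nat \<times> nat) ell2 \<Rightarrow> (nat \<times> nat) ell2" where
  "cross_comm x = w_part (pull z_step x) - pull z_step (w_part x)"

lemma cross_comm_Q:
  assumes "x \<in> Q"
  shows "cross_comm x \<in> Q"
proof -
  have "cross_comm x = pull z_step (push w_step x - w_part x) - (push w_step (pull z_step x) - w_part (pull z_step x))"
    unfolding cross_comm_def linear_diff[OF bounded_linear.linear[OF bounded_linear_pull[OF inj_z_step]]]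
    by (simp add: pull_z_push_w)
  moreover have "pull z_step (push w_step x - w_part x) \<in> Q"
    by (intro pull_z_step_Q projection_w assms)
  moreover have "push w_step (pull z_step x) - w_part (pull z_step x) \<in> Q"
    by (intro pull_z_step_Q projection_w assms)
  ultimately show ?thesis using subspace_diff[OF subspace_qspace] by metis
qed

lemma cross_commutator_hfun:
  assumes p: "quotient_module p = hfun ` Q" and x: "x \<in> Q"
  shows "cross_commutator p (hfun x) = hfun (cross_comm x)"
proof -
  have Sw: "S_w p (hfun x) = hfun (push w_step x - w_part x)" if "x \<in> Q" for x
    unfolding S_w_def compression_def p mult_w_hfun by (rule projection_w(1)[OF that])
  have adj: "hadjoint (quotient_module p) (S_z p) (hfun y) = hfun (pull z_step y)" if y: "y \<in> Q" for y
    unfolding p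
  proof (rule hadjoint_hfun[OF pull_z_step_Q[OF y] _ subspace_qspace])
    fix f assume f: "f \<in> Q"
    obtain s where s: "hproj (hfun ` Q) (hfun (push z_step f)) = hfun (push z_step f - s)"
      and orth: "\<And>h. h \<in> Q \<Longrightarrow> cinner s h = 0" using projection_z[OF f] by blast
    show "hinner (S_z p (hfun f)) (hfun y) = cinner f (pull z_step y)"
      unfolding S_z_def compression_def p mult_z_hfun s hinner_hfun cinner_diff_left orth[OF y]
      by (simp add: cinner_push[OF inj_z_step])
  qed
  have "cross_commutator p (hfun x)
      = (\<lambda>v. hfun (pull z_step (push w_step x - w_part x)) v - hfun (push w_step (pull z_step x) - w_part (pull z_step x)) v)"
    unfolding cross_commutator_def Sw[OF x] adj[OF x] adj[OF projection_w(2)[OF x]] Sw[OF pull_z_step_Q[OF x]] ..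
  also have "\<dots> = hfun (pull z_step (push w_step x - w_part x) - (push w_step (pull z_step x) - w_part (pull z_step x)))"
    by (simp only: hfun_diff)
  also have "pull z_step (push w_step x - w_part x) - (push w_step (pull z_step x) - w_part (pull z_step x)) = cross_comm x"
    unfolding cross_comm_def linear_diff[OF bounded_linear.linear[OF bounded_linear_pull[OF inj_z_step]]]
    by (simp add: pull_z_push_w)
  finally show ?thesis .
qed

text \<open>The sequence of conjugated Verblunsky coefficients shifted by one, started with the
  convention that the coefficient of index -1 is -1.\<close>

definition out_coeff :: "nat \<Rightarrow> complex" where
  "out_coeff m = (case m of 0 \<Rightarrow> - 1 | Suc n \<Rightarrow> cnj (alpha n))"

definition out_vec :: "nat \<Rightarrow> (nat \<times> nat) ell2" where "out_vec m = pull z_step (emb m (opoly_star m))"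
definition in_vec :: "nat \<Rightarrow> (nat \<times> nat) ell2" where "in_vec m = pull w_step (emb m (opoly m))"

lemma w_coeff_eq: "w_coeff x m = cinner x (in_vec m)"
  unfolding w_coeff_def in_vec_def by (rule cinner_push[OF inj_w_step])

text \<open>Moving the backward shift to the other side produces \<open>\<zeta>\<close> times
  \<open>opoly m\<close>. Of the two terms of the Szego recursion the reversed one has degree at
  most \<open>m\<close>, hence lies in \<open>w\<close> times the submodule in degree
  \<open>D + m + 1\<close> and drops out.\<close>

lemma w_coeff_pull_z_step:
  assumes x: "x \<in> Q"
  shows "w_coeff (pull z_step x) m = complex_of_real (rho m) * w_coeff x (Suc m)"
proof -
  have "w_coeff (pull z_step x) m = cinner (push w_step x) (emb (Suc m) (pCons 0 (opoly m)))"
    unfolding w_coeff_def by (simp add: pull_z_push_w[symmetric] cinner_pull[OF inj_z_step] push_z_emb)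
  also have "pCons 0 (opoly m) = smult (complex_of_real (rho m)) (opoly (Suc m)) + smult (cnj (alpha m)) (opoly_star m)"
    by (simp only: szego) simp
  also have "cinner (push w_step x) (emb (Suc m) \<dots>) = complex_of_real (rho m) * w_coeff x (Suc m)
      + alpha m * cinner (push w_step x) (emb (Suc m) (opoly_star m))"
    by (simp add: emb_add emb_smult cinner_add_right w_coeff_def del: opoly.simps)
  also have "cinner (push w_step x) (emb (Suc m) (opoly_star m)) = 0"
    using degree_opoly_star[of m] by (intro cinner_push_w_emb[OF x]) (auto intro: coeff_eq_0)
  finally show ?thesis by simp
qed

lemma cross_comm_sums:
  assumes x: "x \<in> Q"
  shows "(\<lambda>m. cscale (w_coeff x m * out_coeff m) (out_vec m)) sums cross_comm x"
proof -
  let ?P = "\<lambda>m. emb m (opoly m)"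
  have blp: "bounded_linear (pull z_step)" by (rule bounded_linear_pull[OF inj_z_step])
  have pc: "pull z_step (cscale c y) = cscale c (pull z_step y)" for c y
    by (rule ell2_eqI) (simp add: coord_pull inj_z_step)
  have 1: "(\<lambda>m. cscale (w_coeff x m) (pull z_step (?P m))) sums pull z_step (w_part x)"
    using bounded_linear.sums[OF blp summable_sums[OF summable_w_part[of x]]] by (simp add: w_part_def pc)
  have 2: "(\<lambda>m. cscale (w_coeff (pull z_step x) m) (?P m)) sums w_part (pull z_step x)"
    using summable_sums[OF summable_w_part[of "pull z_step x"]] by (simp add: w_part_def)
  \<comment> \<open>Index shift: the backward shift of term \<open>Suc m\<close> has degree
    \<open>D + m\<close>, the same as term \<open>m\<close> of
    \<open>w_part (pull z_step x)\<close>. Term 0 remains unpaired.\<close>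
  have "(\<lambda>m. cscale (w_coeff x (Suc m)) (pull z_step (?P (Suc m)))) sums (pull z_step (w_part x) - cscale (w_coeff x 0) (pull z_step (?P 0)))"
    using sums_Suc_iff[of "\<lambda>m. cscale (w_coeff x m) (pull z_step (?P m))"] 1 by (simp del: opoly.simps)
  from sums_diff[OF 2 this]
  have 3: "(\<lambda>m. cscale (w_coeff (pull z_step x) m) (?P m) - cscale (w_coeff x (Suc m)) (pull z_step (?P (Suc m))))
      sums (cross_comm x + cscale (w_coeff x 0) (pull z_step (?P 0)))"
    by (simp add: cross_comm_def algebra_simps del: opoly.simps)
  \<comment> \<open>The backward shift of the inverse Szego recursion: after subtraction only the
    multiple of \<open>out_vec (Suc m)\<close> is left in this degree.\<close>
  have step: "cscale (w_coeff (pull z_step x) m) (?P m) - cscale (w_coeff x (Suc m)) (pull z_step (?P (Suc m)))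
      = cscale (w_coeff x (Suc m) * out_coeff (Suc m)) (out_vec (Suc m))" for m
  proof -
    have "emb (Suc m) (smult (complex_of_real (rho m)) (pCons 0 (opoly m)))
        = emb (Suc m) (opoly (Suc m) + smult (cnj (alpha m)) (opoly_star (Suc m)))"
      by (simp only: szego_inverse)
    then have "cscale (complex_of_real (rho m)) (push z_step (?P m))
        = ?P (Suc m) + cscale (cnj (alpha m)) (emb (Suc m) (opoly_star (Suc m)))"
      by (simp only: emb_smult emb_add push_z_emb)
    then have "pull z_step (cscale (complex_of_real (rho m)) (push z_step (?P m)))
        = pull z_step (?P (Suc m) + cscale (cnj (alpha m)) (emb (Suc m) (opoly_star (Suc m))))"
      by (rule arg_cong)
    then have "cscale (complex_of_real (rho m)) (?P m) = pull z_step (?P (Suc m)) + cscale (cnj (alpha m)) (out_vec (Suc m))"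
      unfolding linear_add[OF bounded_linear.linear[OF blp]] pc pull_push[OF inj_z_step] out_vec_def .
    then have K: "coord (cscale (complex_of_real (rho m)) (?P m)) k = coord (pull z_step (?P (Suc m)) + cscale (cnj (alpha m)) (out_vec (Suc m))) k" for k
      by simp
    show ?thesis
    proof (rule ell2_eqI)
      fix k
      have "w_coeff x (Suc m) * coord (cscale (complex_of_real (rho m)) (?P m)) k
          = w_coeff x (Suc m) * coord (pull z_step (?P (Suc m)) + cscale (cnj (alpha m)) (out_vec (Suc m))) k"
        unfolding K ..
      then show "coord (cscale (w_coeff (pull z_step x) m) (?P m) - cscale (w_coeff x (Suc m)) (pull z_step (?P (Suc m)))) k
          = coord (cscale (w_coeff x (Suc m) * out_coeff (Suc m)) (out_vec (Suc m))) k"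
        by (simp add: w_coeff_pull_z_step[OF x] out_coeff_def algebra_simps del: opoly.simps)
    qed
  qed
  have "(\<lambda>m. cscale (w_coeff x (Suc m) * out_coeff (Suc m)) (out_vec (Suc m))) sums (cross_comm x - cscale (w_coeff x 0 * out_coeff 0) (out_vec 0))"
  proof -
    \<comment> \<open>The constant polynomial 1 is its own reversal at length 0, which identifies
      the unpaired term with the direction \<open>out_vec 0\<close> and coefficient -1.\<close>
    have "?P 0 = emb 0 (opoly_star 0)" by (simp add: opoly_star_def rev_poly_def)
    then have "cscale (w_coeff x 0) (pull z_step (?P 0)) = - cscale (w_coeff x 0 * out_coeff 0) (out_vec 0)"
      by (intro ell2_eqI) (simp add: out_vec_def out_coeff_def)
    with 3 show ?thesis unfolding step by simp
  qed
  then show ?thesis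
    using sums_Suc_iff[of "\<lambda>m. cscale (w_coeff x m * out_coeff m) (out_vec m)" "cross_comm x - cscale (w_coeff x 0 * out_coeff 0) (out_vec 0)"]
    by simp
qed

section \<open>Orthogonality and norms of the shifted vectors\<close>

lemma coord_out_vec: "coord (out_vec m) (i, j) = coord (emb m (opoly_star m)) (Suc i, j)"
  unfolding out_vec_def coord_pull[OF inj_z_step] by (simp add: z_step_def)

lemma cinner_out_vec: "m \<noteq> n \<Longrightarrow> cinner (out_vec m) (out_vec n) = 0"
  by (rule cinner_eq_0_disjoint) (auto simp: coord_out_vec coord_emb)

lemma infsum_hom_edge:
  assumes "\<And>k. k \<in> A \<Longrightarrow> k \<noteq> k0 \<Longrightarrow> coord x k = 0" "k0 \<in> A"
  shows "(\<Sum>\<^sub>\<infinity>k\<in>A. (cmod (coord x k))\<^sup>2) = (cmod (coord x k0))\<^sup>2"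
proof -
  have "(\<Sum>\<^sub>\<infinity>k\<in>A. (cmod (coord x k))\<^sup>2) = (\<Sum>\<^sub>\<infinity>k\<in>{k0}. (cmod (coord x k))\<^sup>2)"
    by (rule infsum_cong_neutral) (use assms in auto)
  then show ?thesis by simp
qed

lemma norm_emb:
  assumes "degree f \<le> m" "ip f f = 1"
  shows "(norm (emb m f))\<^sup>2 = 1"
proof -
  have "complex_of_real ((norm (emb m f))\<^sup>2) = 1"
    unfolding cinner_self_norm[symmetric] cinner_emb[OF assms(1,1)] by (rule assms(2))
  then show ?thesis by (metis of_real_eq_1_iff)
qed

text \<open>The backward shift in \<open>z\<close> loses exactly the coefficient of the pure power
  \<open>w^(D + m)\<close>, the constant term of \<open>q * opoly_star m\<close> over
  \<open>L\<close>, and \<open>opoly_star m\<close> takes the value \<open>kappa m\<close> at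
  0.\<close>

lemma norm_out_vec: "(norm (out_vec m))\<^sup>2 = 1 - (cmod (coeff q 0))\<^sup>2 / L\<^sup>2 * (kappa m)\<^sup>2"
proof -
  have "(\<Sum>\<^sub>\<infinity>k\<in>- range z_step. (cmod (coord (emb m (opoly_star m)) k))\<^sup>2)
      = (cmod (coord (emb m (opoly_star m)) (0, D + m)))\<^sup>2"
    by (rule infsum_hom_edge) (auto simp: range_z_step coord_emb split: if_splits)
  also have "coord (emb m (opoly_star m)) (0, D + m) = coeff q 0 * complex_of_real (kappa m) / complex_of_real L"
    by (simp add: coord_emb coeff_mult coeff_opoly_star_0)
  finally show ?thesis
    unfolding out_vec_def norm_pull_sq[OF inj_z_step] norm_emb[OF degree_opoly_star ip_opoly_star_self]
    using L_pos kappa_pos[of m] by (simp add: norm_mult norm_divide power_mult_distrib power_divide)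
qed

text \<open>Both degrees are formal: if \<open>degree q < D\<close> or \<open>degree f < m\<close>,
  both sides vanish.\<close>

lemma coeff_mult_top:
  assumes "degree f \<le> m"
  shows "coeff (q * f) (D + m) = coeff q D * coeff f m"
proof -
  have "coeff (q * f) (D + m) = (\<Sum>i\<le>D + m. if i = D then coeff q D * coeff f m else 0)"
    unfolding coeff_mult
  proof (intro sum.cong refl)
    fix i
    consider "i = D" | "i < D" | "i > D" by linarith
    then show "coeff q i * coeff f (D + m - i) = (if i = D then coeff q D * coeff f m else 0)"
      using assms degree_q by cases (auto simp: coeff_eq_0)
  qed
  then show ?thesis by simp
qed

lemma norm_in_vec: "(norm (in_vec m))\<^sup>2 = 1 - (cmod (coeff q D))\<^sup>2 / L\<^sup>2 * (kappa m)\<^sup>2"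
proof -
  have deg: "degree (opoly m) \<le> m" by (simp add: degree_opoly)
  have unit: "ip (opoly m) (opoly m) = 1" by (simp add: ip_opoly)
  have "(\<Sum>\<^sub>\<infinity>k\<in>- range w_step. (cmod (coord (emb m (opoly m)) k))\<^sup>2)
      = (cmod (coord (emb m (opoly m)) (D + m, 0)))\<^sup>2"
    by (rule infsum_hom_edge) (auto simp: range_w_step coord_emb split: if_splits)
  also have "coord (emb m (opoly m)) (D + m, 0) = coeff q D * complex_of_real (kappa m) / complex_of_real L"
    by (simp add: coord_emb coeff_mult_top[OF deg] coeff_opoly_top)
  finally show ?thesis
    unfolding in_vec_def norm_pull_sq[OF inj_w_step] norm_emb[OF deg unit]
    using L_pos kappa_pos[of m] by (simp add: norm_mult norm_divide power_mult_distrib power_divide)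
qed

text \<open>Orthogonality of \<open>opoly m\<close> to lower degrees places its backward shift in
  the quotient module, so Parseval's identity in an orthonormal basis of \<open>Q\<close> applies to
  it.\<close>

lemma in_vec_Q: "in_vec m \<in> Q"
  unfolding mem_Q_iff
proof (intro allI impI)
  fix n and f :: "complex poly" assume f: "degree f \<le> n"
  have "cinner (in_vec m) (emb n f) = cinner (emb m (opoly m)) (emb (Suc n) f)"
    unfolding in_vec_def cinner_pull[OF inj_w_step] push_w_emb[OF f] ..
  also have "\<dots> = 0"
  proof (cases "m = Suc n")
    case True
    then show ?thesis
      using f by (simp add: cinner_emb degree_opoly ip_opoly_lower coeff_eq_0 del: opoly.simps)
  qed (rule cinner_emb_neq)
  finally show "cinner (in_vec m) (emb n f) = 0" .
qed

lemma norm_out_vec_le: "norm (out_vec m) \<le> 1"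
proof -
  have "(norm (emb m (opoly_star m)))\<^sup>2 = 1"
    by (rule norm_emb[OF degree_opoly_star ip_opoly_star_self])
  then have "norm (emb m (opoly_star m)) = 1"
    by (metis norm_ge_zero real_sqrt_one real_sqrt_unique)
  then show ?thesis unfolding out_vec_def using norm_pull_le[OF inj_z_step] by metis
qed

lemma norm_out_coeff_le: "cmod (out_coeff m) \<le> 1"
  using norm_alpha by (cases m) (auto simp: out_coeff_def less_imp_le)

definition weight :: "nat \<Rightarrow> real" where "weight m = (cmod (out_coeff m))\<^sup>2 * (norm (out_vec m))\<^sup>2"

lemma weight_bounds: "0 \<le> weight m" "weight m \<le> 1"
proof -
  have "(cmod (out_coeff m))\<^sup>2 \<le> 1" "(norm (out_vec m))\<^sup>2 \<le> 1"
    using norm_out_coeff_le[of m] norm_out_vec_le[of m] by (simp_all add: power_le_one)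
  then show "0 \<le> weight m" "weight m \<le> 1" unfolding weight_def by (simp_all add: mult_le_one)
qed

lemma norm_cross_comm:
  assumes x: "x \<in> Q"
  shows "summable (\<lambda>m. weight m * (cmod (w_coeff x m))\<^sup>2)"
    and "(norm (cross_comm x))\<^sup>2 = (\<Sum>m. weight m * (cmod (w_coeff x m))\<^sup>2)"
proof -
  show summ: "summable (\<lambda>m. weight m * (cmod (w_coeff x m))\<^sup>2)"
  proof (rule summable_comparison_test')
    show "norm (weight n * (cmod (w_coeff x n))\<^sup>2) \<le> (cmod (w_coeff x n))\<^sup>2" for n
      using weight_bounds[of n] by (simp add: mult_left_le_one_le)
  qed (rule summable_w_coeff(1))
  have eq: "(norm (cscale (w_coeff x m * out_coeff m) (out_vec m)))\<^sup>2 = weight m * (cmod (w_coeff x m))\<^sup>2" for m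
    by (simp add: weight_def norm_mult power_mult_distrib)
  have "(norm (\<Sum>m. cscale (w_coeff x m * out_coeff m) (out_vec m)))\<^sup>2 = (\<Sum>m. (norm (cscale (w_coeff x m * out_coeff m) (out_vec m)))\<^sup>2)"
    by (rule summable_orthogonal(2)) (use summ in \<open>simp_all add: inner_ell2_def cinner_out_vec eq del: norm_cscale\<close>)
  then show "(norm (cross_comm x))\<^sup>2 = (\<Sum>m. weight m * (cmod (w_coeff x m))\<^sup>2)"
    unfolding eq sums_unique[OF cross_comm_sums[OF x], symmetric] .
qed

lemma norm_cross_comm_le:
  assumes x: "x \<in> Q"
  shows "norm (cross_comm x) \<le> norm x"
proof (rule power2_le_imp_le)
  have "(norm (cross_comm x))\<^sup>2 \<le> (\<Sum>m. (cmod (w_coeff x m))\<^sup>2)"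
    unfolding norm_cross_comm(2)[OF x]
    by (rule suminf_le) (use weight_bounds summable_w_coeff norm_cross_comm(1)[OF x] in \<open>auto simp: mult_left_le_one_le\<close>)
  also have "\<dots> \<le> (norm x)\<^sup>2" by (rule summable_w_coeff)
  finally show "(norm (cross_comm x))\<^sup>2 \<le> (norm x)\<^sup>2" .
qed simp

lemma cross_comm_add: "x \<in> Q \<Longrightarrow> y \<in> Q \<Longrightarrow> cross_comm (x + y) = cross_comm x + cross_comm y"
proof -
  assume x: "x \<in> Q" and y: "y \<in> Q"
  have "(\<lambda>m. cscale (w_coeff x m * out_coeff m) (out_vec m) + cscale (w_coeff y m * out_coeff m) (out_vec m)) sums (cross_comm x + cross_comm y)"
    by (intro sums_add cross_comm_sums x y)
  moreover have "cscale (w_coeff x m * out_coeff m) (out_vec m) + cscale (w_coeff y m * out_coeff m) (out_vec m) = cscale (w_coeff (x + y) m * out_coeff m) (out_vec m)" for m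
    by (rule ell2_eqI) (simp add: w_coeff_eq cinner_add_left algebra_simps)
  ultimately show "cross_comm (x + y) = cross_comm x + cross_comm y"
    using cross_comm_sums[OF subspace_add[OF subspace_qspace x y]] by (simp add: sums_unique2)
qed

lemma cross_comm_cscale: "x \<in> Q \<Longrightarrow> cross_comm (cscale c x) = cscale c (cross_comm x)"
proof -
  assume x: "x \<in> Q"
  have "(\<lambda>m. cscale c (cscale (w_coeff x m * out_coeff m) (out_vec m))) sums cscale c (cross_comm x)"
    by (rule bounded_linear.sums[OF bounded_linear_cscale cross_comm_sums[OF x]])
  moreover have "cscale c (cscale (w_coeff x m * out_coeff m) (out_vec m)) = cscale (w_coeff (cscale c x) m * out_coeff m) (out_vec m)" for m
    by (rule ell2_eqI) (simp add: w_coeff_eq algebra_simps)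
  ultimately show "cross_comm (cscale c x) = cscale c (cross_comm x)"
    using cross_comm_sums[OF cscale_qspace[OF x, of c]] by (simp add: sums_unique2)
qed

text \<open>Squared Hilbert-Schmidt norm of the m-th rank-one term, which sends \<open>x\<close> to
  \<open>w_coeff x m * out_coeff m\<close> times \<open>out_vec m\<close>.\<close>

definition hs_term :: "nat \<Rightarrow> real" where "hs_term m = weight m * (norm (in_vec m))\<^sup>2"

lemma hs_term_0: "hs_term 0 = (1 - (cmod (coeff q 0))\<^sup>2 / L\<^sup>2) * (1 - (cmod (coeff q D))\<^sup>2 / L\<^sup>2)"
  by (simp add: hs_term_def weight_def norm_out_vec norm_in_vec out_coeff_def kappa_0)

lemma hs_term_Suc: "hs_term (Suc n) = (cmod (alpha n))\<^sup>2 * (1 - (cmod (coeff q 0))\<^sup>2 / L\<^sup>2 * (kappa (Suc n))\<^sup>2)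
    * (1 - (cmod (coeff q D))\<^sup>2 / L\<^sup>2 * (kappa (Suc n))\<^sup>2)"
  by (simp add: hs_term_def weight_def norm_out_vec norm_in_vec out_coeff_def)

lemma hs_term_nonneg: "0 \<le> hs_term m"
  by (simp add: hs_term_def weight_bounds)

lemma norm_in_vec_le: "(norm (in_vec m))\<^sup>2 \<le> 1"
  unfolding norm_in_vec using L_pos by simp

lemma hs_term_0_le: "hs_term 0 \<le> 1"
  unfolding hs_term_def using weight_bounds[of 0] norm_in_vec_le[of 0] by (simp add: mult_le_one)

lemma hs_term_Suc_le: "hs_term (Suc n) \<le> (cmod (alpha n))\<^sup>2"
proof -
  have "(norm (out_vec (Suc n)))\<^sup>2 * (norm (in_vec (Suc n)))\<^sup>2 \<le> 1"
    using norm_out_vec_le[of "Suc n"] norm_in_vec_le[of "Suc n"] by (intro mult_le_one) (auto simp: power_le_one)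
  then have "(cmod (alpha n))\<^sup>2 * ((norm (out_vec (Suc n)))\<^sup>2 * (norm (in_vec (Suc n)))\<^sup>2) \<le> (cmod (alpha n))\<^sup>2 * 1"
    by (intro mult_left_mono) auto
  then show ?thesis by (simp add: hs_term_def weight_def out_coeff_def mult.assoc)
qed

lemma summable_hs_term: "summable hs_term"
proof -
  have "summable (\<lambda>n. hs_term (Suc n))"
    by (rule summable_comparison_test'[OF verblunsky_sums(1)[OF q_nonzero]])
       (simp add: hs_term_nonneg hs_term_Suc_le)
  then show ?thesis by (simp only: summable_Suc_iff)
qed

text \<open>The double family over degrees and basis vectors is nonnegative. Summing over degrees
  first gives the norm of the image of a basis vector; summing over the basis first gives
  \<open>hs_term m\<close> by Parseval for \<open>in_vec m\<close>.\<close>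

lemma hs_sum:
  assumes "E \<subseteq> Q" "\<And>e f. e \<in> E \<Longrightarrow> f \<in> E \<Longrightarrow> cinner e f = (if e = f then 1 else 0)"
    "\<And>x. x \<in> Q \<Longrightarrow> (\<And>e. e \<in> E \<Longrightarrow> cinner x e = 0) \<Longrightarrow> x = 0"
  shows "((\<lambda>e. (norm (cross_comm e))\<^sup>2) has_sum (\<Sum>m. hs_term m)) E"
proof (rule has_sum_swap_nonneg)
  show "((\<lambda>e. weight m * (cmod (w_coeff e m))\<^sup>2) has_sum hs_term m) E" for m
  proof -
    have "((\<lambda>e. (cmod (cinner (in_vec m) e))\<^sup>2) has_sum (norm (in_vec m))\<^sup>2) E"
      by (rule parseval_ell2[OF closed_qspace subspace_qspace cscale_qspace assms in_vec_Q])
    moreover have "cmod (cinner (in_vec m) e) = cmod (w_coeff e m)" for e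
      unfolding w_coeff_eq by (metis cinner_commute complex_mod_cnj)
    ultimately show ?thesis unfolding hs_term_def by (intro has_sum_cmult_right) simp
  qed
  show "(hs_term has_sum (\<Sum>m. hs_term m)) UNIV"
    using summable_sums[OF summable_hs_term] hs_term_nonneg by (intro sums_nonneg_imp_has_sum)
  show "((\<lambda>m. weight m * (cmod (w_coeff e m))\<^sup>2) has_sum (norm (cross_comm e))\<^sup>2) UNIV" if "e \<in> E" for e
  proof -
    have e: "e \<in> Q" using that assms(1) by blast
    have "(\<lambda>m. weight m * (cmod (w_coeff e m))\<^sup>2) sums (norm (cross_comm e))\<^sup>2"
      unfolding norm_cross_comm(2)[OF e] by (rule summable_sums[OF norm_cross_comm(1)[OF e]])
    then show ?thesis by (intro sums_nonneg_imp_has_sum) (simp_all add: weight_bounds)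
  qed
qed (simp add: weight_bounds)

lemma
  assumes p: "quotient_module p = hfun ` Q"
  shows hilbert_schmidt_cross_commutator: "hilbert_schmidt_on (quotient_module p) (cross_commutator p)"
    and hs_norm_cross_commutator: "(hs_norm (quotient_module p) (cross_commutator p))\<^sup>2 = (\<Sum>m. hs_term m)"
proof -
  note cc = cross_commutator_hfun[OF p]
  have bounded: "bounded_operator_on (quotient_module p) (cross_commutator p)"
    unfolding bounded_operator_on_def p
  proof (intro conjI ballI allI)
    show "cross_commutator p f \<in> hfun ` Q" if "f \<in> hfun ` Q" for f
      using that cc cross_comm_Q by auto
    show "cross_commutator p (\<lambda>x. f x + g x) = (\<lambda>x. cross_commutator p f x + cross_commutator p g x)"
      if "f \<in> hfun ` Q" "g \<in> hfun ` Q" for f g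
      using that by (auto simp: cc cross_comm_add subspace_add[OF subspace_qspace] simp flip: hfun_add)
    show "cross_commutator p (\<lambda>x. c * f x) = (\<lambda>x. c * cross_commutator p f x)" if "f \<in> hfun ` Q" for c f
      using that by (auto simp: cc cross_comm_cscale cscale_qspace simp flip: hfun_cscale)
    show "\<exists>C. \<forall>f\<in>hfun ` Q. hnorm (cross_commutator p f) \<le> C * hnorm f"
      by (rule exI[of _ 1]) (auto simp: cc hnorm_hfun norm_cross_comm_le)
  qed
  \<comment> \<open>Proved for every orthonormal basis, so that it holds in particular for the one
    selected by \<open>SOME\<close> in \<open>hs_norm\<close>.\<close>
  have sum: "((\<lambda>e. (hnorm (cross_commutator p e))\<^sup>2) has_sum (\<Sum>m. hs_term m)) F"
    if F: "orthonormal_basis (quotient_module p) F" for F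
  proof -
    have "F \<subseteq> hfun ` Q" using F by (simp add: orthonormal_basis_def p)
    then obtain E where E: "E \<subseteq> Q" "F = hfun ` E" by (metis subset_imageE)
    have on: "cinner e f = (if e = f then 1 else 0)" if "e \<in> E" "f \<in> E" for e f
      using F that unfolding p E(2) orthonormal_basis_hfun_iff by blast
    have complete: "x = 0" if "x \<in> Q" "\<And>e. e \<in> E \<Longrightarrow> cinner x e = 0" for x
      using F that unfolding p E(2) orthonormal_basis_hfun_iff by blast
    have "((\<lambda>e. (norm (cross_comm e))\<^sup>2) has_sum (\<Sum>m. hs_term m)) E"
      by (rule hs_sum[OF E(1) on complete])
    then have "((\<lambda>e. (hnorm (cross_commutator p (hfun e)))\<^sup>2) has_sum (\<Sum>m. hs_term m)) E"
      by (rule has_sum_cong[THEN iffD1, rotated]) (use E(1) in \<open>auto simp: cc hnorm_hfun\<close>)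
    then show ?thesis
      unfolding E(2) using has_sum_reindex[OF inj_on_subset[OF inj_hfun subset_UNIV],
        where g = "\<lambda>e. (hnorm (cross_commutator p e))\<^sup>2"]
      by (simp add: o_def)
  qed
  have "\<exists>E. orthonormal_basis (quotient_module p) (hfun ` E)"
    unfolding p orthonormal_basis_hfun_iff by (rule orthonormal_basis_ell2_exists[OF subspace_qspace])
  then obtain E where ex: "orthonormal_basis (quotient_module p) (hfun ` E)" ..
  show "hilbert_schmidt_on (quotient_module p) (cross_commutator p)"
    unfolding hilbert_schmidt_on_def using bounded ex has_sum_imp_summable[OF sum[OF ex]] by blast
  have "orthonormal_basis (quotient_module p) (SOME F. orthonormal_basis (quotient_module p) F)"
    using ex by (rule someI)
  from infsumI[OF sum[OF this]] show "(hs_norm (quotient_module p) (cross_commutator p))\<^sup>2 = (\<Sum>m. hs_term m)"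
    unfolding hs_norm_def by (simp add: suminf_nonneg[OF summable_hs_term hs_term_nonneg])
qed

end

theorem corollary6p6:
  fixes p :: "complex poly poly" and q :: "complex poly" and D :: nat
    and a b :: real and \<alpha> :: "nat \<Rightarrow> complex" and \<kappa> :: "nat \<Rightarrow> real"
  assumes "p \<noteq> 0" and "homogeneous2 D p" and "D \<ge> 1"
    and "q = poly p 1"
    and "a = (cmod (coeff q 0))\<^sup>2 / (L2_norm_circle q)\<^sup>2"
    and "b = (cmod (coeff q D))\<^sup>2 / (L2_norm_circle q)\<^sup>2"
    and "\<alpha> = verblunsky (circle_measure q)"
    and "\<kappa> = op_kappa (circle_measure q)"
  shows "hilbert_schmidt_on (quotient_module p) (cross_commutator p)
    \<and> summable (\<lambda>n. (cmod (\<alpha> n))\<^sup>2 * (1 - a * (\<kappa> (Suc n))\<^sup>2) * (1 - b * (\<kappa> (Suc n))\<^sup>2))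
    \<and> (hs_norm (quotient_module p) (cross_commutator p))\<^sup>2 = (1 - a) * (1 - b)
         + (\<Sum>n. (cmod (\<alpha> n))\<^sup>2 * (1 - a * (\<kappa> (Suc n))\<^sup>2) * (1 - b * (\<kappa> (Suc n))\<^sup>2))
    \<and> summable (\<lambda>n. (cmod (\<alpha> n))\<^sup>2)
    \<and> (hs_norm (quotient_module p) (cross_commutator p))\<^sup>2 \<le> 1 + (\<Sum>n. (cmod (\<alpha> n))\<^sup>2)
    \<and> 1 + (\<Sum>n. (cmod (\<alpha> n))\<^sup>2) \<le> 1 + ln ((L2_norm_circle q)\<^sup>2 / (mahler_measure q)\<^sup>2)
    \<and> 1 + ln ((L2_norm_circle q)\<^sup>2 / (mahler_measure q)\<^sup>2) \<le> 1 + ln (real ((2 * D) choose D))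
    \<and> 1 + ln (real ((2 * D) choose D)) < 1 + 2 * real D * ln 2"
proof -
  have pq: "p = homogenize D q" "degree q \<le> D"
    using homogeneous2_eq_homogenize[OF assms(2)] assms(4) by auto
  have "q \<noteq> 0"
  proof
    assume "q = 0"
    then have "p = 0" by (intro poly_eqI) (subst pq(1), simp add: coeff_homogenize)
    with assms(1) show False by simp
  qed
  then interpret homogeneous_quotient D q
    using pq(2) by unfold_locales
  have qm: "quotient_module p = hfun ` Q" by (rule quotient_module_eq[OF assms(2,4)])
  let ?t = "\<lambda>n. (cmod (\<alpha> n))\<^sup>2 * (1 - a * (\<kappa> (Suc n))\<^sup>2) * (1 - b * (\<kappa> (Suc n))\<^sup>2)"
  have t: "hs_term (Suc n) = ?t n" for n
    unfolding hs_term_Suc assms(5-8) ..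
  have t0: "hs_term 0 = (1 - a) * (1 - b)"
    unfolding hs_term_0 assms(5,6) ..
  have summ: "summable ?t"
    using summable_hs_term summable_Suc_iff[of hs_term] by (simp only: t)
  have hs: "(hs_norm (quotient_module p) (cross_commutator p))\<^sup>2 = (1 - a) * (1 - b) + (\<Sum>n. ?t n)"
    unfolding hs_norm_cross_commutator[OF qm] suminf_split_head[OF summable_hs_term, THEN eq_diff_eq[THEN iffD1], symmetric] t t0
    by simp
  have v: "summable (\<lambda>n. (cmod (\<alpha> n))\<^sup>2)"
    "(\<Sum>n. (cmod (\<alpha> n))\<^sup>2) \<le> ln (L\<^sup>2 / (mahler_measure q)\<^sup>2)"
    unfolding assms(7) by (rule verblunsky_sums[OF \<open>q \<noteq> 0\<close>])+
  \<comment> \<open>The factors involving \<open>a\<close> and \<open>b\<close> are squared norms of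
    backward shifts of unit vectors, hence lie between 0 and 1.\<close>
  have "(\<Sum>n. ?t n) \<le> (\<Sum>n. (cmod (\<alpha> n))\<^sup>2)"
  proof (rule suminf_le[OF _ summ v(1)])
    show "?t n \<le> (cmod (\<alpha> n))\<^sup>2" for n
      using hs_term_Suc_le[of n] unfolding t assms(7) .
  qed
  moreover have "(1 - a) * (1 - b) \<le> 1" using hs_term_0_le unfolding t0 .
  ultimately have le1: "(hs_norm (quotient_module p) (cross_commutator p))\<^sup>2 \<le> 1 + (\<Sum>n. (cmod (\<alpha> n))\<^sup>2)"
    unfolding hs by linarith
  have M: "(mahler_measure q)\<^sup>2 > 0" using mahler_measure_pos[of q] by simp
  have L2: "L\<^sup>2 > 0" using L_pos by simp
  have "L\<^sup>2 / (mahler_measure q)\<^sup>2 \<le> real ((2 * D) choose D)"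
    using L2_norm_le_mahler_measure[OF \<open>q \<noteq> 0\<close> pq(2)] M by (simp add: divide_le_eq)
  then have le2: "ln (L\<^sup>2 / (mahler_measure q)\<^sup>2) \<le> ln (real ((2 * D) choose D))"
    using M L2 by (intro ln_mono) auto
  have "ln (real ((2 * D) choose D)) < ln (4 ^ D)"
    using central_binomial_less[OF assms(3)] by (subst ln_less_cancel_iff) auto
  also have "ln (4 ^ D :: real) = 2 * real D * ln 2"
  proof -
    have "(4 :: real) ^ D = 2 ^ (2 * D)" by (simp add: power_mult)
    then show ?thesis by (simp add: ln_realpow)
  qed
  finally have le3: "ln (real ((2 * D) choose D)) < 2 * real D * ln 2" .
  show ?thesis
    using hilbert_schmidt_cross_commutator[OF qm] summ hs v le1 le2 le3 by simp
qed

end
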